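(* Let $G,H$ be Lie groups with Lie algebras $\mathfrak g,\mathfrak h$, let $\Phi:G\to\mathrm{Aut}(H)$ be an action with differentiated action $\phi:\mathfrak g\to\mathrm{Der}(\mathfrak h)$, let $\mathcal B:H\to G$ be a relative Rota-Baxter operator on $G$ with respect to $(H;\Phi)$, and let $B=\mathcal B_{*e_H}$. Define $\mathsf{VE}:C^k(\mathcal B)\to C^k(B)$, $k\ge1$, by $$\mathsf{VE}(F)(u_1,\dots,u_{k-1})=\sum_{s\in S_{k-1}}(-1)^{|s|}\frac{d}{dt_{s(1)}}\cdots\frac{d}{dt_{s(k-1)}}\bigg|_{t_{s(1)}=\cdots=t_{s(k-1)}=0}F\big(\mathrm{Exp}(t_{s(1)}u_{s(1)}),\dots,\mathrm{Exp}(t_{s(k-1)}u_{s(k-1)})\big)$$ for $F\in C^k(\mathcal B)$ and $u_1,\dots,u_{k-1}\in\mathfrak h$. Then $\mathsf{VE}$ is a cochain map from $(C^*(\mathcal B),\mathrm d^{\mathcal B})$ to $(C^*(B),\mathrm d^{B}_{CE})$, i.e. $\mathsf{VE}\circ\mathrm d^{\mathcal B}=\mathrm d^B_{CE}\circ\mathsf{VE}$. Consequently $\mathsf{VE}$ induces a homomorphism $\mathsf{VE}_*$ from the cohomology group $\mathcal H^k(\mathcal B)$ to $H^k(B)$.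
   Context: Lie groups are real and finite-dimensional. An action of $G$ on $H$ is a group homomorphism $\Phi:G\to\mathrm{Aut}(H)$ into the Lie group automorphisms of $H$ such that $(g,h)\mapsto\Phi(g)h$ is smooth. A relative Rota-Baxter operator on $G$ with respect to $(H;\Phi)$ is a smooth map $\mathcal B:H\to G$ with $\mathcal B(h_1)\cdot_G\mathcal B(h_2)=\mathcal B(h_1\cdot_H\Phi(\mathcal B(h_1))h_2)$. Its descendent Lie group is the manifold $H$ with multiplication $h_1\star h_2=h_1\cdot_H\Phi(\mathcal B(h_1))h_2$, unit $e_H$, inverse $h^\dagger=\Phi(\mathcal B(h)^{-1})h^{-1}$. $\mathrm{Exp}$ is the exponential map of the Lie group $(H,e_H,\star)$, $S_{k-1}$ is the symmetric group and $(-1)^{|s|}$ the sign of $s$. The descendent Lie group acts linearly on $\mathfrak g$ by $\Theta(h)=$ the tangent map at $e_G$ of $G\to G$, $g\mapsto(\mathcal B(\Phi(g)h^\dagger))^{-1}\cdot_G g\cdot_G\mathcal B(h^\dagger)$ (this map fixes $e_G$). Cohomology of $\mathcal B$: $C^k(\mathcal B)$ is the space of smooth maps $H^{k-1}\to\mathfrak g$ ($k\ge 1$, $C^1(\mathcal B)=\mathfrak g$), with the group cohomology differential of $(H,\star)$ with coefficients in $(\mathfrak g,\Theta)$: for $\alpha:H^n\to\mathfrak g$, $$\mathrm d^{\mathcal B}\alpha(h_1,\dots,h_{n+1})=\Theta(h_1)\alpha(h_2,\dots,h_{n+1})+\sum_{i=1}^n(-1)^i\alpha(h_1,\dots,h_i\star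 h_{i+1},\dots,h_{n+1})+(-1)^{n+1}\alpha(h_1,\dots,h_n).$$ $\mathcal H^k(\mathcal B)$ is the $k$-th cohomology of $(C^*(\mathcal B),\mathrm d^{\mathcal B})$. Differentiated action: $\tilde\Phi(g)=\Phi(g)_{*e_H}$, $\phi:=\tilde\Phi_{*e_G}:\mathfrak g\to\mathrm{Der}(\mathfrak h)$. $B=\mathcal B_{*e_H}$ is a relative Rota-Baxter operator of weight $1$ on $\mathfrak g$ with respect to $(\mathfrak h;\phi)$, i.e. $[B(u),B(v)]_{\mathfrak g}=B(\phi(B(u))v-\phi(B(v))u+[u,v]_{\mathfrak h})$. Cohomology of $B$: with $[u,v]_B=\phi(B(u))v-\phi(B(v))u+[u,v]_{\mathfrak h}$ and $\theta(u)x=B(\phi(x)u)+[B(u),x]_{\mathfrak g}$ (a representation of the Lie algebra $(\mathfrak h,[\cdot,\cdot]_B)$ on $\mathfrak g$), $C^k(B)=\mathrm{Hom}(\wedge^{k-1}\mathfrak h,\mathfrak g)$ with the Chevalley-Eilenberg differential, for $f\in\mathrm{Hom}(\wedge^n\mathfrak h,\mathfrak g)$, $$\mathrm d^B_{CE}f(u_1,\dots,u_{n+1})=\sum_{i}(-1)^{i+1}\theta(u_i)f(u_1,\dots,\hat u_i,\dots,u_{n+1})+\sum_{i<j}(-1)^{i+j}f([u_i,u_j]_B,u_1,\dots,\hat u_i,\dots,\hat u_j,\dots,u_{n+1}).$$ $H^k(B)$ is its $k$-th cohomology. *)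

theory Defs
  imports
    "HOL-Analysis.Analysis"
    "HOL-Combinatorics.Permutations"
    "HOL-Algebra.Coset"
begin

section \<open>Smooth maps between open subsets of normed spaces\<close>

text \<open>
  Continuity of all iterated directional derivatives; this is the usual notion of class
  \<open>C^k\<close> when the source is finite-dimensional, which is the only case in which it is used.
\<close>

primrec Ck_on :: "nat \<Rightarrow> 'a::real_normed_vector set \<Rightarrow> ('a \<Rightarrow> 'b::real_normed_vector) \<Rightarrow> bool" where
  "Ck_on 0 S f \<longleftrightarrow> continuous_on S f"
| "Ck_on (Suc k) S f \<longleftrightarrow> continuous_on S f \<and> (\<forall>x\<in>S. f differentiable (at x)) \<and>
     (\<forall>v. Ck_on k S (\<lambda>x. frechet_derivative f (at x) v))"

definition smooth_on :: "'a::real_normed_vector set \<Rightarrow> ('a \<Rightarrow> 'b::real_normed_vector) \<Rightarrow> bool" where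
  "smooth_on S f \<longleftrightarrow> (\<forall>k. Ck_on k S f)"

text \<open>
  The same notion on an open subset of the \<open>n\<close>-fold power of a vector space, with \<open>n\<close> a variable.
  The power is represented by \<open>nat \<Rightarrow> 'a\<close> with the product topology, of which only the coordinates
  below \<open>n\<close> matter; the derivatives taken are the partial ones in each of these coordinates.
\<close>

primrec Ck_pow_on ::
  "nat \<Rightarrow> nat \<Rightarrow> (nat \<Rightarrow> 'a::real_normed_vector) set \<Rightarrow> ((nat \<Rightarrow> 'a) \<Rightarrow> 'b::real_normed_vector) \<Rightarrow> bool" where
  "Ck_pow_on 0 n S f \<longleftrightarrow> continuous_on S f"
| "Ck_pow_on (Suc k) n S f \<longleftrightarrow> continuous_on S f \<and>
     (\<forall>i<n. (\<forall>x\<in>S. (\<lambda>y. f (x(i := y))) differentiable (at (x i))) \<and>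
       (\<forall>v. Ck_pow_on k n S (\<lambda>x. frechet_derivative (\<lambda>y. f (x(i := y))) (at (x i)) v)))"

definition smooth_pow_on ::
  "nat \<Rightarrow> (nat \<Rightarrow> 'a::real_normed_vector) set \<Rightarrow> ((nat \<Rightarrow> 'a) \<Rightarrow> 'b::real_normed_vector) \<Rightarrow> bool" where
  "smooth_pow_on n S f \<longleftrightarrow> (\<forall>k. Ck_pow_on k n S f)"


section \<open>Smooth manifolds\<close>

text \<open>A chart is a pair of its domain and its coordinate map, whose values off the domain are irrelevant.\<close>

type_synonym ('m, 'e) chart = "'m set \<times> ('m \<Rightarrow> 'e)"

abbreviation chart_dom :: "('m, 'e) chart \<Rightarrow> 'm set" where
  "chart_dom c \<equiv> fst c"

abbreviation chart_map :: "('m, 'e) chart \<Rightarrow> 'm \<Rightarrow> 'e" where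
  "chart_map c \<equiv> snd c"

abbreviation chart_ran :: "('m, 'e) chart \<Rightarrow> 'e set" where
  "chart_ran c \<equiv> chart_map c ` chart_dom c"

definition chart_inv :: "('m, 'e) chart \<Rightarrow> 'e \<Rightarrow> 'm" where
  "chart_inv c = inv_into (chart_dom c) (chart_map c)"

definition is_chart :: "('m::topological_space, 'e::real_normed_vector) chart \<Rightarrow> bool" where
  "is_chart c \<longleftrightarrow> open (chart_dom c) \<and> open (chart_ran c) \<and>
     homeomorphism (chart_dom c) (chart_ran c) (chart_map c) (chart_inv c)"

text \<open>
  The model space is any finite-dimensional real inner product space. The class
  \<open>euclidean_space\<close> is not used because it excludes dimension \<open>0\<close>; class \<open>banach\<close> is no
  restriction in finite dimension.
\<close>

definition smooth_manifold ::
  "('m::{t2_space, second_countable_topology}, 'e::{real_inner, banach}) chart set \<Rightarrow> bool" where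
  "smooth_manifold A \<longleftrightarrow>
     (\<exists>E::'e set. finite E \<and> span E = UNIV) \<and>
     (\<forall>c\<in>A. is_chart c) \<and>
     (\<Union>c\<in>A. chart_dom c) = UNIV \<and>
     (\<forall>c\<in>A. \<forall>d\<in>A. smooth_on (chart_map c ` (chart_dom c \<inter> chart_dom d)) (chart_map d \<circ> chart_inv c))"

definition smooth_map ::
  "('m::topological_space, 'e::real_normed_vector) chart set \<Rightarrow>
   ('n::topological_space, 'f::real_normed_vector) chart set \<Rightarrow> ('m \<Rightarrow> 'n) \<Rightarrow> bool" where
  "smooth_map A A' f \<longleftrightarrow> continuous_on UNIV f \<and>
     (\<forall>c\<in>A. \<forall>d\<in>A'. smooth_on (chart_map c ` (chart_dom c \<inter> f -` chart_dom d))
        (chart_map d \<circ> f \<circ> chart_inv c))"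

definition prod_atlas ::
  "('m, 'e) chart set \<Rightarrow> ('n, 'f) chart set \<Rightarrow> ('m \<times> 'n, 'e \<times> 'f) chart set" where
  "prod_atlas A A' =
     {(chart_dom c \<times> chart_dom d, map_prod (chart_map c) (chart_map d)) | c d. c \<in> A \<and> d \<in> A'}"

definition vec_atlas :: "('e, 'e) chart set" where
  "vec_atlas = {(UNIV, id)}"

text \<open>
  Functions on the \<open>n\<close>-fold power of a set are functions of a sequence depending only on its
  first \<open>n\<close> entries; for \<open>n = 0\<close> these are the constants.
\<close>

definition depends_on_first :: "nat \<Rightarrow> ((nat \<Rightarrow> 'm) \<Rightarrow> 'v) \<Rightarrow> bool" where
  "depends_on_first n F \<longleftrightarrow> (\<forall>h h'. (\<forall>i<n. h i = h' i) \<longrightarrow> F h = F h')"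

definition smooth_pow_map ::
  "nat \<Rightarrow> ('m, 'e::real_normed_vector) chart set \<Rightarrow> ((nat \<Rightarrow> 'm) \<Rightarrow> 'v::real_normed_vector) \<Rightarrow> bool" where
  "smooth_pow_map n A F \<longleftrightarrow> depends_on_first n F \<and>
     (\<forall>c. (\<forall>i<n. c i \<in> A) \<longrightarrow>
        smooth_pow_on n {x. \<forall>i<n. x i \<in> chart_ran (c i)} (\<lambda>x. F (\<lambda>i. chart_inv (c i) (x i))))"


section \<open>Lie groups\<close>

record ('m, 'e) lie_struct = "'m monoid" +
  atlas :: "('m, 'e) chart set"

definition lie_group ::
  "('m::{t2_space, second_countable_topology}, 'e::{real_inner, banach}) lie_struct \<Rightarrow> bool" where
  "lie_group G \<longleftrightarrow> Group.group G \<and> carrier G = UNIV \<and> smooth_manifold (atlas G) \<and>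
     smooth_map (prod_atlas (atlas G) (atlas G)) (atlas G) (\<lambda>(x, y). x \<otimes>\<^bsub>G\<^esub> y) \<and>
     smooth_map (atlas G) (atlas G) (\<lambda>x. inv\<^bsub>G\<^esub> x)"

text \<open>
  The tangent space at the unit, hence the Lie algebra, is identified with the model space: a fixed
  chart \<open>c\<close> around the unit sends the class of a curve \<open>\<gamma>\<close> through the unit to \<open>(c \<circ> \<gamma>)'(0)\<close>.
  The choice depends on the atlas and the unit only, so that two Lie group structures
  on one manifold with the same unit have the same tangent space at the unit.
\<close>

definition unit_chart :: "('m, 'e) lie_struct \<Rightarrow> ('m, 'e) chart" where
  "unit_chart G = (SOME c. c \<in> atlas G \<and> \<one>\<^bsub>G\<^esub> \<in> chart_dom c)"

abbreviation unit_coord :: "('m, 'e) lie_struct \<Rightarrow> 'e" where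
  "unit_coord G \<equiv> chart_map (unit_chart G) \<one>\<^bsub>G\<^esub>"

text \<open>Tangent map at the unit of a map \<open>f\<close> that sends the unit to the unit.\<close>

definition tangent_map_unit ::
  "('m, 'e::real_normed_vector) lie_struct \<Rightarrow> ('n, 'f::real_normed_vector) lie_struct \<Rightarrow>
   ('m \<Rightarrow> 'n) \<Rightarrow> 'e \<Rightarrow> 'f" where
  "tangent_map_unit G H f =
     frechet_derivative (chart_map (unit_chart H) \<circ> f \<circ> chart_inv (unit_chart G)) (at (unit_coord G))"

text \<open>
  In the chart around the unit, the left-invariant vector field with value \<open>x\<close> at the unit; then
  the bracket of two such vector fields, \<open>[X, Y] = DY(X) - DX(Y)\<close>, at the unit.
\<close>

definition left_inv_field ::
  "('m, 'e::real_normed_vector) lie_struct \<Rightarrow> 'e \<Rightarrow> 'e \<Rightarrow> 'e" where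
  "left_inv_field G x p =
     (let c = unit_chart G in
      frechet_derivative (\<lambda>q. chart_map c (chart_inv c p \<otimes>\<^bsub>G\<^esub> chart_inv c q)) (at (unit_coord G)) x)"

definition lie_bracket ::
  "('m, 'e::real_normed_vector) lie_struct \<Rightarrow> 'e \<Rightarrow> 'e \<Rightarrow> 'e" where
  "lie_bracket G x y =
     (let e = unit_coord G; X = left_inv_field G x; Y = left_inv_field G y in
      frechet_derivative Y (at e) (X e) - frechet_derivative X (at e) (Y e))"

definition one_parameter_subgroup ::
  "('m::topological_space, 'e::real_normed_vector) lie_struct \<Rightarrow> 'e \<Rightarrow> (real \<Rightarrow> 'm) \<Rightarrow> bool" where
  "one_parameter_subgroup G u \<gamma> \<longleftrightarrow> smooth_map vec_atlas (atlas G) \<gamma> \<and>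
     (\<forall>s t. \<gamma> (s + t) = \<gamma> s \<otimes>\<^bsub>G\<^esub> \<gamma> t) \<and>
     ((chart_map (unit_chart G) \<circ> \<gamma>) has_vector_derivative u) (at 0)"

definition lie_exp ::
  "('m::topological_space, 'e::real_normed_vector) lie_struct \<Rightarrow> 'e \<Rightarrow> 'm" where
  "lie_exp G u = (THE \<gamma>. one_parameter_subgroup G u \<gamma>) 1"


section \<open>Actions and relative Rota-Baxter operators\<close>

definition lie_automorphism ::
  "('h::topological_space, 'b::real_normed_vector) lie_struct \<Rightarrow> ('h \<Rightarrow> 'h) \<Rightarrow> bool" where
  "lie_automorphism H f \<longleftrightarrow> f \<in> iso H H \<and> smooth_map (atlas H) (atlas H) f \<and>
     smooth_map (atlas H) (atlas H) (inv_into UNIV f)"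

definition lie_action ::
  "('g::topological_space, 'a::real_normed_vector) lie_struct \<Rightarrow>
   ('h::topological_space, 'b::real_normed_vector) lie_struct \<Rightarrow> ('g \<Rightarrow> 'h \<Rightarrow> 'h) \<Rightarrow> bool" where
  "lie_action G H \<Phi> \<longleftrightarrow> (\<forall>g. lie_automorphism H (\<Phi> g)) \<and>
     (\<forall>g g'. \<Phi> (g \<otimes>\<^bsub>G\<^esub> g') = \<Phi> g \<circ> \<Phi> g') \<and>
     smooth_map (prod_atlas (atlas G) (atlas H)) (atlas H) (\<lambda>(g, h). \<Phi> g h)"

definition rel_rota_baxter ::
  "('g::topological_space, 'a::real_normed_vector) lie_struct \<Rightarrow>
   ('h::topological_space, 'b::real_normed_vector) lie_struct \<Rightarrow>
   ('g \<Rightarrow> 'h \<Rightarrow> 'h) \<Rightarrow> ('h \<Rightarrow> 'g) \<Rightarrow> bool" where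
  "rel_rota_baxter G H \<Phi> \<B> \<longleftrightarrow> smooth_map (atlas H) (atlas G) \<B> \<and>
     (\<forall>h1 h2. \<B> h1 \<otimes>\<^bsub>G\<^esub> \<B> h2 = \<B> (h1 \<otimes>\<^bsub>H\<^esub> \<Phi> (\<B> h1) h2))"

definition descendent ::
  "('h, 'b) lie_struct \<Rightarrow> ('g \<Rightarrow> 'h \<Rightarrow> 'h) \<Rightarrow> ('h \<Rightarrow> 'g) \<Rightarrow> ('h, 'b) lie_struct" where
  "descendent H \<Phi> \<B> = H\<lparr>mult := \<lambda>h1 h2. h1 \<otimes>\<^bsub>H\<^esub> \<Phi> (\<B> h1) h2\<rparr>"

definition dagger ::
  "('g, 'a) lie_struct \<Rightarrow> ('h, 'b) lie_struct \<Rightarrow> ('g \<Rightarrow> 'h \<Rightarrow> 'h) \<Rightarrow> ('h \<Rightarrow> 'g) \<Rightarrow> 'h \<Rightarrow> 'h" where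
  "dagger G H \<Phi> \<B> h = \<Phi> (inv\<^bsub>G\<^esub> (\<B> h)) (inv\<^bsub>H\<^esub> h)"

definition Theta ::
  "('g, 'a::real_normed_vector) lie_struct \<Rightarrow> ('h, 'b) lie_struct \<Rightarrow>
   ('g \<Rightarrow> 'h \<Rightarrow> 'h) \<Rightarrow> ('h \<Rightarrow> 'g) \<Rightarrow> 'h \<Rightarrow> 'a \<Rightarrow> 'a" where
  "Theta G H \<Phi> \<B> h = tangent_map_unit G G
     (\<lambda>g. inv\<^bsub>G\<^esub> (\<B> (\<Phi> g (dagger G H \<Phi> \<B> h))) \<otimes>\<^bsub>G\<^esub> g \<otimes>\<^bsub>G\<^esub> \<B> (dagger G H \<Phi> \<B> h))"

text \<open>
  The tangent map at the unit of \<open>G\<close> of the map from \<open>G\<close> to the normed space of bounded linear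
  endomorphisms of the Lie algebra of \<open>H\<close> that sends \<open>g\<close> to the tangent map of \<open>\<Phi> g\<close> at the unit.
\<close>

definition diff_action ::
  "('g, 'a::real_normed_vector) lie_struct \<Rightarrow> ('h, 'b::real_normed_vector) lie_struct \<Rightarrow>
   ('g \<Rightarrow> 'h \<Rightarrow> 'h) \<Rightarrow> 'a \<Rightarrow> 'b \<Rightarrow> 'b" where
  "diff_action G H \<Phi> x = blinfun_apply
     (frechet_derivative (\<lambda>p. Blinfun (tangent_map_unit H H (\<Phi> (chart_inv (unit_chart G) p))))
        (at (unit_coord G)) x)"


section \<open>Cochain complexes and their cohomology\<close>

text \<open>
  Complexes start in degree \<open>1\<close>: there is no coboundary but \<open>0\<close> in degree \<open>1\<close>.
\<close>

definition cocycles ::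
  "(nat \<Rightarrow> ('x \<Rightarrow> 'v::real_vector) set) \<Rightarrow> (nat \<Rightarrow> ('x \<Rightarrow> 'v) \<Rightarrow> 'x \<Rightarrow> 'v) \<Rightarrow> nat \<Rightarrow> ('x \<Rightarrow> 'v) set" where
  "cocycles C d k = {F \<in> C k. d k F = (\<lambda>_. 0)}"

definition coboundaries ::
  "(nat \<Rightarrow> ('x \<Rightarrow> 'v::real_vector) set) \<Rightarrow> (nat \<Rightarrow> ('x \<Rightarrow> 'v) \<Rightarrow> 'x \<Rightarrow> 'v) \<Rightarrow> nat \<Rightarrow> ('x \<Rightarrow> 'v) set" where
  "coboundaries C d k = (if k \<le> 1 then {\<lambda>_. 0} else d (k - 1) ` C (k - 1))"

definition cocycle_group ::
  "(nat \<Rightarrow> ('x \<Rightarrow> 'v::real_vector) set) \<Rightarrow> (nat \<Rightarrow> ('x \<Rightarrow> 'v) \<Rightarrow> 'x \<Rightarrow> 'v) \<Rightarrow> nat \<Rightarrow> ('x \<Rightarrow> 'v) monoid" where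
  "cocycle_group C d k =
     \<lparr>carrier = cocycles C d k, mult = \<lambda>F F' x. F x + F' x, one = \<lambda>_. 0\<rparr>"

definition cohomology ::
  "(nat \<Rightarrow> ('x \<Rightarrow> 'v::real_vector) set) \<Rightarrow> (nat \<Rightarrow> ('x \<Rightarrow> 'v) \<Rightarrow> 'x \<Rightarrow> 'v) \<Rightarrow> nat \<Rightarrow> ('x \<Rightarrow> 'v) set monoid" where
  "cohomology C d k = cocycle_group C d k Mod coboundaries C d k"

definition cohomology_class ::
  "(nat \<Rightarrow> ('x \<Rightarrow> 'v::real_vector) set) \<Rightarrow> (nat \<Rightarrow> ('x \<Rightarrow> 'v) \<Rightarrow> 'x \<Rightarrow> 'v) \<Rightarrow> nat \<Rightarrow>
   ('x \<Rightarrow> 'v) \<Rightarrow> ('x \<Rightarrow> 'v) set" where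
  "cohomology_class C d k F = coboundaries C d k #>\<^bsub>cocycle_group C d k\<^esub> F"

definition cochain_map ::
  "(nat \<Rightarrow> ('x \<Rightarrow> 'v::real_vector) set) \<Rightarrow> (nat \<Rightarrow> ('x \<Rightarrow> 'v) \<Rightarrow> 'x \<Rightarrow> 'v) \<Rightarrow>
   (nat \<Rightarrow> ('y \<Rightarrow> 'w::real_vector) set) \<Rightarrow> (nat \<Rightarrow> ('y \<Rightarrow> 'w) \<Rightarrow> 'y \<Rightarrow> 'w) \<Rightarrow>
   (nat \<Rightarrow> ('x \<Rightarrow> 'v) \<Rightarrow> 'y \<Rightarrow> 'w) \<Rightarrow> bool" where
  "cochain_map C d C' d' V \<longleftrightarrow> (\<forall>k\<ge>1.
     (\<forall>F\<in>C k. V k F \<in> C' k) \<and>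
     (\<forall>F\<in>C k. \<forall>F'\<in>C k. \<forall>a b. V k (\<lambda>x. a *\<^sub>R F x + b *\<^sub>R F' x) = (\<lambda>y. a *\<^sub>R V k F y + b *\<^sub>R V k F' y)) \<and>
     (\<forall>F\<in>C k. V (k + 1) (d k F) = d' k (V k F)))"


section \<open>The two complexes of a relative Rota-Baxter operator\<close>

text \<open>
  Cochains of degree \<open>k\<close> have \<open>k - 1\<close> arguments, which are numbered from \<open>0\<close>.
\<close>

definition rb_cochains ::
  "('h, 'b::real_normed_vector) lie_struct \<Rightarrow> nat \<Rightarrow> ((nat \<Rightarrow> 'h) \<Rightarrow> 'a::real_normed_vector) set" where
  "rb_cochains H k = {F. smooth_pow_map (k - 1) (atlas H) F}"

text \<open>
  \<open>merge m i h\<close> is \<open>h\<close> with the \<open>i\<close>-th and \<open>(i+1)\<close>-st entries, counted from \<open>1\<close>, multiplied.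
\<close>

definition merge :: "('h \<Rightarrow> 'h \<Rightarrow> 'h) \<Rightarrow> nat \<Rightarrow> (nat \<Rightarrow> 'h) \<Rightarrow> nat \<Rightarrow> 'h" where
  "merge m i h = (\<lambda>j. if j + 1 < i then h j else if j + 1 = i then m (h j) (h (j + 1)) else h (j + 1))"

definition rb_d ::
  "('g, 'a::real_normed_vector) lie_struct \<Rightarrow> ('h, 'b) lie_struct \<Rightarrow> ('g \<Rightarrow> 'h \<Rightarrow> 'h) \<Rightarrow> ('h \<Rightarrow> 'g) \<Rightarrow>
   nat \<Rightarrow> ((nat \<Rightarrow> 'h) \<Rightarrow> 'a) \<Rightarrow> (nat \<Rightarrow> 'h) \<Rightarrow> 'a" where
  "rb_d G H \<Phi> \<B> k \<alpha> h =
     (let n = k - 1 in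
      Theta G H \<Phi> \<B> (h 0) (\<alpha> (\<lambda>j. h (j + 1)))
      + (\<Sum>i = 1..n. (-1) ^ i *\<^sub>R \<alpha> (merge (mult (descendent H \<Phi> \<B>)) i h))
      + (-1) ^ (n + 1) *\<^sub>R \<alpha> h)"

definition alternating_multilinear ::
  "nat \<Rightarrow> ((nat \<Rightarrow> 'b::real_vector) \<Rightarrow> 'a::real_vector) \<Rightarrow> bool" where
  "alternating_multilinear n f \<longleftrightarrow> depends_on_first n f \<and>
     (\<forall>u. \<forall>i<n. linear (\<lambda>y. f (u(i := y)))) \<and>
     (\<forall>u. \<forall>i<n. \<forall>j<n. i \<noteq> j \<and> u i = u j \<longrightarrow> f u = 0)"

definition lie_rb_cochains :: "nat \<Rightarrow> ((nat \<Rightarrow> 'b::real_vector) \<Rightarrow> 'a::real_vector) set" where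
  "lie_rb_cochains k = {f. alternating_multilinear (k - 1) f}"

definition descendent_bracket ::
  "('h, 'b::real_normed_vector) lie_struct \<Rightarrow> ('a \<Rightarrow> 'b \<Rightarrow> 'b) \<Rightarrow> ('b \<Rightarrow> 'a) \<Rightarrow> 'b \<Rightarrow> 'b \<Rightarrow> 'b" where
  "descendent_bracket H \<phi> B u v = \<phi> (B u) v - \<phi> (B v) u + lie_bracket H u v"

definition theta ::
  "('g, 'a::real_normed_vector) lie_struct \<Rightarrow> ('a \<Rightarrow> 'b \<Rightarrow> 'b) \<Rightarrow> ('b \<Rightarrow> 'a) \<Rightarrow> 'b \<Rightarrow> 'a \<Rightarrow> 'a" where
  "theta G \<phi> B u x = B (\<phi> x u) + lie_bracket G (B u) x"

definition omit :: "nat \<Rightarrow> (nat \<Rightarrow> 'b) \<Rightarrow> nat \<Rightarrow> 'b" where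
  "omit i u = (\<lambda>j. if j < i then u j else u (j + 1))"

text \<open>
  With indices starting at \<open>0\<close>, the sign \<open>(-1)^(i+1)\<close> of the first sum becomes \<open>(-1)^i\<close>; that of
  the second is unchanged.
\<close>

definition lie_rb_d ::
  "('g, 'a::real_normed_vector) lie_struct \<Rightarrow> ('h, 'b::real_normed_vector) lie_struct \<Rightarrow>
   ('a \<Rightarrow> 'b \<Rightarrow> 'b) \<Rightarrow> ('b \<Rightarrow> 'a) \<Rightarrow> nat \<Rightarrow> ((nat \<Rightarrow> 'b) \<Rightarrow> 'a) \<Rightarrow> (nat \<Rightarrow> 'b) \<Rightarrow> 'a" where
  "lie_rb_d G H \<phi> B k f u =
     (let n = k - 1 in
      (\<Sum>i<n + 1. (-1) ^ i *\<^sub>R theta G \<phi> B (u i) (f (omit i u)))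
      + (\<Sum>j<n + 1. \<Sum>i<j. (-1) ^ (i + j) *\<^sub>R
           f (case_nat (descendent_bracket H \<phi> B (u i) (u j)) (omit i (omit j u)))))"


section \<open>The van Est map\<close>

text \<open>
  \<open>iter_deriv [i1, ..., im] f t\<close> is the iterated partial derivative
  \<open>d/dt_i1 ... d/dt_im f\<close> at \<open>t\<close>, where \<open>d/dt_im\<close> is applied first.
\<close>

primrec iter_deriv :: "nat list \<Rightarrow> ((nat \<Rightarrow> real) \<Rightarrow> 'v::real_normed_vector) \<Rightarrow> (nat \<Rightarrow> real) \<Rightarrow> 'v" where
  "iter_deriv [] f t = f t"
| "iter_deriv (i # is) f t = vector_derivative (\<lambda>r. iter_deriv is f (t(i := r))) (at (t i))"

definition VE ::
  "('h::topological_space, 'b::real_normed_vector) lie_struct \<Rightarrow> ('g \<Rightarrow> 'h \<Rightarrow> 'h) \<Rightarrow> ('h \<Rightarrow> 'g) \<Rightarrow>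
   nat \<Rightarrow> ((nat \<Rightarrow> 'h) \<Rightarrow> 'a::real_normed_vector) \<Rightarrow> (nat \<Rightarrow> 'b) \<Rightarrow> 'a" where
  "VE H \<Phi> \<B> k F u =
     (let n = k - 1 in
      \<Sum>s | s permutes {..<n}. real_of_int (sign s) *\<^sub>R
        iter_deriv (map s [0..<n])
          (\<lambda>t. F (\<lambda>i. lie_exp (descendent H \<Phi> \<B>) (t (s i) *\<^sub>R u (s i)))) (\<lambda>_. 0))"

end

theory Submission
  imports Defs "Jordan_Normal_Form.Determinant"
begin

text \<open>
The van Est map sees only the descendent group, that is \<open>H\<close> with the product
\<open>h \<star> k = h \<cdot> \<Phi> (\<B> h) k\<close>. Its exponential curve \<open>t \<mapsto> Exp (t u)\<close> leaves the unit with velocity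
\<open>u\<close>, and each variable is differentiated once. Hence in the chart around the unit the iterated
derivative in the definition of \<open>VE\<close> is a mixed partial derivative of the cochain at the unit, of
order one in every slot (\<open>iter_deriv_cochain\<close>). This is multilinear in the directions and linear
in the cochain, and \<open>VE\<close> is its alternation \<open>alt\<close>, which gives all assertions except
\<open>VE \<circ> d = d \<circ> VE\<close>.

For the latter, the same derivatives are computed for a coboundary (\<open>iter_deriv_rb_d\<close>). The last term
of the differential does not depend on the last variable and contributes nothing. The first one contributes
the derivative of \<open>\<Theta>\<close> along an exponential curve. A term in which \<open>h\<^sub>i \<star> h\<^sub>i\<^sub>+\<^sub>1\<close> occupies a slot
is differentiated twice in that slot. If \<open>\<beta>\<close> denotes the bilinear part of the product in coordinates
centred at the unit, \<open>p \<star> q = p + q + \<beta> p q + \<dots>\<close>, the result is a second derivative in the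
directions \<open>u\<^sub>i\<close> and \<open>u\<^sub>i\<^sub>+\<^sub>1\<close> plus a first derivative in the direction \<open>\<beta> u\<^sub>i u\<^sub>i\<^sub>+\<^sub>1\<close>. Second
derivatives are symmetric and disappear in the alternation (\<open>doubled_partial_swap\<close>), while the other
part is turned into the terms with \<open>\<beta> u v - \<beta> v u\<close> of the Chevalley-Eilenberg differential
(\<open>alt_bracket_slots\<close>).

It remains to recognise the two infinitesimal objects. That \<open>\<beta> u v - \<beta> v u\<close> is \<open>[u, v]\<^sub>B\<close> follows from
\<open>\<beta>\<^sub>\<star> u v = \<beta>\<^sub>H u v + \<phi> (B u) v\<close> (\<open>\<beta>_K\<close>), the product rule for \<open>h \<cdot> \<Phi> (\<B> h) k\<close>. That the
derivative of \<open>\<Theta>\<close> is \<open>\<theta>\<close> (\<open>Theta_exp_curve_derivative\<close>) comes out of the identity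
\<open>\<B> (\<Phi> g k) \<cdot> f g k = g \<cdot> \<B> k\<close>, which defines the map \<open>f\<close> underlying \<open>\<Theta>\<close>, when it is
differentiated once in \<open>g\<close> and once in \<open>k\<close>.

The exponential map is given by a definite description, so one-parameter subgroups must be shown to exist
and to be unique. Both come from the local theory of the differential equation of a left-invariant field,
solved by Picard iteration. Smoothness of composites is handled throughout by plots: maps from open
subsets of normed spaces to a manifold that are smooth in every chart. They are preserved by all maps in
question, so that no chart computations are needed for composites.

The homomorphism of cohomology groups then exists for purely linear reasons (\<open>cochain_map_induces_hom\<close>).
\<close>

(* The symbol \<bullet> and the word orthogonal refer to inner product spaces below. *)
no_notation scalar_prod (infix "\<bullet>" 70)
hide_const (open) Matrix.orthogonal
hide_fact (open) Matrix.orthogonal_def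

section \<open>Continuously differentiable maps\<close>

text \<open>
The model spaces are finite-dimensional inner product spaces without a distinguished basis. A finite set that
reproduces all vectors in this way does the work of an orthonormal basis; it may contain \<open>0\<close>, so it exists
in dimension \<open>0\<close> too.
\<close>

definition parseval_frame :: "'e::real_inner set \<Rightarrow> bool" where
  "parseval_frame E \<longleftrightarrow> finite E \<and> (\<forall>x. (\<Sum>b\<in>E. (x \<bullet> b) *\<^sub>R b) = x)"

lemma parseval_frameD:
  assumes "parseval_frame E"
  shows "finite E" "(\<Sum>b\<in>E. (x \<bullet> b) *\<^sub>R b) = x"
  using assms by (auto simp: parseval_frame_def)

text \<open>
Gram-Schmidt, with the zero vectors dropped and the others normalised.
\<close>

lemma parseval_frame_of_span:
  fixes S :: "'e::real_inner set"
  assumes "finite S" "span S = UNIV"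
  shows "\<exists>E::'e set. parseval_frame E"
proof -
  obtain C :: "'e set" where C: "finite C" "span C = UNIV" "pairwise orthogonal C"
    using basis_orthogonal[OF assms(1)] unfolding assms(2) by blast
  define D where "D = C - {0}"
  define E where "E = (\<lambda>b. b /\<^sub>R norm b) ` D"
  have D: "finite D" "span D = UNIV" "pairwise orthogonal D" "0 \<notin> D"
    using C by (auto simp: D_def span_delete_0 pairwise_def)
  have inj: "inj_on (\<lambda>b. b /\<^sub>R norm b) D"
  proof (rule inj_onI, rule ccontr)
    fix b c assume bc: "b \<in> D" "c \<in> D" "b /\<^sub>R norm b = c /\<^sub>R norm c" "b \<noteq> c"
    then have "b \<bullet> c = 0" using D(3) by (auto simp: pairwise_def orthogonal_def)
    then have "(b /\<^sub>R norm b) \<bullet> (c /\<^sub>R norm c) = 0" by simp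
    then have "(b /\<^sub>R norm b) \<bullet> (b /\<^sub>R norm b) = 0" using bc(3) by simp
    then show False using bc D(4) by auto
  qed
  have on: "(b /\<^sub>R norm b) \<bullet> (b /\<^sub>R norm b) = 1" if "b \<in> D" for b
    using that D(4) by (metis norm_eq_1 norm_sgn sgn_div_norm)
  have oo: "(b /\<^sub>R norm b) \<bullet> (c /\<^sub>R norm c) = 0" if "b \<in> D" "c \<in> D" "b \<noteq> c" for b c
    using that D(3) by (auto simp: pairwise_def orthogonal_def)
  define P where "P = (\<lambda>x::'e. \<Sum>b\<in>E. (x \<bullet> b) *\<^sub>R b)"
  have P: "P x = (\<Sum>c\<in>D. (x \<bullet> (c /\<^sub>R norm c)) *\<^sub>R (c /\<^sub>R norm c))" for x
    unfolding P_def E_def by (subst sum.reindex[OF inj]) (rule sum.cong, simp_all)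
  have "linear P"
    unfolding P_def by (rule linear_compose_sum) (auto intro!: linearI simp: inner_left_distrib scaleR_left_distrib)
  moreover have "P d = d" if "d \<in> D" for d
  proof -
    have "P d = (\<Sum>c\<in>D. if c = d then d else 0)"
      unfolding P
    proof (rule sum.cong[OF refl])
      fix c assume "c \<in> D"
      show "(d \<bullet> (c /\<^sub>R norm c)) *\<^sub>R (c /\<^sub>R norm c) = (if c = d then d else 0)"
      proof (cases "c = d")
        case True
        have "norm d \<noteq> 0" using D(4) that by auto
        then have "inverse (norm d) * (norm d * norm d) * inverse (norm d) = 1" by (simp add: field_simps)
        then show ?thesis using True by (simp add: dot_square_norm power2_eq_square)
      next
        case False
        then have "d \<bullet> c = 0" using D(3) \<open>c \<in> D\<close> that by (auto simp: pairwise_def orthogonal_def)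
        then show ?thesis using False by simp
      qed
    qed
    also have "\<dots> = d" using D(1) that by (simp add: sum.delta)
    finally show ?thesis .
  qed
  ultimately have "P x = id x" for x
    using linear_eq_on_span[of P id D x] D(2) linear_id by (metis UNIV_I id_apply)
  then have "parseval_frame E"
    unfolding parseval_frame_def P_def E_def using D(1) by auto
  then show ?thesis by blast
qed

lemma parseval_frame_prod:
  fixes E :: "'e::real_inner set" and F :: "'f::real_inner set"
  assumes E: "parseval_frame E" and F: "parseval_frame F"
  shows "\<exists>D::('e \<times> 'f) set. parseval_frame D"
proof (rule parseval_frame_of_span)
  let ?S = "(\<lambda>b. (b, 0)) ` E \<union> (\<lambda>b. (0, b)) ` F :: ('e \<times> 'f) set"
  show "finite ?S" using assms by (auto simp: parseval_frame_def)
  have "(x, y) \<in> span ?S" for x y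
  proof -
    have "(x, y) = (\<Sum>b\<in>E. (x \<bullet> b) *\<^sub>R (b, 0)) + (\<Sum>b\<in>F. (y \<bullet> b) *\<^sub>R (0, b))"
      using parseval_frameD(2)[OF E, of x] parseval_frameD(2)[OF F, of y]
      by (auto simp: prod_eq_iff fst_sum snd_sum)
    also have "\<dots> \<in> span ?S"
      by (intro span_add span_sum span_scale span_base) auto
    finally show "(x, y) \<in> span ?S" .
  qed
  then show "span ?S = UNIV" by auto
qed

lemma parseval_frame_real: "parseval_frame {1::real}"
  by (simp add: parseval_frame_def)

lemma linear_parseval_expand:
  assumes "parseval_frame E" "linear L"
  shows "L x = (\<Sum>b\<in>E. (x \<bullet> b) *\<^sub>R L b)"
  by (subst parseval_frameD(2)[OF assms(1), of x, symmetric])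
    (simp add: linear_sum[OF assms(2)] linear_cmul[OF assms(2)])

lemma Ck_on_continuous: "Ck_on k S f \<Longrightarrow> continuous_on S f"
  by (cases k) auto

lemma Ck_on_Suc_D: "Ck_on (Suc k) S f \<Longrightarrow> Ck_on k S f"
  by (induction k arbitrary: f) (force intro: Ck_on_continuous)+

lemma Ck_on_subset: "Ck_on k S f \<Longrightarrow> T \<subseteq> S \<Longrightarrow> Ck_on k T f"
  by (induction k arbitrary: f) (auto intro: continuous_on_subset)

lemma frechet_derivative_cong_open:
  assumes "open S" "x \<in> S" "\<And>y. y \<in> S \<Longrightarrow> f y = g y"
  shows "frechet_derivative f (at x) = frechet_derivative g (at x)"
proof -
  have "(f has_derivative D) (at x) \<longleftrightarrow> (g has_derivative D) (at x)" for D
    using has_derivative_transform_within_open[of f D x UNIV S g]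
      has_derivative_transform_within_open[of g D x UNIV S f] assms by auto
  then show ?thesis by (simp add: frechet_derivative_def)
qed

lemma differentiable_cong_open:
  assumes "open S" "x \<in> S" "\<And>y. y \<in> S \<Longrightarrow> f y = g y" "f differentiable (at x)"
  shows "g differentiable (at x)"
  using assms has_derivative_transform_within_open[of f _ x UNIV S g] unfolding differentiable_def by blast

lemma Ck_on_cong:
  assumes "open S" "\<And>y. y \<in> S \<Longrightarrow> f y = g y" "Ck_on k S f"
  shows "Ck_on k S g"
  using assms(2,3)
proof (induction k arbitrary: f g)
  case 0
  then show ?case by (simp cong: continuous_on_cong)
next
  case (Suc k)
  have "continuous_on S g" using Suc.prems by (auto cong: continuous_on_cong)
  moreover have "g differentiable (at x)" if "x \<in> S" for x
    using differentiable_cong_open[OF assms(1) that, of f g] Suc.prems that by simp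
  moreover have "Ck_on k S (\<lambda>x. frechet_derivative g (at x) v)" for v
  proof (rule Suc.IH[of "\<lambda>x. frechet_derivative f (at x) v"])
    show "frechet_derivative f (at x) v = frechet_derivative g (at x) v" if "x \<in> S" for x
      using frechet_derivative_cong_open[OF assms(1) that Suc.prems(1)] by simp
  qed (use Suc.prems(2) in simp)
  ultimately show ?case by simp
qed

lemma Ck_on_local:
  assumes "\<And>x. x \<in> S \<Longrightarrow> \<exists>W. open W \<and> x \<in> W \<and> Ck_on k W f"
  shows "Ck_on k S f"
  using assms
proof (induction k arbitrary: f)
  case 0
  show ?case
    unfolding Ck_on.simps continuous_on_eq_continuous_within
  proof
    fix x assume "x \<in> S"
    then obtain W where "open W" "x \<in> W" "continuous_on W f" using 0 by auto
    then show "continuous (at x within S) f"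
      using continuous_on_eq_continuous_at continuous_at_imp_continuous_at_within by blast
  qed
next
  case (Suc k)
  have "continuous_on S f"
    unfolding continuous_on_eq_continuous_within
  proof
    fix x assume "x \<in> S"
    then obtain W where "open W" "x \<in> W" "continuous_on W f" using Suc.prems by (metis Ck_on_continuous)
    then show "continuous (at x within S) f"
      using continuous_on_eq_continuous_at continuous_at_imp_continuous_at_within by blast
  qed
  moreover have "f differentiable (at x)" if "x \<in> S" for x
    using Suc.prems[OF that] by auto
  moreover have "Ck_on k S (\<lambda>x. frechet_derivative f (at x) v)" for v
    by (rule Suc.IH) (use Suc.prems in force)
  ultimately show ?case by simp
qed

lemma Ck_on_SucI:
  assumes "open S" "\<And>x. x \<in> S \<Longrightarrow> (f has_derivative f' x) (at x)" "\<And>v. Ck_on k S (\<lambda>x. f' x v)"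
  shows "Ck_on (Suc k) S f"
proof -
  have "frechet_derivative f (at x) v = f' x v" if "x \<in> S" for x v
    using frechet_derivative_at[OF assms(2)[OF that]] by simp
  moreover have "continuous_on S f"
    using assms(2) by (meson continuous_at_imp_continuous_on has_derivative_continuous)
  moreover have "f differentiable (at x)" if "x \<in> S" for x
    using assms(2)[OF that] by (auto simp: differentiable_def)
  ultimately show ?thesis
    using Ck_on_cong[OF assms(1) _ assms(3)] by simp
qed

lemma Ck_on_SucD:
  assumes "Ck_on (Suc k) S f" "x \<in> S"
  shows "(f has_derivative frechet_derivative f (at x)) (at x)"
    "Ck_on k S (\<lambda>x. frechet_derivative f (at x) v)"
  using assms by (auto simp: frechet_derivative_works[symmetric])

lemma Ck_on_const: "open S \<Longrightarrow> Ck_on k S (\<lambda>_. c)"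
proof (induction k arbitrary: c)
  case (Suc k)
  then show ?case by (intro Ck_on_SucI[where f' = "\<lambda>_ _. 0"]) auto
qed simp

lemma Ck_on_bounded_linear_comp:
  assumes L: "bounded_linear L" and S: "open S" and f: "Ck_on k S f"
  shows "Ck_on k S (\<lambda>x. L (f x))"
  using f
proof (induction k arbitrary: f)
  case 0
  then show ?case by (auto intro: continuous_on_compose2[OF linear_continuous_on[OF L, of UNIV]])
next
  case (Suc k)
  show ?case
    by (rule Ck_on_SucI[where f' = "\<lambda>x v. L (frechet_derivative f (at x) v)"])
      (use S Suc Ck_on_SucD[OF Suc.prems] in \<open>auto intro: bounded_linear.has_derivative[OF L]\<close>)
qed

lemma Ck_on_ident: "open S \<Longrightarrow> Ck_on k S (\<lambda>x. x)"
proof (cases k)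
  case (Suc j)
  assume "open S"
  then show ?thesis unfolding Suc
    by (intro Ck_on_SucI[where f' = "\<lambda>_ v. v"]) (auto intro: Ck_on_const)
qed simp

lemma Ck_on_add:
  assumes "open S" "Ck_on k S f" "Ck_on k S g"
  shows "Ck_on k S (\<lambda>x. f x + g x)"
  using assms(2,3)
proof (induction k arbitrary: f g)
  case 0
  then show ?case by (auto intro: continuous_intros)
next
  case (Suc k)
  show ?case
    by (rule Ck_on_SucI[where f' = "\<lambda>x v. frechet_derivative f (at x) v + frechet_derivative g (at x) v"])
      (use assms(1) Suc.IH Ck_on_SucD[OF Suc.prems(1)] Ck_on_SucD[OF Suc.prems(2)] Suc.prems
        in \<open>auto intro!: derivative_intros\<close>)
qed

lemma Ck_on_sum:
  assumes "open S" "finite I" "\<And>i. i \<in> I \<Longrightarrow> Ck_on k S (f i)"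
  shows "Ck_on k S (\<lambda>x. \<Sum>i\<in>I. f i x)"
  using assms(2,3) by (induction I) (auto intro: Ck_on_const Ck_on_add assms(1))

lemma Ck_on_bilinear:
  assumes B: "bounded_bilinear B" and S: "open S" and "Ck_on k S f" "Ck_on k S g"
  shows "Ck_on k S (\<lambda>x. B (f x) (g x))"
  using assms(3,4)
proof (induction k arbitrary: f g)
  case 0
  then show ?case by (auto intro: bounded_bilinear.continuous_on[OF B])
next
  case (Suc k)
  show ?case
  proof (rule Ck_on_SucI[where f' = "\<lambda>x v. B (f x) (frechet_derivative g (at x) v) + B (frechet_derivative f (at x) v) (g x)", OF S])
    show "((\<lambda>x. B (f x) (g x)) has_derivative
           (\<lambda>v. B (f x) (frechet_derivative g (at x) v) + B (frechet_derivative f (at x) v) (g x))) (at x)"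
      if "x \<in> S" for x
      using bounded_bilinear.FDERIV[OF B Ck_on_SucD(1)[OF Suc.prems(1) that] Ck_on_SucD(1)[OF Suc.prems(2) that]] .
    show "Ck_on k S (\<lambda>x. B (f x) (frechet_derivative g (at x) v) + B (frechet_derivative f (at x) v) (g x))" for v
      using Suc.prems by (auto intro!: Ck_on_add[OF S] Suc.IH intro: Ck_on_Suc_D)
  qed
qed

text \<open>
The derivative of the composite at \<open>x\<close> in the direction \<open>v\<close> is that of \<open>g\<close> in the direction \<open>Df(x) v\<close>, which
varies with \<open>x\<close>, whereas the definition of \<open>Ck_on\<close> is about derivatives in fixed directions. Expanding \<open>Df(x) v\<close> in a frame
gives a finite sum of products to which the induction hypothesis applies.
\<close>

lemma Ck_on_compose:
  fixes f :: "'e::real_normed_vector \<Rightarrow> 'f::real_inner" and g :: "'f \<Rightarrow> 'w::real_normed_vector"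
  assumes E: "parseval_frame (E::'f set)" and S: "open S" and T: "open T"
    and "Ck_on k S f" "Ck_on k T g" and fS: "f ` S \<subseteq> T"
  shows "Ck_on k S (\<lambda>x. g (f x))"
  using assms(4,5)
proof (induction k arbitrary: g)
  case 0
  then show ?case using fS by (auto intro: continuous_on_compose2)
next
  case (Suc k)
  note f = Ck_on_SucD[OF Suc.prems(1)] and g = Ck_on_SucD[OF Suc.prems(2)]
  have fk: "Ck_on k S f" by (rule Ck_on_Suc_D[OF Suc.prems(1)])
  let ?D = "\<lambda>x v. \<Sum>b\<in>E. (frechet_derivative f (at x) v \<bullet> b) *\<^sub>R frechet_derivative g (at (f x)) b"
  show ?case
  proof (rule Ck_on_SucI[where f' = ?D, OF S])
    fix x assume x: "x \<in> S"
    have lin: "linear (frechet_derivative g (at (f x)))"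
      using g(1) x fS has_derivative_linear by blast
    have "((\<lambda>x. g (f x)) has_derivative (\<lambda>v. frechet_derivative g (at (f x)) (frechet_derivative f (at x) v))) (at x)"
      using has_derivative_compose[OF f(1)[OF x] g(1)] x fS by auto
    moreover have "(\<lambda>v. frechet_derivative g (at (f x)) (frechet_derivative f (at x) v)) = ?D x"
      by (rule ext) (rule linear_parseval_expand[OF E lin])
    ultimately show "((\<lambda>x. g (f x)) has_derivative ?D x) (at x)" by metis
  next
    fix v
    show "Ck_on k S (\<lambda>x. ?D x v)"
    proof (rule Ck_on_sum[OF S])
      show "finite E" using E by (simp add: parseval_frame_def)
      fix b
      have "Ck_on k S (\<lambda>x. frechet_derivative f (at x) v)"
        using Suc.prems(1) by simp
      moreover have "Ck_on k S (\<lambda>x. frechet_derivative g (at (f x)) b)"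
        by (rule Suc.IH[OF fk]) (use Suc.prems(2) in auto)
      ultimately show "Ck_on k S (\<lambda>x. (frechet_derivative f (at x) v \<bullet> b) *\<^sub>R frechet_derivative g (at (f x)) b)"
        by (intro Ck_on_bilinear[OF bounded_bilinear_scaleR S]
          Ck_on_bounded_linear_comp[OF bounded_linear_inner_left S])
    qed
  qed
qed

lemma smooth_on_subset: "smooth_on S f \<Longrightarrow> T \<subseteq> S \<Longrightarrow> smooth_on T f"
  by (auto simp: smooth_on_def intro: Ck_on_subset)

lemma smooth_on_cong: "smooth_on S f \<Longrightarrow> open S \<Longrightarrow> (\<And>y. y \<in> S \<Longrightarrow> f y = g y) \<Longrightarrow> smooth_on S g"
  unfolding smooth_on_def using Ck_on_cong by blast

lemma smooth_on_local:
  assumes "\<And>x. x \<in> S \<Longrightarrow> \<exists>W. open W \<and> x \<in> W \<and> smooth_on W f"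
  shows "smooth_on S f"
  unfolding smooth_on_def
proof
  show "Ck_on k S f" for k by (rule Ck_on_local) (use assms in \<open>auto simp: smooth_on_def\<close>)
qed

lemma smooth_on_const: "open S \<Longrightarrow> smooth_on S (\<lambda>_. c)"
  and smooth_on_ident: "open S \<Longrightarrow> smooth_on S (\<lambda>x. x)"
  and smooth_on_bounded_linear:
    "bounded_linear L \<Longrightarrow> open S \<Longrightarrow> smooth_on S f \<Longrightarrow> smooth_on S (\<lambda>x. L (f x))"
  and smooth_on_add:
    "open S \<Longrightarrow> smooth_on S f \<Longrightarrow> smooth_on S g \<Longrightarrow> smooth_on S (\<lambda>x. f x + g x)"
  and smooth_on_bilinear:
    "bounded_bilinear B \<Longrightarrow> open S \<Longrightarrow> smooth_on S f \<Longrightarrow> smooth_on S g' \<Longrightarrow> smooth_on S (\<lambda>x. B (f x) (g' x))"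
  by (auto simp: smooth_on_def intro: Ck_on_const Ck_on_ident Ck_on_bounded_linear_comp Ck_on_add Ck_on_bilinear)

lemma smooth_on_compose:
  fixes f :: "'e::real_normed_vector \<Rightarrow> 'f::real_inner" and g :: "'f \<Rightarrow> 'w::real_normed_vector"
  assumes "parseval_frame (E::'f set)" "smooth_on T g" "smooth_on S f" "open S" "open T" "f ` S \<subseteq> T"
  shows "smooth_on S (\<lambda>x. g (f x))"
  using assms Ck_on_compose unfolding smooth_on_def by blast

lemma smooth_on_Pair:
  assumes "open S" "smooth_on S f" "smooth_on S g"
  shows "smooth_on S (\<lambda>x. (f x, g x))"
proof -
  have "bounded_linear (\<lambda>x. (x, 0))" "bounded_linear (\<lambda>x. (0, x))"
    by (auto intro: bounded_linear_Pair bounded_linear_ident bounded_linear_zero)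
  note this[THEN smooth_on_bounded_linear, OF assms(1)]
  from smooth_on_add[OF assms(1) this(1)[OF assms(2)] this(2)[OF assms(3)]] show ?thesis by simp
qed

lemma smooth_on_continuous: "smooth_on S f \<Longrightarrow> continuous_on S f"
  unfolding smooth_on_def using Ck_on_continuous by blast

lemma smooth_on_derivative: "smooth_on S f \<Longrightarrow> smooth_on S (\<lambda>x. frechet_derivative f (at x) v)"
  unfolding smooth_on_def by (metis Ck_on.simps(2))

lemma smooth_on_has_derivative:
  "smooth_on S f \<Longrightarrow> x \<in> S \<Longrightarrow> (f has_derivative frechet_derivative f (at x)) (at x)"
  unfolding smooth_on_def using Ck_on_SucD(1) by blast

lemma smooth_on_derivative_linear:
  "smooth_on S f \<Longrightarrow> x \<in> S \<Longrightarrow> linear (frechet_derivative f (at x))"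
  using smooth_on_has_derivative has_derivative_linear by blast

text \<open>
The mean value theorem, used in the direction \<open>u\<close> and then in the direction \<open>v\<close>. The second difference on the
left is symmetric in \<open>u\<close> and \<open>v\<close>, which makes the second derivative symmetric in the limit.
\<close>

lemma second_difference_mean_value:
  fixes f :: "'e::real_normed_vector \<Rightarrow> 'w::real_inner"
  assumes f: "Ck_on 2 S f" and h: "h > 0" and B: "\<And>s t. s \<in> {0..h} \<Longrightarrow> t \<in> {0..h} \<Longrightarrow> x + s *\<^sub>R u + t *\<^sub>R v \<in> S"
  shows "\<exists>s\<in>{0..h}. \<exists>t\<in>{0..h}.
    (f (x + h *\<^sub>R u + h *\<^sub>R v) - f (x + h *\<^sub>R u) - f (x + h *\<^sub>R v) + f x) \<bullet> w =
    h * h * (frechet_derivative (\<lambda>z. frechet_derivative f (at z) u) (at (x + s *\<^sub>R u + t *\<^sub>R v)) v \<bullet> w)"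
proof -
  have f1: "(f has_derivative frechet_derivative f (at z)) (at z)" if "z \<in> S" for z
    using Ck_on_SucD(1)[of 1] f that by (simp add: numeral_2_eq_2)
  have f2: "((\<lambda>z. frechet_derivative f (at z) u) has_derivative
       frechet_derivative (\<lambda>z. frechet_derivative f (at z) u) (at z)) (at z)" if "z \<in> S" for z
    using Ck_on_SucD(1)[of 0 S "\<lambda>z. frechet_derivative f (at z) u"] f that by (simp add: numeral_2_eq_2)
  define g where "g s = (f (x + s *\<^sub>R u + h *\<^sub>R v) - f (x + s *\<^sub>R u)) \<bullet> w" for s
  define g' where "g' s = (frechet_derivative f (at (x + s *\<^sub>R u + h *\<^sub>R v)) u - frechet_derivative f (at (x + s *\<^sub>R u)) u) \<bullet> w" for s
  have scale: "frechet_derivative f (at z) (a *\<^sub>R y) = a *\<^sub>R frechet_derivative f (at z) y" if "z \<in> S" for z a y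
    using f1[OF that] by (simp add: has_derivative_linear linear_cmul)
  have "(g has_real_derivative g' s) (at s)" if s: "0 \<le> s" "s \<le> h" for s
  proof -
    have 1: "x + s *\<^sub>R u + h *\<^sub>R v \<in> S" "x + s *\<^sub>R u \<in> S" using B[of s h] B[of s 0] s h by auto
    have a: "((\<lambda>s. f (x + s *\<^sub>R u + h *\<^sub>R v)) has_derivative (\<lambda>r. frechet_derivative f (at (x + s *\<^sub>R u + h *\<^sub>R v)) (r *\<^sub>R u))) (at s)"
      by (rule has_derivative_compose[of "\<lambda>s. x + s *\<^sub>R u + h *\<^sub>R v" "\<lambda>r. r *\<^sub>R u" s UNIV f, OF _ f1[OF 1(1)]]) (auto intro!: derivative_eq_intros)
    have b: "((\<lambda>s. f (x + s *\<^sub>R u)) has_derivative (\<lambda>r. frechet_derivative f (at (x + s *\<^sub>R u)) (r *\<^sub>R u))) (at s)"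
      by (rule has_derivative_compose[of "\<lambda>s. x + s *\<^sub>R u" "\<lambda>r. r *\<^sub>R u" s UNIV f, OF _ f1[OF 1(2)]]) (auto intro!: derivative_eq_intros)
    have "(g has_derivative (\<lambda>r. (frechet_derivative f (at (x + s *\<^sub>R u + h *\<^sub>R v)) (r *\<^sub>R u) - frechet_derivative f (at (x + s *\<^sub>R u)) (r *\<^sub>R u)) \<bullet> w)) (at s)"
      unfolding g_def by (intro has_derivative_inner_left has_derivative_diff a b)
    moreover have "(\<lambda>r. (frechet_derivative f (at (x + s *\<^sub>R u + h *\<^sub>R v)) (r *\<^sub>R u) - frechet_derivative f (at (x + s *\<^sub>R u)) (r *\<^sub>R u)) \<bullet> w) = (*) (g' s)"
      by (rule ext) (simp only: g'_def scale[OF 1(1)] scale[OF 1(2)] inner_diff_left right_diff_distrib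
          left_diff_distrib inner_scaleR_left mult.commute)
    ultimately show ?thesis by (simp add: has_field_derivative_def)
  qed
  from MVT2[OF h this] obtain s where s: "0 < s" "s < h" "g h - g 0 = h * g' s" by auto
  define k where "k t = frechet_derivative f (at (x + s *\<^sub>R u + t *\<^sub>R v)) u \<bullet> w" for t
  define k' where "k' t = frechet_derivative (\<lambda>z. frechet_derivative f (at z) u) (at (x + s *\<^sub>R u + t *\<^sub>R v)) v \<bullet> w" for t
  have "(k has_real_derivative k' t) (at t)" if t: "0 \<le> t" "t \<le> h" for t
  proof -
    have 1: "x + s *\<^sub>R u + t *\<^sub>R v \<in> S" using B[of s t] s h t by auto
    have lin: "linear (frechet_derivative (\<lambda>z. frechet_derivative f (at z) u) (at (x + s *\<^sub>R u + t *\<^sub>R v)))"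
      using f2[OF 1] has_derivative_linear by blast
    have a: "((\<lambda>t. frechet_derivative f (at (x + s *\<^sub>R u + t *\<^sub>R v)) u) has_derivative
       (\<lambda>r. frechet_derivative (\<lambda>z. frechet_derivative f (at z) u) (at (x + s *\<^sub>R u + t *\<^sub>R v)) (r *\<^sub>R v))) (at t)"
      by (rule has_derivative_compose[of "\<lambda>t. x + s *\<^sub>R u + t *\<^sub>R v" "\<lambda>r. r *\<^sub>R v" t UNIV
          "\<lambda>z. frechet_derivative f (at z) u", OF _ f2[OF 1]]) (auto intro!: derivative_eq_intros)
    have "(k has_derivative (\<lambda>r. frechet_derivative (\<lambda>z. frechet_derivative f (at z) u) (at (x + s *\<^sub>R u + t *\<^sub>R v)) (r *\<^sub>R v) \<bullet> w)) (at t)"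
      unfolding k_def by (intro has_derivative_inner_left a)
    then show ?thesis
      by (simp add: has_field_derivative_def k'_def linear_cmul[OF lin] mult_commute_abs)
  qed
  from MVT2[OF h this] obtain t where t: "0 < t" "t < h" "k h - k 0 = h * k' t" by auto
  have "g' s = k h - k 0" by (simp add: g'_def k_def inner_diff_left)
  then have "g h - g 0 = h * h * k' t" using s(3) t(3) by simp
  then show ?thesis
    using s t unfolding g_def k'_def by (intro bexI[of _ s] bexI[of _ t]) (auto simp: algebra_simps)
qed

lemma second_derivative_symmetric:
  fixes f :: "'e::real_normed_vector \<Rightarrow> 'w::real_inner"
  assumes S: "open S" "x \<in> S" and f: "Ck_on 2 S f"
  shows "frechet_derivative (\<lambda>z. frechet_derivative f (at z) u) (at x) v =
         frechet_derivative (\<lambda>z. frechet_derivative f (at z) v) (at x) u"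
proof -
  define D where "D u v y = frechet_derivative (\<lambda>z. frechet_derivative f (at z) u) (at y) v" for u v y
  define \<Delta> where "\<Delta> u v h = f (x + h *\<^sub>R u + h *\<^sub>R v) - f (x + h *\<^sub>R u) - f (x + h *\<^sub>R v) + f x" for u v and h :: real
  have cont: "isCont (D u v) x" for u v
    using f S unfolding numeral_2_eq_2 D_def by (simp add: continuous_on_eq_continuous_at)
  have lim: "((\<lambda>h. (\<Delta> u v h \<bullet> w) / (h * h)) \<longlongrightarrow> D u v x \<bullet> w) (at_right 0)" for u v w
  proof (rule tendstoI)
    fix e :: real assume e: "e > 0"
    have "isCont (\<lambda>y. D u v y \<bullet> w) x" using cont by (intro continuous_intros)
    then obtain d where d: "d > 0" "\<And>y. dist y x < d \<Longrightarrow> dist (D u v y \<bullet> w) (D u v x \<bullet> w) < e"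
      using e unfolding continuous_at_eps_delta by metis
    obtain r where r: "r > 0" "ball x r \<subseteq> S" using S open_contains_ball by blast
    define h0 where "h0 = min d r / (norm u + norm v + 1)"
    have pos: "norm u + norm v + 1 > 0" by (smt (verit) norm_ge_zero)
    have h0: "h0 > 0" using d(1) r(1) pos by (simp add: h0_def)
    have close: "dist (x + s *\<^sub>R u + t *\<^sub>R v) x < min d r" if "0 \<le> s" "s \<le> h" "0 \<le> t" "t \<le> h" "h < h0" for s t h
    proof -
      have "dist (x + s *\<^sub>R u + t *\<^sub>R v) x \<le> s * norm u + t * norm v"
        using norm_triangle_ineq[of "s *\<^sub>R u" "t *\<^sub>R v"] that by (simp add: dist_norm algebra_simps)
      also have "\<dots> \<le> h * norm u + h * norm v"
        using that by (intro add_mono mult_right_mono) auto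
      also have "\<dots> \<le> h * (norm u + norm v + 1)" using that by (simp add: algebra_simps)
      also have "\<dots> < h0 * (norm u + norm v + 1)" using that pos by (intro mult_strict_right_mono)
      also have "\<dots> = min d r" using pos by (simp add: h0_def)
      finally show ?thesis .
    qed
    have "dist ((\<Delta> u v h \<bullet> w) / (h * h)) (D u v x \<bullet> w) < e" if h: "0 < h" "h < h0" for h
    proof -
      have "\<And>s t. s \<in> {0..h} \<Longrightarrow> t \<in> {0..h} \<Longrightarrow> x + s *\<^sub>R u + t *\<^sub>R v \<in> S"
        using close h(2) r(2) by (force simp: dist_commute)
      from second_difference_mean_value[OF f h(1) this, of w]
      obtain s t where st: "s \<in> {0..h}" "t \<in> {0..h}" "\<Delta> u v h \<bullet> w = h * h * (D u v (x + s *\<^sub>R u + t *\<^sub>R v) \<bullet> w)"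
        unfolding \<Delta>_def D_def by blast
      then show ?thesis using d(2) close[of s h t] h by auto
    qed
    then show "\<forall>\<^sub>F h in at_right 0. dist ((\<Delta> u v h \<bullet> w) / (h * h)) (D u v x \<bullet> w) < e"
      using h0 by (auto simp: eventually_at_right_field intro!: exI[of _ h0])
  qed
  have sym: "\<Delta> u v h = \<Delta> v u h" for h by (simp add: \<Delta>_def algebra_simps)
  have "D u v x \<bullet> w = D v u x \<bullet> w" for w
    by (rule tendsto_unique[OF _ lim[of u v w]]) (use lim[of v u w] sym in auto)
  then have "D u v x = D v u x" by (metis inner_diff_left inner_eq_zero_iff right_minus_eq)
  then show ?thesis by (simp add: D_def)
qed

text \<open>
The product rule for a linear map \<open>L y\<close> applied to a vector \<open>X y\<close>, both varying with \<open>y\<close>. Expansion of \<open>X y\<close> in a frame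
reduces it to the functions \<open>L y b\<close> with finitely many fixed vectors \<open>b\<close>.
\<close>

lemma derivative_along_field:
  fixes L :: "'f::real_normed_vector \<Rightarrow> 'e::real_inner \<Rightarrow> 'w::real_normed_vector" and X :: "'f \<Rightarrow> 'e"
  assumes E: "parseval_frame (E::'e set)"
    and q: "\<And>v. ((\<lambda>y. L y v) has_derivative (\<lambda>h. L' h v)) (at x)"
    and L: "\<forall>\<^sub>F y in nhds x. linear (L y)" and X: "(X has_derivative X') (at x)"
  shows "((\<lambda>y. L y (X y)) has_derivative (\<lambda>u. L' u (X x) + L x (X' u))) (at x)"
proof -
  have linL: "linear (L x)" using L eventually_nhds_x_imp_x by blast
  \<comment> \<open>The derivative of a family of linear maps is linear, being a limit of linear maps.\<close>
  have linL': "linear (L' h)" for h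
  proof -
    have ev: "\<forall>\<^sub>F y in at x. linear (L y)" using L by (simp add: eventually_nhds_conv_at)
    show ?thesis
    proof (rule linearI)
      fix a b
      have "((\<lambda>y. L y a + L y b) has_derivative (\<lambda>h. L' h a + L' h b)) (at x)"
        by (intro has_derivative_add q)
      then have "((\<lambda>y. L y (a + b)) has_derivative (\<lambda>h. L' h a + L' h b)) (at x)"
        by (rule has_derivative_transform_eventually) (use ev linL in \<open>auto elim: eventually_mono simp: linear_add\<close>)
      from has_derivative_unique[OF this q] show "L' h (a + b) = L' h a + L' h b" by (simp add: fun_eq_iff)
    next
      fix r :: real and a
      have "((\<lambda>y. r *\<^sub>R L y a) has_derivative (\<lambda>h. r *\<^sub>R L' h a)) (at x)"
        by (intro has_derivative_scaleR_right q)
      then have "((\<lambda>y. L y (r *\<^sub>R a)) has_derivative (\<lambda>h. r *\<^sub>R L' h a)) (at x)"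
        by (rule has_derivative_transform_eventually) (use ev linL in \<open>auto elim: eventually_mono simp: linear_cmul\<close>)
      from has_derivative_unique[OF this q] show "L' h (r *\<^sub>R a) = r *\<^sub>R L' h a" by (simp add: fun_eq_iff)
    qed
  qed
  have "((\<lambda>y. \<Sum>b\<in>E. (X y \<bullet> b) *\<^sub>R L y b) has_derivative
      (\<lambda>u. \<Sum>b\<in>E. (X x \<bullet> b) *\<^sub>R L' u b + (X' u \<bullet> b) *\<^sub>R L x b)) (at x)"
    by (intro has_derivative_sum has_derivative_scaleR has_derivative_inner_left X q)
  moreover have "(\<lambda>u. \<Sum>b\<in>E. (X x \<bullet> b) *\<^sub>R L' u b + (X' u \<bullet> b) *\<^sub>R L x b) = (\<lambda>u. L' u (X x) + L x (X' u))"
    by (simp only: sum.distrib linear_parseval_expand[OF E linL, symmetric]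
        linear_parseval_expand[OF E linL', symmetric])
  ultimately have "((\<lambda>y. \<Sum>b\<in>E. (X y \<bullet> b) *\<^sub>R L y b) has_derivative
      (\<lambda>u. L' u (X x) + L x (X' u))) (at x)" by simp
  then show ?thesis
  proof (rule has_derivative_transform_eventually)
    have "\<forall>\<^sub>F y in at x. linear (L y)" using L by (simp add: eventually_nhds_conv_at)
    then show "\<forall>\<^sub>F y in at x. (\<Sum>b\<in>E. (X y \<bullet> b) *\<^sub>R L y b) = L y (X y)"
      by eventually_elim (metis linear_parseval_expand[OF E])
  qed (simp_all only: linear_parseval_expand[OF E linL, symmetric] UNIV_I)
qed

section \<open>Ordinary differential equations\<close>

lemma vector_differentiable_bound:
  fixes f :: "real \<Rightarrow> 'b::real_normed_vector"
  assumes "convex S" "\<And>t. t \<in> S \<Longrightarrow> (f has_vector_derivative f' t) (at t within S)"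
    "\<And>t. t \<in> S \<Longrightarrow> norm (f' t) \<le> M" "s \<in> S" "t \<in> S"
  shows "norm (f s - f t) \<le> M * \<bar>s - t\<bar>"
proof -
  have "onorm (\<lambda>h::real. h *\<^sub>R f' t) \<le> M" if "t \<in> S" for t
  proof (rule onorm_bound)
    show "0 \<le> M" using assms(3)[OF that] norm_ge_zero order_trans by blast
    show "norm (h *\<^sub>R f' t) \<le> M * norm h" for h :: real
      using mult_right_mono[OF assms(3)[OF that], of "\<bar>h\<bar>"] by (simp add: mult.commute)
  qed
  then show ?thesis
    using differentiable_bound[OF assms(1), of f "\<lambda>t h. h *\<^sub>R f' t" M t s] assms
    by (auto simp: has_vector_derivative_def norm_minus_commute abs_minus_commute)
qed

lemma smooth_on_locally_lipschitz:
  fixes X :: "'e::real_inner \<Rightarrow> 'w::real_normed_vector"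
  assumes E: "parseval_frame (E::'e set)" and X: "smooth_on U X" and U: "open U" "x0 \<in> U"
  shows "\<exists>r>0. \<exists>L\<ge>0. cball x0 r \<subseteq> U \<and>
    (\<forall>x\<in>cball x0 r. \<forall>y\<in>cball x0 r. norm (X x - X y) \<le> L * norm (x - y))"
proof -
  have fin: "finite E" using E by (simp add: parseval_frame_def)
  have ev: "\<forall>\<^sub>F x in nhds x0. \<forall>b\<in>E. norm (frechet_derivative X (at x) b) < norm (frechet_derivative X (at x0) b) + 1"
  proof (rule eventually_ball_finite[OF fin], rule ballI)
    fix b
    have "isCont (\<lambda>x. frechet_derivative X (at x) b) x0"
      using smooth_on_continuous[OF smooth_on_derivative[OF X]] U continuous_on_eq_continuous_at by blast
    then have "((\<lambda>x. norm (frechet_derivative X (at x) b)) \<longlongrightarrow> norm (frechet_derivative X (at x0) b)) (nhds x0)"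
      by (intro tendsto_norm) (simp add: isCont_def tendsto_nhds_iff)
    then show "\<forall>\<^sub>F x in nhds x0. norm (frechet_derivative X (at x) b) < norm (frechet_derivative X (at x0) b) + 1"
      by (rule order_tendstoD) simp
  qed
  have "\<forall>\<^sub>F x in nhds x0. x \<in> U" using U eventually_nhds by blast
  with ev obtain r where r: "r > 0"
    "\<And>x. dist x x0 < r \<Longrightarrow> x \<in> U \<and> (\<forall>b\<in>E. norm (frechet_derivative X (at x) b) < norm (frechet_derivative X (at x0) b) + 1)"
    unfolding eventually_nhds_metric by (metis (no_types, lifting) less_trans linorder_neqE_linordered_idom min_less_iff_conj)
  define L where "L = (\<Sum>b\<in>E. norm b * (norm (frechet_derivative X (at x0) b) + 1))"
  have sub: "x \<in> cball x0 (r/2) \<Longrightarrow> dist x x0 < r" for x using r(1) by (auto simp: dist_commute)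
  have on: "onorm (frechet_derivative X (at x)) \<le> L" if x: "x \<in> cball x0 (r/2)" for x
  proof (rule onorm_bound)
    show "0 \<le> L" unfolding L_def by (intro sum_nonneg mult_nonneg_nonneg) auto
    fix v
    have lin: "linear (frechet_derivative X (at x))"
      using smooth_on_derivative_linear[OF X] r(2)[OF sub[OF x]] by blast
    have "norm (frechet_derivative X (at x) v) \<le> (\<Sum>b\<in>E. norm ((v \<bullet> b) *\<^sub>R frechet_derivative X (at x) b))"
      by (subst linear_parseval_expand[OF E lin]) (rule norm_sum)
    also have "\<dots> \<le> (\<Sum>b\<in>E. (norm v * norm b) * (norm (frechet_derivative X (at x0) b) + 1))"
    proof (rule sum_mono)
      fix b assume "b \<in> E"
      then have "norm (frechet_derivative X (at x) b) \<le> norm (frechet_derivative X (at x0) b) + 1"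
        using r(2)[OF sub[OF x]] by fastforce
      then show "norm ((v \<bullet> b) *\<^sub>R frechet_derivative X (at x) b) \<le> norm v * norm b * (norm (frechet_derivative X (at x0) b) + 1)"
        unfolding norm_scaleR by (intro mult_mono) (auto simp: Cauchy_Schwarz_ineq2)
    qed
    also have "\<dots> = L * norm v" by (simp add: L_def sum_distrib_right sum_distrib_left mult_ac)
    finally show "norm (frechet_derivative X (at x) v) \<le> L * norm v" .
  qed
  have "norm (X x - X y) \<le> L * norm (x - y)" if "x \<in> cball x0 (r/2)" "y \<in> cball x0 (r/2)" for x y
    by (rule differentiable_bound[OF convex_cball _ on that])
      (use sub r(2) smooth_on_has_derivative[OF X] in \<open>blast intro: has_derivative_at_withinI\<close>)
  moreover have "L \<ge> 0" unfolding L_def by (intro sum_nonneg mult_nonneg_nonneg) auto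
  moreover have "cball x0 (r/2) \<subseteq> U" using sub r(2) by blast
  ultimately show ?thesis using r(1) by (intro exI[of _ "r/2"]) auto
qed

text \<open>
Picard iteration. The integral operator acts on bounded continuous functions on the whole line, which form a
complete metric space. The time \<open>a\<close> is so short that the operator preserves the functions with values in the ball
(this needs \<open>M a \<le> r\<close>) and contracts distances by \<open>1/2\<close> (this needs \<open>L a \<le> 1/2\<close>).
\<close>

lemma ode_local_existence:
  fixes X :: "'e::banach \<Rightarrow> 'e"
  assumes r: "r > 0" and L: "L \<ge> 0"
    and lip: "\<And>x y. x \<in> cball x0 r \<Longrightarrow> y \<in> cball x0 r \<Longrightarrow> norm (X x - X y) \<le> L * norm (x - y)"
  shows "\<exists>a>0. \<exists>x. x 0 = x0 \<and> (\<forall>t\<in>{-a<..<a}. x t \<in> cball x0 r \<and> (x has_vector_derivative X (x t)) (at t))"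
proof -
  define M where "M = norm (X x0) + L * r + 1"
  have M: "M > 0" using r L by (simp add: M_def add_nonneg_pos)
  have XM: "norm (X x) \<le> M" if "x \<in> cball x0 r" for x
  proof -
    have "norm (X x - X x0) \<le> L * norm (x - x0)" using lip[OF that] r by simp
    also have "\<dots> \<le> L * r" using that L by (intro mult_left_mono) (auto simp: dist_norm norm_minus_commute)
    finally show ?thesis unfolding M_def using norm_triangle_sub[of "X x" "X x0"] by linarith
  qed
  define a where "a = min (r / M) (1 / (2 * (L + 1)))"
  have a: "a > 0" "M * a \<le> r" "L * a \<le> 1/2"
  proof -
    show "a > 0" using r L M by (simp add: a_def)
    have "a \<le> r / M" by (simp add: a_def)
    then show "M * a \<le> r" using M by (simp add: field_simps)
    have "a \<le> 1 / (2 * (L + 1))" by (simp add: a_def)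
    then have "a * (2 * (L + 1)) \<le> 1" using L by (simp add: field_simps)
    then show "L * a \<le> 1/2" using \<open>a > 0\<close> by (simp add: algebra_simps)
  qed
  have contX: "continuous_on (cball x0 r) X"
  proof (rule continuous_onI)
    fix x e assume x: "x \<in> cball x0 r" and e: "(e::real) > 0"
    show "\<exists>d>0. \<forall>x'\<in>cball x0 r. dist x' x < d \<longrightarrow> dist (X x') (X x) \<le> e"
    proof (intro exI[of _ "e / (L + 1)"] conjI ballI impI)
      show "e / (L + 1) > 0" using e L by simp
      fix y assume y: "y \<in> cball x0 r" "dist y x < e / (L + 1)"
      have "dist (X y) (X x) \<le> L * dist y x" using lip[OF y(1) x] by (simp add: dist_norm)
      also have "\<dots> \<le> (L + 1) * dist y x" by (intro mult_right_mono) auto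
      also have "\<dots> \<le> e" using y(2) L by (simp add: field_simps)
      finally show "dist (X y) (X x) \<le> e" .
    qed
  qed
  define S where "S = (PiC UNIV (\<lambda>_. cball x0 r) :: (real \<Rightarrow>\<^sub>C 'e) set)"
  have S: "apply_bcontfun f t \<in> cball x0 r" if "f \<in> S" for f t
    using that unfolding S_def mem_PiC_iff by auto
  define G where "G f t = integral {-a..t} (\<lambda>s. X (apply_bcontfun f s))" for f t
  have G: "(G f has_vector_derivative X (apply_bcontfun f t)) (at t within {-a..a})" if "f \<in> S" "t \<in> {-a..a}" for f t
  proof -
    have "continuous_on {-a..a} (\<lambda>s. X (apply_bcontfun f s))"
      by (rule continuous_on_compose2[OF contX]) (use S[OF that(1)] in auto)
    then show ?thesis using integral_has_vector_derivative that(2) unfolding G_def by blast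
  qed
  \<comment> \<open>Clamping the time makes functions on the interval into functions on the whole line.\<close>
  define cl where "cl t = max (-a) (min a t)" for t
  have cl: "cl t \<in> {-a..a}" for t using a(1) by (auto simp: cl_def)
  have cl_id: "t \<in> {-a..a} \<Longrightarrow> cl t = t" for t by (auto simp: cl_def)
  have cl_abs: "\<bar>cl t\<bar> \<le> a" for t using cl[of t] by auto
  \<comment> \<open>This is the integral from \<open>0\<close> to the clamped time, of either sign, as a difference of integrals from \<open>-a\<close>.\<close>
  define P where "P f t = x0 + (G f (cl t) - G f 0)" for f t
  have Pball: "P f t \<in> cball x0 r" if "f \<in> S" for f t
  proof -
    have "norm (G f (cl t) - G f 0) \<le> M * \<bar>cl t - 0\<bar>"
      by (rule vector_differentiable_bound[OF convex_real_interval(5) G[OF that]])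
        (use S[OF that] XM a(1) cl in auto)
    also have "\<dots> \<le> M * a" using cl_abs[of t] M by simp
    finally show ?thesis using a(2) by (simp add: P_def dist_norm norm_minus_commute)
  qed
  have Pcont: "continuous_on UNIV (P f)" if "f \<in> S" for f
  proof -
    have "continuous_on {-a..a} (G f)"
      using G[OF that] has_vector_derivative_continuous continuous_on_eq_continuous_within by blast
    moreover have "continuous_on UNIV cl" unfolding cl_def by (intro continuous_intros)
    ultimately have "continuous_on UNIV (\<lambda>t. G f (cl t))"
      by (rule continuous_on_compose2) (use cl in auto)
    then show ?thesis unfolding P_def by (intro continuous_intros)
  qed
  have Pb: "P f \<in> bcontfun" if "f \<in> S" for f
    unfolding bcontfun_def using Pcont[OF that] Pball[OF that] bounded_subset[OF bounded_cball[of x0 r]] by blast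
  define Q where "Q f = Bcontfun (P f)" for f
  have Q: "apply_bcontfun (Q f) = P f" if "f \<in> S" for f
    unfolding Q_def using Bcontfun_inverse[OF Pb[OF that]] .
  have "\<exists>!f. f \<in> S \<and> Q f = f"
  proof (rule Banach_fix[where c="1/2"])
    show "complete S" unfolding S_def complete_eq_closed by (intro closed_PiC) auto
    have "const_bcontfun x0 \<in> S" using r by (auto simp: S_def mem_PiC_iff const_bcontfun.rep_eq)
    then show "S \<noteq> {}" by blast
    show "Q ` S \<subseteq> S" using Q Pball by (auto simp: S_def mem_PiC_iff)
    fix f g assume fg: "f \<in> S" "g \<in> S"
    show "dist (Q f) (Q g) \<le> 1/2 * dist f g"
    proof (rule dist_bound)
      fix t
      have "norm ((G f (cl t) - G g (cl t)) - (G f 0 - G g 0)) \<le> (L * dist f g) * \<bar>cl t - 0\<bar>"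
      proof (rule vector_differentiable_bound[OF convex_real_interval(5)])
        show "((\<lambda>t. G f t - G g t) has_vector_derivative X (apply_bcontfun f t) - X (apply_bcontfun g t)) (at t within {-a..a})"
          if "t \<in> {-a..a}" for t
          by (intro has_vector_derivative_diff G fg that)
        show "norm (X (apply_bcontfun f t) - X (apply_bcontfun g t)) \<le> L * dist f g" for t
        proof -
          have "norm (X (apply_bcontfun f t) - X (apply_bcontfun g t)) \<le> L * dist (apply_bcontfun f t) (apply_bcontfun g t)"
            using lip[OF S[OF fg(1)] S[OF fg(2)]] by (simp add: dist_norm)
          also have "\<dots> \<le> L * dist f g" using dist_bounded L by (intro mult_left_mono)
          finally show ?thesis .
        qed
      qed (use a(1) cl in auto)
      also have "\<dots> \<le> (L * dist f g) * a" using cl_abs[of t] L by (intro mult_left_mono) auto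
      also have "\<dots> = (L * a) * dist f g" by (simp add: mult_ac)
      also have "\<dots> \<le> 1/2 * dist f g" using a(3) by (intro mult_right_mono) auto
      finally show "dist (apply_bcontfun (Q f) t) (apply_bcontfun (Q g) t) \<le> 1/2 * dist f g"
        by (simp add: Q fg P_def dist_norm algebra_simps)
    qed
  qed auto
  then obtain f where f: "f \<in> S" "Q f = f" by blast
  define x where "x = apply_bcontfun f"
  have xP: "x t = P f t" for t using Q[OF f(1)] f(2) by (simp add: x_def)
  have "x 0 = x0" using a(1) by (simp add: xP P_def cl_id)
  moreover have "x t \<in> cball x0 r \<and> (x has_vector_derivative X (x t)) (at t)" if t: "t \<in> {-a<..<a}" for t
  proof
    show "x t \<in> cball x0 r" using S[OF f(1)] by (simp add: x_def)
    have "(G f has_vector_derivative X (x t)) (at t)"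
      using G[OF f(1), of t] t unfolding x_def
      by (metis at_within_Icc_at atLeastAtMost_iff greaterThanLessThan_iff less_imp_le)
    then have "((\<lambda>t. x0 + (G f t - G f 0)) has_vector_derivative X (x t)) (at t)"
      by (auto intro!: derivative_eq_intros)
    then show "(x has_vector_derivative X (x t)) (at t)"
      by (rule has_vector_derivative_transform_within_open[of _ _ _ "{-a<..<a}"])
        (use t in \<open>auto simp: xP P_def cl_id\<close>)
  qed
  ultimately show ?thesis using a(1) by blast
qed

text \<open>
The largest distance of the two solutions on the interval is at most \<open>L a\<close> times itself.
\<close>

lemma ode_local_uniqueness:
  fixes X :: "'e::real_normed_vector \<Rightarrow> 'e"
  assumes L: "L \<ge> 0" and a: "a \<ge> 0" "L * a < 1"
    and lip: "\<And>x y. x \<in> S \<Longrightarrow> y \<in> S \<Longrightarrow> norm (X x - X y) \<le> L * norm (x - y)"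
    and x: "\<And>t. t \<in> {-a..a} \<Longrightarrow> x t \<in> S \<and> (x has_vector_derivative X (x t)) (at t)"
    and y: "\<And>t. t \<in> {-a..a} \<Longrightarrow> y t \<in> S \<and> (y has_vector_derivative X (y t)) (at t)"
    and init: "x 0 = y 0" and t: "t \<in> {-a..a}"
  shows "x t = y t"
proof -
  have xy: "((\<lambda>t. x t - y t) has_vector_derivative (X (x t) - X (y t))) (at t within {-a..a})" if "t \<in> {-a..a}" for t
    using x[OF that] y[OF that] by (intro has_vector_derivative_diff) (auto intro: has_vector_derivative_at_within)
  then have "continuous_on {-a..a} (\<lambda>t. x t - y t)"
    using has_vector_derivative_continuous continuous_on_eq_continuous_within by blast
  then have "continuous_on {-a..a} (\<lambda>t. norm (x t - y t))" by (rule continuous_on_norm)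
  then obtain s where s: "s \<in> {-a..a}" "\<And>t. t \<in> {-a..a} \<Longrightarrow> norm (x t - y t) \<le> norm (x s - y s)"
    using continuous_attains_sup[of "{-a..a}" "\<lambda>t. norm (x t - y t)"] a by auto
  have "norm ((x s - y s) - (x 0 - y 0)) \<le> (L * norm (x s - y s)) * \<bar>s - 0\<bar>"
  proof (rule vector_differentiable_bound[OF convex_real_interval(5) xy])
    fix t assume t: "t \<in> {-a..a}"
    have "norm (X (x t) - X (y t)) \<le> L * norm (x t - y t)" using lip x[OF t] y[OF t] by blast
    also have "\<dots> \<le> L * norm (x s - y s)" using s(2)[OF t] L by (intro mult_left_mono)
    finally show "norm (X (x t) - X (y t)) \<le> L * norm (x s - y s)" .
  qed (use s a in auto)
  also have "\<dots> \<le> (L * norm (x s - y s)) * a" using s(1) L by (intro mult_left_mono) auto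
  finally have "norm (x s - y s) * (1 - L * a) \<le> 0" using init by (simp add: algebra_simps)
  then have "norm (x s - y s) \<le> 0" using a(2) by (simp add: mult_le_0_iff)
  then show ?thesis using s(2)[OF t] by simp
qed

text \<open>
Bootstrapping: if the solution is of class \<open>C\<^sup>k\<close>, so is the right-hand side, which is its derivative.
\<close>

lemma ode_solution_smooth:
  fixes X :: "'e::real_inner \<Rightarrow> 'e"
  assumes E: "parseval_frame (E::'e set)" and X: "smooth_on U X" and U: "open U" and I: "open (I::real set)"
    and x: "\<And>t. t \<in> I \<Longrightarrow> x t \<in> U \<and> (x has_vector_derivative X (x t)) (at t)"
  shows "smooth_on I x"
  unfolding smooth_on_def
proof
  fix k
  show "Ck_on k I x"
  proof (induction k)
    case 0
    have "isCont x t" if "t \<in> I" for t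
      using x[OF that] has_vector_derivative_continuous[of x _ t UNIV] by blast
    then show ?case by (simp add: continuous_at_imp_continuous_on)
  next
    case (Suc k)
    have "Ck_on k I (\<lambda>t. X (x t))"
      by (rule Ck_on_compose[OF E I U Suc]) (use X x in \<open>auto simp: smooth_on_def\<close>)
    then have "Ck_on k I (\<lambda>t. v *\<^sub>R X (x t))" for v
      by (rule Ck_on_bounded_linear_comp[OF bounded_linear_scaleR_right I])
    then show ?case
      by (intro Ck_on_SucI[where f' = "\<lambda>t v. v *\<^sub>R X (x t)", OF I]) (use x in \<open>auto simp: has_vector_derivative_def\<close>)
  qed
qed

section \<open>Plots of a manifold\<close>

text \<open>
A map into a manifold that is smooth in every chart of the target. Its source is an open subset of a normed
space, so that no charts of the source are involved. Parameters ranging over several manifolds are treated by plots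
on products of chart ranges.
\<close>

definition plot :: "('m::topological_space, 'e::real_normed_vector) chart set \<Rightarrow>
    'p::real_normed_vector set \<Rightarrow> ('p \<Rightarrow> 'm) \<Rightarrow> bool" where
  "plot A S p \<longleftrightarrow> open S \<and> continuous_on S p \<and>
     (\<forall>d\<in>A. smooth_on (S \<inter> p -` chart_dom d) (\<lambda>x. chart_map d (p x)))"

lemma is_chartD:
  assumes "is_chart c"
  shows "open (chart_dom c)" "open (chart_ran c)"
    "x \<in> chart_dom c \<Longrightarrow> chart_inv c (chart_map c x) = x"
    "y \<in> chart_ran c \<Longrightarrow> chart_map c (chart_inv c y) = y"
    "y \<in> chart_ran c \<Longrightarrow> chart_inv c y \<in> chart_dom c"
    "x \<in> chart_dom c \<Longrightarrow> chart_map c x \<in> chart_ran c"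
    "continuous_on (chart_dom c) (chart_map c)" "continuous_on (chart_ran c) (chart_inv c)"
  using assms by (auto simp: is_chart_def homeomorphism_def)

lemma is_chart_open_image:
  assumes "is_chart c" "open T"
  shows "open (chart_map c ` (chart_dom c \<inter> T))"
proof -
  have "chart_map c ` (chart_dom c \<inter> T) = chart_ran c \<inter> chart_inv c -` T"
    using is_chartD(3-6)[OF assms(1)] by (auto simp: image_iff)
  then show ?thesis
    using continuous_open_preimage[OF is_chartD(8,2)[OF assms(1)] assms(2)] by simp
qed

lemma plot_open: "plot A S p \<Longrightarrow> open S"
  and plot_continuous: "plot A S p \<Longrightarrow> continuous_on S p"
  by (auto simp: plot_def)

lemma plot_open_preimage: "plot A S p \<Longrightarrow> open T \<Longrightarrow> open (S \<inter> p -` T)"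
  by (metis continuous_open_preimage plot_def)

lemma plot_coord: "plot A S p \<Longrightarrow> d \<in> A \<Longrightarrow> smooth_on (S \<inter> p -` chart_dom d) (\<lambda>x. chart_map d (p x))"
  by (simp add: plot_def)

lemma plot_cong:
  assumes "plot A S p" "\<And>x. x \<in> S \<Longrightarrow> p x = q x" "\<forall>c\<in>A. is_chart c"
  shows "plot A S q"
  unfolding plot_def
proof (intro conjI ballI)
  show "open S" using assms(1) plot_open by blast
  show "continuous_on S q" using plot_continuous[OF assms(1)] assms(2) by (simp cong: continuous_on_cong)
  fix d assume d: "d \<in> A"
  have eq: "S \<inter> q -` chart_dom d = S \<inter> p -` chart_dom d" using assms(2) by auto
  show "smooth_on (S \<inter> q -` chart_dom d) (\<lambda>x. chart_map d (q x))"
    unfolding eq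
  proof (rule smooth_on_cong[OF plot_coord[OF assms(1) d]])
    show "open (S \<inter> p -` chart_dom d)"
      using plot_open_preimage[OF assms(1)] is_chartD(1) assms(3) d by blast
  qed (use assms(2) in auto)
qed

lemma plot_const: "open S \<Longrightarrow> plot A S (\<lambda>_. m)"
proof -
  assume S: "open S"
  have "open (S \<inter> (\<lambda>_. m) -` T)" for T
    using S by (cases "m \<in> T") auto
  then show ?thesis using S by (auto simp: plot_def intro: smooth_on_const)
qed

lemma plot_reparam:
  fixes r :: "'p::real_normed_vector \<Rightarrow> 'q::real_inner"
  assumes "parseval_frame (E::'q set)" "plot A T p" "smooth_on S r" "open S" "r ` S \<subseteq> T" "\<forall>c\<in>A. is_chart c"
  shows "plot A S (\<lambda>x. p (r x))"
  unfolding plot_def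
proof (intro conjI ballI)
  have r: "continuous_on S r" by (rule smooth_on_continuous[OF assms(3)])
  show cont: "continuous_on S (\<lambda>x. p (r x))"
    using continuous_on_compose2[OF plot_continuous[OF assms(2)] r assms(5)] .
  fix d assume d: "d \<in> A"
  have od: "open (chart_dom d)" using assms(6) d is_chartD(1) by blast
  show "smooth_on (S \<inter> (\<lambda>x. p (r x)) -` chart_dom d) (\<lambda>x. chart_map d (p (r x)))"
    by (rule smooth_on_compose[OF assms(1) plot_coord[OF assms(2) d]])
      (use assms(5) od cont in \<open>auto intro: smooth_on_subset[OF assms(3)] plot_open_preimage[OF assms(2)]
        continuous_open_preimage assms(4)\<close>)
qed (rule assms(4))

lemma plot_chart_inv:
  assumes "is_chart c" "c \<in> A"
    and "\<forall>d\<in>A. smooth_on (chart_map c ` (chart_dom c \<inter> chart_dom d)) (chart_map d \<circ> chart_inv c)"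
  shows "plot A (chart_ran c) (chart_inv c)"
  unfolding plot_def
proof (intro conjI ballI)
  fix d assume d: "d \<in> A"
  have "chart_ran c \<inter> chart_inv c -` chart_dom d = chart_map c ` (chart_dom c \<inter> chart_dom d)"
    using is_chartD(3-6)[OF assms(1)] by (auto simp: image_iff)
  then show "smooth_on (chart_ran c \<inter> chart_inv c -` chart_dom d) (\<lambda>x. chart_map d (chart_inv c x))"
    using assms(3) d by (simp add: o_def)
qed (use is_chartD[OF assms(1)] in auto)

text \<open>
Locally the composite factors through a chart around the given point of the middle manifold.
\<close>

lemma plot_smooth_map:
  fixes A :: "('m::topological_space, 'e::real_inner) chart set"
  assumes E: "parseval_frame (E::'e set)" and A: "\<forall>c\<in>A. is_chart c" "(\<Union>c\<in>A. chart_dom c) = UNIV"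
    and A': "\<forall>c\<in>A'. is_chart c" and f: "smooth_map A A' f" and p: "plot A S p"
  shows "plot A' S (\<lambda>x. f (p x))"
  unfolding plot_def
proof (intro conjI ballI)
  show S: "open S" by (rule plot_open[OF p])
  have fc: "continuous_on UNIV f" using f by (simp add: smooth_map_def)
  show cont: "continuous_on S (\<lambda>x. f (p x))"
    using continuous_on_compose2[OF fc plot_continuous[OF p]] by simp
  fix d assume d: "d \<in> A'"
  have od: "open (chart_dom d)" using d A' is_chartD(1) by blast
  show "smooth_on (S \<inter> (\<lambda>x. f (p x)) -` chart_dom d) (\<lambda>x. chart_map d (f (p x)))"
  proof (rule smooth_on_local)
    fix x assume x: "x \<in> S \<inter> (\<lambda>x. f (p x)) -` chart_dom d"
    obtain c where c: "c \<in> A" "p x \<in> chart_dom c" using A(2) by blast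
    have cc: "is_chart c" using A(1) c(1) by blast
    define V where "V = f -` chart_dom d"
    have oV: "open V" unfolding V_def using open_vimage[OF od fc] .
    define W where "W = S \<inter> p -` (chart_dom c \<inter> V)"
    have oW: "open W" unfolding W_def
      by (rule plot_open_preimage[OF p]) (use is_chartD(1)[OF cc] oV in auto)
    have 1: "smooth_on (chart_map c ` (chart_dom c \<inter> V)) (chart_map d \<circ> f \<circ> chart_inv c)"
      using f c(1) d unfolding smooth_map_def V_def by blast
    have 2: "smooth_on W (\<lambda>x. chart_map c (p x))"
      by (rule smooth_on_subset[OF plot_coord[OF p c(1)]]) (auto simp: W_def)
    have "smooth_on W (\<lambda>x. (chart_map d \<circ> f \<circ> chart_inv c) (chart_map c (p x)))"
      by (rule smooth_on_compose[OF E 1 2 oW is_chart_open_image[OF cc oV]]) (auto simp: W_def)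
    then have "smooth_on W (\<lambda>x. chart_map d (f (p x)))"
      by (rule smooth_on_cong[OF _ oW]) (use is_chartD(3)[OF cc] in \<open>auto simp: W_def\<close>)
    then show "\<exists>W. open W \<and> x \<in> W \<and> smooth_on W (\<lambda>x. chart_map d (f (p x)))"
      using oW x c by (intro exI[of _ W]) (auto simp: W_def V_def)
  qed
qed

text \<open>
A converse of \<open>plot_smooth_map\<close>: the inverses of the charts are plots, and it suffices to test smoothness on them.
\<close>

lemma smooth_mapI_plot:
  assumes A: "\<forall>c\<in>A. is_chart c" "(\<Union>c\<in>A. chart_dom c) = UNIV"
    and f: "\<And>c. c \<in> A \<Longrightarrow> plot A' (chart_ran c) (\<lambda>x. f (chart_inv c x))"
  shows "smooth_map A A' f"
  unfolding smooth_map_def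
proof (intro conjI ballI)
  have "continuous_on (\<Union>c\<in>A. chart_dom c) f"
  proof (rule continuous_on_open_UN)
    fix c assume c: "c \<in> A"
    then have cc: "is_chart c" using A(1) by blast
    show "open (chart_dom c)" by (rule is_chartD(1)[OF cc])
    have "continuous_on (chart_dom c) (\<lambda>x. f (chart_inv c (chart_map c x)))"
      by (rule continuous_on_compose2[OF plot_continuous[OF f[OF c]] is_chartD(7)[OF cc]]) auto
    then show "continuous_on (chart_dom c) f"
      by (rule continuous_on_eq) (use is_chartD(3)[OF cc] in auto)
  qed
  then show "continuous_on UNIV f" using A(2) by simp
  fix c d assume c: "c \<in> A" and d: "d \<in> A'"
  then have cc: "is_chart c" using A(1) by blast
  have "chart_map c ` (chart_dom c \<inter> f -` chart_dom d) = chart_ran c \<inter> (\<lambda>x. f (chart_inv c x)) -` chart_dom d"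
    using is_chartD(3-6)[OF cc] by (auto simp: image_iff)
  then show "smooth_on (chart_map c ` (chart_dom c \<inter> f -` chart_dom d)) (chart_map d \<circ> f \<circ> chart_inv c)"
    using plot_coord[OF f[OF c] d] by (simp add: o_def)
qed

abbreviation prod_chart :: "('m, 'e) chart \<Rightarrow> ('n, 'f) chart \<Rightarrow> ('m \<times> 'n, 'e \<times> 'f) chart" where
  "prod_chart c d \<equiv> (chart_dom c \<times> chart_dom d, map_prod (chart_map c) (chart_map d))"

lemma prod_chart_inv:
  assumes "is_chart c" "is_chart d" "z \<in> chart_ran c \<times> chart_ran d"
  shows "chart_inv (prod_chart c d) z = (chart_inv c (fst z), chart_inv d (snd z))"
proof -
  have inj: "inj_on (chart_map c) (chart_dom c)" "inj_on (chart_map d) (chart_dom d)"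
    using is_chartD(3)[OF assms(1)] is_chartD(3)[OF assms(2)] by (auto intro: inj_on_inverseI)
  obtain x y where xy: "x \<in> chart_dom c" "y \<in> chart_dom d" "z = (chart_map c x, chart_map d y)"
    using assms(3) by auto
  have "inj_on (map_prod (chart_map c) (chart_map d)) (chart_dom c \<times> chart_dom d)"
    using inj by (rule map_prod_inj_on)
  from inv_into_f_f[OF this, of "(x, y)"] show ?thesis
    using xy is_chartD(3)[OF assms(1)] is_chartD(3)[OF assms(2)] by (simp add: chart_inv_def)
qed

lemma is_chart_prod:
  assumes c: "is_chart c" and d: "is_chart d"
  shows "is_chart (prod_chart c d)"
proof -
  have ran: "chart_ran (prod_chart c d) = chart_ran c \<times> chart_ran d"
    by (auto simp: map_prod_surj_on)
  have 1: "continuous_on (chart_dom c \<times> chart_dom d) (map_prod (chart_map c) (chart_map d))"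
    unfolding map_prod_def case_prod_beta
    by (intro continuous_on_Pair continuous_on_compose2[OF is_chartD(7)[OF c]] continuous_on_compose2[OF is_chartD(7)[OF d]]
        continuous_on_fst continuous_on_snd continuous_on_id) auto
  have 2: "continuous_on (chart_ran c \<times> chart_ran d) (chart_inv (prod_chart c d))"
  proof (rule continuous_on_eq)
    show "continuous_on (chart_ran c \<times> chart_ran d) (\<lambda>z. (chart_inv c (fst z), chart_inv d (snd z)))"
      by (intro continuous_on_Pair continuous_on_compose2[OF is_chartD(8)[OF c]] continuous_on_compose2[OF is_chartD(8)[OF d]]
        continuous_on_fst continuous_on_snd continuous_on_id) auto
  qed (use prod_chart_inv[OF c d] in auto)
  have inv: "chart_inv (prod_chart c d) (map_prod (chart_map c) (chart_map d) z) = z" if "z \<in> chart_dom c \<times> chart_dom d" for z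
    using that prod_chart_inv[OF c d, of "map_prod (chart_map c) (chart_map d) z"] is_chartD(3)[OF c] is_chartD(3)[OF d] by auto
  have inv': "map_prod (chart_map c) (chart_map d) (chart_inv (prod_chart c d) z) = z" if "z \<in> chart_ran c \<times> chart_ran d" for z
    using that by (simp add: prod_chart_inv[OF c d that] is_chartD(4)[OF c] is_chartD(4)[OF d] prod_eq_iff mem_Times_iff)
  have "homeomorphism (chart_dom c \<times> chart_dom d) (chart_ran c \<times> chart_ran d)
      (map_prod (chart_map c) (chart_map d)) (chart_inv (prod_chart c d))"
  proof (rule homeomorphismI[OF 1 2])
    show "chart_inv (prod_chart c d) ` (chart_ran c \<times> chart_ran d) \<subseteq> chart_dom c \<times> chart_dom d"
    proof
      fix z assume "z \<in> chart_inv (prod_chart c d) ` (chart_ran c \<times> chart_ran d)"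
      then obtain y where y: "y \<in> chart_ran c \<times> chart_ran d" "z = chart_inv (prod_chart c d) y" by blast
      then show "z \<in> chart_dom c \<times> chart_dom d"
        by (simp add: prod_chart_inv[OF c d y(1)] is_chartD(5)[OF c] is_chartD(5)[OF d] mem_Times_iff)
    qed
  qed (use inv inv' in auto)
  then show ?thesis
    using is_chartD(1,2)[OF c] is_chartD(1,2)[OF d] unfolding is_chart_def ran by (auto intro: open_Times)
qed

lemma plot_Pair:
  assumes p: "plot A S p" and q: "plot A' S q" and A: "\<forall>c\<in>A. is_chart c" "\<forall>c\<in>A'. is_chart c"
  shows "plot (prod_atlas A A') S (\<lambda>x. (p x, q x))"
  unfolding plot_def
proof (intro conjI ballI)
  show S: "open S" by (rule plot_open[OF p])
  show "continuous_on S (\<lambda>x. (p x, q x))"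
    by (intro continuous_on_Pair plot_continuous[OF p] plot_continuous[OF q])
  fix e assume "e \<in> prod_atlas A A'"
  then obtain c d where e: "e = prod_chart c d" and c: "c \<in> A" and d: "d \<in> A'"
    unfolding prod_atlas_def by blast
  have "open (chart_dom c)" "open (chart_dom d)" using A c d is_chartD(1) by blast+
  then have o: "open (S \<inter> p -` chart_dom c \<inter> (S \<inter> q -` chart_dom d))"
    by (intro open_Int plot_open_preimage[OF p] plot_open_preimage[OF q])
  have "smooth_on (S \<inter> p -` chart_dom c \<inter> (S \<inter> q -` chart_dom d)) (\<lambda>x. (chart_map c (p x), chart_map d (q x)))"
    by (rule smooth_on_Pair[OF o smooth_on_subset[OF plot_coord[OF p c]] smooth_on_subset[OF plot_coord[OF q d]]]) auto
  moreover have "S \<inter> (\<lambda>x. (p x, q x)) -` chart_dom e = S \<inter> p -` chart_dom c \<inter> (S \<inter> q -` chart_dom d)"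
    by (auto simp: e)
  ultimately show "smooth_on (S \<inter> (\<lambda>x. (p x, q x)) -` chart_dom e) (\<lambda>x. chart_map e (p x, q x))"
    by (simp add: e)
qed

lemma smooth_manifoldD:
  assumes "smooth_manifold (A :: ('m::{t2_space, second_countable_topology}, 'e::{real_inner, banach}) chart set)"
  shows "\<exists>E::'e set. parseval_frame E" "\<forall>c\<in>A. is_chart c" "(\<Union>c\<in>A. chart_dom c) = UNIV"
    "c \<in> A \<Longrightarrow> plot A (chart_ran c) (chart_inv c)"
  using assms parseval_frame_of_span plot_chart_inv[of c A] unfolding smooth_manifold_def by blast+

lemma prod_atlasD:
  assumes "smooth_manifold (A :: ('m::{t2_space, second_countable_topology}, 'e::{real_inner, banach}) chart set)"
    and "smooth_manifold (A' :: ('n::{t2_space, second_countable_topology}, 'f::{real_inner, banach}) chart set)"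
  shows "\<exists>E::('e \<times> 'f) set. parseval_frame E" "\<forall>c\<in>prod_atlas A A'. is_chart c"
    "(\<Union>c\<in>prod_atlas A A'. chart_dom c) = UNIV"
proof -
  show "\<exists>E::('e \<times> 'f) set. parseval_frame E"
    using smooth_manifoldD(1)[OF assms(1)] smooth_manifoldD(1)[OF assms(2)] parseval_frame_prod by blast
  show "\<forall>c\<in>prod_atlas A A'. is_chart c"
    using smooth_manifoldD(2)[OF assms(1)] smooth_manifoldD(2)[OF assms(2)] is_chart_prod
    unfolding prod_atlas_def by blast
  have "\<exists>c\<in>prod_atlas A A'. z \<in> chart_dom c" for z
  proof -
    obtain c d where "c \<in> A" "fst z \<in> chart_dom c" "d \<in> A'" "snd z \<in> chart_dom d"
      using smooth_manifoldD(3)[OF assms(1)] smooth_manifoldD(3)[OF assms(2)] by blast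
    moreover from this have "prod_chart c d \<in> prod_atlas A A'" unfolding prod_atlas_def by blast
    ultimately show ?thesis by (intro bexI[of _ "prod_chart c d"]) (auto simp: mem_Times_iff)
  qed
  then show "(\<Union>c\<in>prod_atlas A A'. chart_dom c) = UNIV" by auto
qed

lemma plot_smooth_map1:
  fixes A :: "('m::{t2_space, second_countable_topology}, 'e::{real_inner, banach}) chart set"
    and A' :: "('n::{t2_space, second_countable_topology}, 'f::{real_inner, banach}) chart set"
  assumes "smooth_manifold A" "smooth_manifold A'" "smooth_map A A' f" "plot A S p"
  shows "plot A' S (\<lambda>x. f (p x))"
  using plot_smooth_map[OF _ smooth_manifoldD(2,3)[OF assms(1)] smooth_manifoldD(2)[OF assms(2)] assms(3,4)]
    smooth_manifoldD(1)[OF assms(1)] by blast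

lemma plot_smooth_map2:
  fixes A :: "('m::{t2_space, second_countable_topology}, 'e::{real_inner, banach}) chart set"
    and A' :: "('n::{t2_space, second_countable_topology}, 'f::{real_inner, banach}) chart set"
    and A'' :: "('k::{t2_space, second_countable_topology}, 'g::{real_inner, banach}) chart set"
  assumes "smooth_manifold A" "smooth_manifold A'" "smooth_manifold A''"
    and "smooth_map (prod_atlas A A') A'' (\<lambda>(x, y). f x y)" "plot A S p" "plot A' S q"
  shows "plot A'' S (\<lambda>x. f (p x) (q x))"
proof -
  obtain E :: "('e \<times> 'f) set" where E: "parseval_frame E"
    using prod_atlasD(1)[OF assms(1,2)] by blast
  from plot_smooth_map[OF E prod_atlasD(2,3)[OF assms(1,2)] smooth_manifoldD(2)[OF assms(3)] assms(4)
      plot_Pair[OF assms(5,6) smooth_manifoldD(2)[OF assms(1)] smooth_manifoldD(2)[OF assms(2)]]]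
  show ?thesis by simp
qed

lemma smooth_map2I_plot:
  fixes A :: "('m::{t2_space, second_countable_topology}, 'e::{real_inner, banach}) chart set"
    and A' :: "('n::{t2_space, second_countable_topology}, 'f::{real_inner, banach}) chart set"
    and A'' :: "('k::{t2_space, second_countable_topology}, 'g::{real_inner, banach}) chart set"
  assumes M: "smooth_manifold A" "smooth_manifold A'" "smooth_manifold A''"
    and f: "\<And>(S::('e \<times> 'f) set) p q. plot A S p \<Longrightarrow> plot A' S q \<Longrightarrow> plot A'' S (\<lambda>x. f (p x) (q x))"
  shows "smooth_map (prod_atlas A A') A'' (\<lambda>(x, y). f x y)"
proof (rule smooth_mapI_plot[OF prod_atlasD(2,3)[OF M(1,2)]])
  fix e assume "e \<in> prod_atlas A A'"
  then obtain c d where e: "e = prod_chart c d" and c: "c \<in> A" and d: "d \<in> A'"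
    unfolding prod_atlas_def by blast
  note A = smooth_manifoldD(2)[OF M(1)] and A' = smooth_manifoldD(2)[OF M(2)]
  have cc: "is_chart c" "is_chart d" using A A' c d by blast+
  have ran: "chart_ran e = chart_ran c \<times> chart_ran d"
    by (auto simp: e map_prod_surj_on)
  have o: "open (chart_ran c \<times> chart_ran d)" by (intro open_Times is_chartD(2) cc)
  obtain E :: "'e set" and F :: "'f set" where EF: "parseval_frame E" "parseval_frame F"
    using smooth_manifoldD(1)[OF M(1)] smooth_manifoldD(1)[OF M(2)] by blast
  have "plot A (chart_ran c \<times> chart_ran d) (\<lambda>z. chart_inv c (fst z))"
    by (rule plot_reparam[OF EF(1) smooth_manifoldD(4)[OF M(1) c] smooth_on_bounded_linear[OF bounded_linear_fst o smooth_on_ident[OF o]] o _ A]) force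
  moreover have "plot A' (chart_ran c \<times> chart_ran d) (\<lambda>z. chart_inv d (snd z))"
    by (rule plot_reparam[OF EF(2) smooth_manifoldD(4)[OF M(2) d] smooth_on_bounded_linear[OF bounded_linear_snd o smooth_on_ident[OF o]] o _ A']) force
  ultimately have "plot A'' (chart_ran c \<times> chart_ran d) (\<lambda>z. f (chart_inv c (fst z)) (chart_inv d (snd z)))"
    by (rule f)
  then show "plot A'' (chart_ran e) (\<lambda>z. (\<lambda>(x, y). f x y) (chart_inv e z))"
    unfolding ran
  proof (rule plot_cong)
    show "f (chart_inv c (fst z)) (chart_inv d (snd z)) = (\<lambda>(x, y). f x y) (chart_inv e z)"
      if "z \<in> chart_ran c \<times> chart_ran d" for z
      using prod_chart_inv[OF cc that] by (simp add: e)
  qed (rule smooth_manifoldD(2)[OF M(3)])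
qed

lemma smooth_map_real_iff_plot: "smooth_map vec_atlas A \<gamma> \<longleftrightarrow> plot A (UNIV::real set) \<gamma>"
  by (simp add: smooth_map_def plot_def vec_atlas_def chart_inv_def o_def)

section \<open>One-parameter subgroups\<close>

lemma plot_local:
  assumes "open S" "\<And>x. x \<in> S \<Longrightarrow> \<exists>W. open W \<and> x \<in> W \<and> plot A W p" and A: "\<forall>c\<in>A. is_chart c"
  shows "plot A S p"
  unfolding plot_def
proof (intro conjI ballI)
  have at: "isCont p x" if x: "x \<in> S" for x
    using assms(2)[OF x] plot_continuous continuous_on_eq_continuous_at by blast
  then show cont: "continuous_on S p" by (simp add: continuous_at_imp_continuous_on)
  fix d assume d: "d \<in> A"
  show "smooth_on (S \<inter> p -` chart_dom d) (\<lambda>x. chart_map d (p x))"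
  proof (rule smooth_on_local)
    fix x assume x: "x \<in> S \<inter> p -` chart_dom d"
    then obtain W where W: "open W" "x \<in> W" "plot A W p" using assms(2) by blast
    have "open (chart_dom d)" using A d is_chartD(1) by blast
    then show "\<exists>W. open W \<and> x \<in> W \<and> smooth_on W (\<lambda>x. chart_map d (p x))"
      using W x plot_coord[OF W(3) d] plot_open_preimage[OF W(3)]
      by (intro exI[of _ "W \<inter> p -` chart_dom d"]) auto
  qed
qed fact

lemma smooth_on_fst: "open S \<Longrightarrow> smooth_on S fst"
  and smooth_on_snd: "open S \<Longrightarrow> smooth_on S snd"
  using smooth_on_bounded_linear[OF bounded_linear_fst _ smooth_on_ident]
    smooth_on_bounded_linear[OF bounded_linear_snd _ smooth_on_ident] by blast+

lemma has_vector_derivative_affine_reparam: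
  assumes "(g has_vector_derivative D) (at (a * t + b))"
  shows "((\<lambda>s. g (a * s + b)) has_vector_derivative a *\<^sub>R D) (at (t::real))"
proof -
  have "((\<lambda>s. a * s + b) has_vector_derivative a) (at t)"
    unfolding has_real_derivative_iff_has_vector_derivative[symmetric] by (auto intro!: derivative_eq_intros)
  from vector_diff_chain_at[OF this assms] show ?thesis by (simp add: o_def)
qed

lemma has_vector_derivative_chain:
  assumes "(x has_vector_derivative x') (at t)" "(f has_derivative D) (at (x t))"
  shows "((\<lambda>t. f (x t)) has_vector_derivative D x') (at t)"
  using vector_derivative_diff_chain_within[of x x' t UNIV f D] assms has_derivative_at_withinI[OF assms(2)]
  by (simp add: o_def)

lemma has_derivative_partial_snd:
  "(f has_derivative D) (at (p, q)) \<Longrightarrow> ((\<lambda>q. f (p, q)) has_derivative (\<lambda>v. D (0, v))) (at q)"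
  by (rule has_derivative_compose[of "Pair p" "Pair 0" q UNIV f])
    (auto intro: has_derivative_Pair has_derivative_const has_derivative_ident)

lemma has_derivative_partial_fst:
  "(f has_derivative D) (at (p, q)) \<Longrightarrow> ((\<lambda>p. f (p, q)) has_derivative (\<lambda>v. D (v, 0))) (at p)"
  by (rule has_derivative_compose[of "\<lambda>p. (p, q)" "\<lambda>v. (v, 0)" p UNIV f])
    (auto intro: has_derivative_Pair has_derivative_const has_derivative_ident)

text \<open>
A group with smooth product and a chosen chart around the unit. The product, its unit and the atlas are separate parameters,
because two groups are considered on the manifold of \<open>H\<close>.
\<close>

locale smooth_group =
  fixes A :: "('h::{t2_space, second_countable_topology}, 'b::{real_inner, banach}) chart set"
    and c :: "('h, 'b) chart"
    and mul :: "'h \<Rightarrow> 'h \<Rightarrow> 'h" (infixl "\<cdot>" 70)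
    and e :: 'h
  assumes manifold: "smooth_manifold A"
    and chart: "c \<in> A" "e \<in> chart_dom c"
    and mul_assoc: "(x \<cdot> y) \<cdot> z = x \<cdot> (y \<cdot> z)"
    and left_unit: "e \<cdot> x = x" and right_unit: "x \<cdot> e = x"
    and left_inverse: "\<exists>y. y \<cdot> x = e"
    and mul_smooth: "smooth_map (prod_atlas A A) A (\<lambda>(x, y). x \<cdot> y)"
begin

abbreviation "U \<equiv> chart_ran c"
abbreviation "\<kappa> \<equiv> chart_map c"
abbreviation "\<iota> \<equiv> chart_inv c"
abbreviation "e0 \<equiv> \<kappa> e"

text \<open>
\<open>m\<close> is the product in coordinates and \<open>W\<close> the open set on which these coordinates are meaningful;
\<open>field u\<close> is the left-invariant vector field with value \<open>u\<close> at the unit.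
\<close>

definition m :: "'b \<Rightarrow> 'b \<Rightarrow> 'b" where "m p q = \<kappa> (\<iota> p \<cdot> \<iota> q)"

definition W :: "('b \<times> 'b) set" where "W = {(p, q). p \<in> U \<and> q \<in> U \<and> \<iota> p \<cdot> \<iota> q \<in> chart_dom c}"

definition field :: "'b \<Rightarrow> 'b \<Rightarrow> 'b" where "field u p = frechet_derivative (m p) (at e0) u"

lemma charts: "\<forall>c\<in>A. is_chart c" by (rule smooth_manifoldD(2)[OF manifold])

lemma is_chart: "is_chart c" using charts chart(1) by blast

lemma frame_exists: "\<exists>E::'b set. parseval_frame E" by (rule smooth_manifoldD(1)[OF manifold])

lemma frame2_exists: "\<exists>E::('b \<times> 'b) set. parseval_frame E" using frame_exists parseval_frame_prod by blast

lemma open_U: "open U" and \<iota>_\<kappa>: "x \<in> chart_dom c \<Longrightarrow> \<iota> (\<kappa> x) = x"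
  and \<kappa>_\<iota>: "p \<in> U \<Longrightarrow> \<kappa> (\<iota> p) = p" and \<iota>_dom: "p \<in> U \<Longrightarrow> \<iota> p \<in> chart_dom c"
  and open_dom: "open (chart_dom c)"
  using is_chartD[OF is_chart] by blast+

lemma e0_U: "e0 \<in> U" using chart(2) by blast

lemma \<iota>_e0: "\<iota> e0 = e" by (rule \<iota>_\<kappa>[OF chart(2)])

lemma plot_mul: "plot A S p \<Longrightarrow> plot A S q \<Longrightarrow> plot A S (\<lambda>x. p x \<cdot> q x)"
  by (rule plot_smooth_map2[OF manifold manifold manifold mul_smooth])

lemma plot_\<iota>: "plot A U \<iota>" by (rule smooth_manifoldD(4)[OF manifold chart(1)])

lemma plot_mul2: "plot A (U \<times> U) (\<lambda>z. \<iota> (fst z) \<cdot> \<iota> (snd z))"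
proof -
  obtain E :: "'b set" where E: "parseval_frame E" using frame_exists by blast
  have o: "open (U \<times> U)" by (intro open_Times open_U)
  show ?thesis
    by (intro plot_mul plot_reparam[OF E plot_\<iota> _ o _ charts] smooth_on_fst smooth_on_snd o) force+
qed

lemma W_eq: "W = (U \<times> U) \<inter> (\<lambda>z. \<iota> (fst z) \<cdot> \<iota> (snd z)) -` chart_dom c"
  by (auto simp: W_def)

lemma open_W: "open W"
  unfolding W_eq by (rule plot_open_preimage[OF plot_mul2 open_dom])

lemma smooth_m: "smooth_on W (\<lambda>z. m (fst z) (snd z))"
  using plot_coord[OF plot_mul2 chart(1)] unfolding W_eq m_def .

definition Dm :: "'b \<times> 'b \<Rightarrow> 'b \<times> 'b \<Rightarrow> 'b" where "Dm z = frechet_derivative (\<lambda>z. m (fst z) (snd z)) (at z)"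

lemma m_has_derivative: "z \<in> W \<Longrightarrow> ((\<lambda>z. m (fst z) (snd z)) has_derivative Dm z) (at z)"
  unfolding Dm_def by (rule smooth_on_has_derivative[OF smooth_m])

lemma m_has_derivative_snd: "(p, q) \<in> W \<Longrightarrow> (m p has_derivative (\<lambda>v. Dm (p, q) (0, v))) (at q)"
  using has_derivative_partial_snd[OF m_has_derivative] by simp

lemma e0_W: "p \<in> U \<Longrightarrow> (p, e0) \<in> W" "p \<in> U \<Longrightarrow> (e0, p) \<in> W"
  using e0_U \<iota>_dom by (auto simp: W_def \<iota>_e0 left_unit right_unit)

lemma m_e0: "p \<in> U \<Longrightarrow> m p e0 = p" "p \<in> U \<Longrightarrow> m e0 p = p"
  by (auto simp: m_def \<iota>_e0 left_unit right_unit \<kappa>_\<iota>)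

lemma field_eq: "p \<in> U \<Longrightarrow> field u p = Dm (p, e0) (0, u)"
  unfolding field_def using frechet_derivative_at[OF m_has_derivative_snd[OF e0_W(1)]] by metis

lemma m_has_derivative_field: "p \<in> U \<Longrightarrow> (m p has_derivative (\<lambda>u. field u p)) (at e0)"
  using m_has_derivative_snd[OF e0_W(1), of p] field_eq[of p] by (simp add: fun_eq_iff)

lemma linear_field: "p \<in> U \<Longrightarrow> linear (\<lambda>u. field u p)"
  using m_has_derivative_field has_derivative_linear by blast

lemma smooth_field: "smooth_on U (field u)"
proof -
  obtain E :: "('b \<times> 'b) set" where E: "parseval_frame E" using frame2_exists by blast
  have "smooth_on W (\<lambda>z. Dm z (0, u))"
    unfolding Dm_def by (rule smooth_on_derivative[OF smooth_m])
  then have "smooth_on U (\<lambda>p. Dm (p, e0) (0, u))"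
  proof (rule smooth_on_compose[OF E _ _ open_U open_W])
    show "smooth_on U (\<lambda>p. (p, e0))"
      by (rule smooth_on_Pair[OF open_U smooth_on_ident[OF open_U] smooth_on_const[OF open_U]])
  qed (use e0_W in auto)
  then show ?thesis
    by (rule smooth_on_cong[OF _ open_U]) (simp add: field_eq)
qed

lemma field_e0: "field u e0 = u"
proof -
  have "(m e0 has_derivative (\<lambda>u. u)) (at e0)"
    by (rule has_derivative_transform_within_open[OF has_derivative_ident open_U e0_U]) (simp add: m_e0)
  from has_derivative_unique[OF this m_has_derivative_field[OF e0_U]] show ?thesis by metis
qed

text \<open>
Left invariance, from associativity: differentiate \<open>m (m p q) r = m p (m q r)\<close> in \<open>r\<close> at the unit.
\<close>

lemma field_translate:
  assumes "(p, q) \<in> W"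
  shows "field u (m p q) = Dm (p, q) (0, field u q)"
proof -
  have pq: "p \<in> U" "q \<in> U" "m p q \<in> U" "\<iota> (m p q) = \<iota> p \<cdot> \<iota> q"
    using assms \<iota>_\<kappa> by (auto simp: W_def m_def)
  have 1: "(m (m p q) has_derivative (\<lambda>u. field u (m p q))) (at e0)"
    by (rule m_has_derivative_field[OF pq(3)])
  have "(m p has_derivative (\<lambda>v. Dm (p, q) (0, v))) (at (m q e0))"
    using m_has_derivative_snd[OF assms] m_e0 pq by simp
  from has_derivative_compose[OF m_has_derivative_field[OF pq(2)] this]
  have 2: "((\<lambda>r. m p (m q r)) has_derivative (\<lambda>u. Dm (p, q) (0, field u q))) (at e0)" .
  let ?V = "{r \<in> U. (q, r) \<in> W}"
  have "?V = U \<inter> (\<lambda>r. (q, r)) -` W" by auto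
  then have V: "open ?V"
    using continuous_open_preimage[OF _ open_U open_W, of "\<lambda>r. (q, r)"] by (simp add: continuous_on_Pair)
  have "((\<lambda>r. m p (m q r)) has_derivative (\<lambda>u. field u (m p q))) (at e0)"
  proof (rule has_derivative_transform_within_open[OF 1 V])
    show "e0 \<in> ?V" using e0_U e0_W pq by simp
    show "m (m p q) r = m p (m q r)" if "r \<in> ?V" for r
      using that pq \<iota>_\<kappa> by (simp add: m_def W_def mul_assoc)
  qed
  from has_derivative_unique[OF this 2] show ?thesis by metis
qed

definition one_param :: "'b \<Rightarrow> (real \<Rightarrow> 'h) \<Rightarrow> bool" where
  "one_param u \<gamma> \<longleftrightarrow> plot A UNIV \<gamma> \<and> (\<forall>s t. \<gamma> (s + t) = \<gamma> s \<cdot> \<gamma> t) \<and>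
     ((\<lambda>t. \<kappa> (\<gamma> t)) has_vector_derivative u) (at 0)"

text \<open>
The value at \<open>0\<close> is idempotent, hence the unit.
\<close>

lemma one_param_zero: "one_param u \<gamma> \<Longrightarrow> \<gamma> 0 = e"
proof -
  assume "one_param u \<gamma>"
  then have "\<gamma> 0 = \<gamma> 0 \<cdot> \<gamma> 0" unfolding one_param_def by (metis add_0)
  moreover obtain y where "y \<cdot> \<gamma> 0 = e" using left_inverse by blast
  ultimately show ?thesis using mul_assoc left_unit by metis
qed

lemma one_param_continuous: "one_param u \<gamma> \<Longrightarrow> continuous_on UNIV \<gamma>"
  using plot_continuous by (auto simp: one_param_def)

lemma one_param_ode:
  assumes \<gamma>: "one_param u \<gamma>" and t: "\<gamma> t \<in> chart_dom c"
  shows "((\<lambda>t. \<kappa> (\<gamma> t)) has_vector_derivative field u (\<kappa> (\<gamma> t))) (at t)"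
proof -
  have p: "\<kappa> (\<gamma> t) \<in> U" using t by blast
  have "(m (\<kappa> (\<gamma> t)) has_derivative (\<lambda>u. field u (\<kappa> (\<gamma> t)))) (at (\<kappa> (\<gamma> (t - t))))"
    using m_has_derivative_field[OF p] one_param_zero[OF \<gamma>] by simp
  moreover have "((\<lambda>s. \<kappa> (\<gamma> (s - t))) has_vector_derivative 1 *\<^sub>R u) (at t)"
    using has_vector_derivative_affine_reparam[of "\<lambda>r. \<kappa> (\<gamma> r)" u 1 t "-t"] \<gamma>
    by (simp add: one_param_def)
  ultimately have 1: "((\<lambda>s. m (\<kappa> (\<gamma> t)) (\<kappa> (\<gamma> (s - t)))) has_vector_derivative field u (\<kappa> (\<gamma> t))) (at t)"
    using has_vector_derivative_chain[of "\<lambda>s. \<kappa> (\<gamma> (s - t))" u t] by simp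
  have 2: "open ((\<lambda>s. \<gamma> (s - t)) -` chart_dom c)"
    by (rule open_vimage[OF open_dom]) (intro continuous_on_compose2[OF one_param_continuous[OF \<gamma>]] continuous_intros, auto)
  have 3: "t \<in> (\<lambda>s. \<gamma> (s - t)) -` chart_dom c" using one_param_zero[OF \<gamma>] chart by simp
  have 4: "m (\<kappa> (\<gamma> t)) (\<kappa> (\<gamma> (s - t))) = \<kappa> (\<gamma> s)" if "s \<in> (\<lambda>s. \<gamma> (s - t)) -` chart_dom c" for s
  proof -
    have "\<gamma> (t + (s - t)) = \<gamma> t \<cdot> \<gamma> (s - t)" using \<gamma> unfolding one_param_def by blast
    then have "\<gamma> t \<cdot> \<gamma> (s - t) = \<gamma> s" by simp
    then show ?thesis using that t \<iota>_\<kappa> by (simp add: m_def)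
  qed
  show ?thesis by (rule has_vector_derivative_transform_within_open[OF 1 2 3 4])
qed

primrec pw :: "'h \<Rightarrow> nat \<Rightarrow> 'h" where
  "pw x 0 = e" | "pw x (Suc n) = x \<cdot> pw x n"

lemma pw_add: "pw x (i + j) = pw x i \<cdot> pw x j"
  by (induction i) (auto simp: left_unit mul_assoc)

lemma pw_mult: "pw x (i * j) = pw (pw x i) j"
  by (induction j) (auto simp: pw_add)

lemma pw_commute: "x \<cdot> y = y \<cdot> x \<Longrightarrow> pw (x \<cdot> y) n = pw x n \<cdot> pw y n"
proof -
  assume xy: "x \<cdot> y = y \<cdot> x"
  have y: "pw x n \<cdot> y = y \<cdot> pw x n" for n
  proof (induction n)
    case (Suc n)
    have "pw x (Suc n) \<cdot> y = (x \<cdot> y) \<cdot> pw x n" by (simp add: mul_assoc Suc)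
    then show ?case by (simp add: xy mul_assoc)
  qed (simp add: left_unit right_unit)
  show ?thesis
  proof (induction n)
    case (Suc n)
    have "pw (x \<cdot> y) (Suc n) = x \<cdot> (y \<cdot> pw x n) \<cdot> pw y n" by (simp add: mul_assoc Suc)
    also have "\<dots> = x \<cdot> pw x n \<cdot> (y \<cdot> pw y n)" by (simp add: y[symmetric] mul_assoc)
    finally show ?case by simp
  qed (simp add: left_unit)
qed

text \<open>
A homomorphism defined near \<open>0\<close> satisfies the power law as long as the arguments stay in its domain. This carries
uniqueness and existence of one-parameter subgroups from a neighbourhood of \<open>0\<close> to the whole line.
\<close>

lemma local_hom_pw:
  assumes "\<And>s t. \<bar>s\<bar> \<le> b \<Longrightarrow> \<bar>t\<bar> \<le> b \<Longrightarrow> g (s + t) = g s \<cdot> g t" "g 0 = e" "\<bar>real n * s\<bar> \<le> b"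
  shows "g (real n * s) = pw (g s) n"
  using assms(3)
proof (induction n)
  case 0
  then show ?case by (simp add: assms(2))
next
  case (Suc n)
  have "\<bar>real n * s\<bar> \<le> \<bar>real (Suc n) * s\<bar>" "\<bar>s\<bar> \<le> \<bar>real (Suc n) * s\<bar>"
    unfolding abs_mult using mult_right_mono[of 1 "real (Suc n)" "\<bar>s\<bar>"] by (auto intro: mult_right_mono)
  then have "\<bar>real n * s\<bar> \<le> b" "\<bar>s\<bar> \<le> b" using Suc.prems by linarith+
  then show ?case using Suc.IH assms(1)[of s "real n * s"] by (simp add: algebra_simps)
qed

text \<open>
In the chart, both curves solve the equation of the same left-invariant field, so they agree near \<open>0\<close>, and
a homomorphism on the line is determined by its values near \<open>0\<close>.
\<close>

lemma one_param_unique: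
  assumes 1: "one_param u \<gamma>" and 2: "one_param u \<delta>"
  shows "\<gamma> = \<delta>"
proof -
  obtain E :: "'b set" where E: "parseval_frame E" using frame_exists by blast
  obtain r L where rL: "r > 0" "L \<ge> 0" "cball e0 r \<subseteq> U"
    "\<And>x y. x \<in> cball e0 r \<Longrightarrow> y \<in> cball e0 r \<Longrightarrow> norm (field u x - field u y) \<le> L * norm (x - y)"
    using smooth_on_locally_lipschitz[OF E smooth_field open_U e0_U] by metis
  have near: "\<forall>\<^sub>F t in nhds 0. \<beta> t \<in> chart_dom c \<and> \<kappa> (\<beta> t) \<in> cball e0 r" if \<beta>: "one_param u \<beta>" for \<beta>
  proof -
    have "open (UNIV \<inter> \<beta> -` chart_dom c)"
      by (rule plot_open_preimage[OF conjunct1[OF \<beta>[unfolded one_param_def]] open_dom])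
    then have a: "\<forall>\<^sub>F t in nhds 0. \<beta> t \<in> chart_dom c"
      using one_param_zero[OF \<beta>] chart unfolding eventually_nhds
      by (intro exI[of _ "\<beta> -` chart_dom c"]) auto
    have "isCont (\<lambda>t. \<kappa> (\<beta> t)) 0" using \<beta> has_vector_derivative_continuous by (auto simp: one_param_def)
    then have "((\<lambda>t. \<kappa> (\<beta> t)) \<longlongrightarrow> e0) (nhds 0)"
      using one_param_zero[OF \<beta>] by (simp add: isCont_def tendsto_nhds_iff)
    then have "\<forall>\<^sub>F t in nhds 0. dist (\<kappa> (\<beta> t)) e0 < r" using rL(1) by (rule tendstoD)
    then show ?thesis using a by eventually_elim (auto simp: dist_commute)
  qed
  from eventually_conj[OF near[OF 1] near[OF 2]] obtain d where d: "d > 0"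
    "\<And>t. \<bar>t\<bar> < d \<Longrightarrow> \<gamma> t \<in> chart_dom c \<and> \<kappa> (\<gamma> t) \<in> cball e0 r \<and> \<delta> t \<in> chart_dom c \<and> \<kappa> (\<delta> t) \<in> cball e0 r"
    unfolding eventually_nhds_metric by (auto simp: dist_real_def)
  define a where "a = min (d / 2) (1 / (2 * (L + 1)))"
  have a: "a > 0" "a < d" "L * a < 1"
  proof -
    show "a > 0" "a < d" using d(1) rL(2) by (auto simp: a_def min_def)
    have "a \<le> 1 / (2 * (L + 1))" by (simp add: a_def)
    then have "a * (2 * (L + 1)) \<le> 1" using rL(2) by (simp add: field_simps)
    then show "L * a < 1" using \<open>a > 0\<close> by (simp add: algebra_simps)
  qed
  have eq: "\<gamma> t = \<delta> t" if t: "\<bar>t\<bar> \<le> a" for t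
  proof -
    have "\<kappa> (\<gamma> t) = \<kappa> (\<delta> t)"
    proof (rule ode_local_uniqueness[OF rL(2) _ a(3), where S="cball e0 r" and X="field u"])
      show "\<kappa> (\<gamma> t) \<in> cball e0 r \<and> ((\<lambda>t. \<kappa> (\<gamma> t)) has_vector_derivative field u (\<kappa> (\<gamma> t))) (at t)"
        if "t \<in> {-a..a}" for t using d(2)[of t] that a one_param_ode[OF 1] by auto
      show "\<kappa> (\<delta> t) \<in> cball e0 r \<and> ((\<lambda>t. \<kappa> (\<delta> t)) has_vector_derivative field u (\<kappa> (\<delta> t))) (at t)"
        if "t \<in> {-a..a}" for t using d(2)[of t] that a one_param_ode[OF 2] by auto
    qed (use rL a t one_param_zero[OF 1] one_param_zero[OF 2] in auto)
    then show ?thesis using \<iota>_\<kappa> d(2)[of t] t a by (metis order.strict_trans1)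
  qed
  show ?thesis
  proof
    fix t
    obtain n :: nat where n: "\<bar>t\<bar> / a < n" using reals_Archimedean2 by blast
    moreover have "0 \<le> \<bar>t\<bar> / a" using a by simp
    ultimately have n0: "real n > 0" by linarith
    have "\<bar>t / n\<bar> \<le> a" using n n0 a by (simp add: field_simps)
    then have "\<gamma> (t / n) = \<delta> (t / n)" by (rule eq)
    moreover have "\<beta> t = pw (\<beta> (t / n)) n" if "one_param u \<beta>" for \<beta>
      using local_hom_pw[of "\<bar>t\<bar>  + \<bar>t / n\<bar>" \<beta> n "t / n"] that one_param_zero[OF that] n0
      by (simp add: one_param_def)
    ultimately show "\<gamma> t = \<delta> t" using 1 2 by metis
  qed
qed

text \<open>
The integral curve \<open>x\<close> of a left-invariant field through the unit is a homomorphism near \<open>0\<close>: by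
\<open>field_translate\<close> the left translate \<open>m (x s) (x t)\<close> is an integral curve in \<open>t\<close>, and so is \<open>x (s + t)\<close>, with the same
value at \<open>t = 0\<close>.
\<close>

lemma local_one_param_exists:
  "\<exists>b>0. \<exists>x. x 0 = e0 \<and> (\<forall>t\<in>{-b<..<b}. x t \<in> U) \<and> smooth_on {-b<..<b} x \<and>
     (x has_vector_derivative u) (at 0) \<and>
     (\<forall>s t. \<bar>s\<bar> < b \<longrightarrow> \<bar>t\<bar> < b \<longrightarrow> \<bar>s + t\<bar> < b \<longrightarrow> \<iota> (x (s + t)) = \<iota> (x s) \<cdot> \<iota> (x t))"
proof -
  obtain E :: "'b set" where E: "parseval_frame E" using frame_exists by blast
  obtain r L where rL: "r > 0" "L \<ge> 0" "cball e0 r \<subseteq> U"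
    "\<And>x y. x \<in> cball e0 r \<Longrightarrow> y \<in> cball e0 r \<Longrightarrow> norm (field u x - field u y) \<le> L * norm (x - y)"
    using smooth_on_locally_lipschitz[OF E smooth_field open_U e0_U] by metis
  obtain a x where a: "a > 0" and x0: "x 0 = e0"
    and x: "\<And>t. t \<in> {-a<..<a} \<Longrightarrow> x t \<in> cball e0 r \<and> (x has_vector_derivative field u (x t)) (at t)"
    using ode_local_existence[OF rL(1,2,4)] by metis
  have xU: "t \<in> {-a<..<a} \<Longrightarrow> x t \<in> U" for t using x rL(3) by blast
  have smooth: "smooth_on {-a<..<a} x"
    by (rule ode_solution_smooth[OF E smooth_field open_U]) (use x rL(3) in auto)
  have contx: "isCont x 0" using x[of 0] a has_vector_derivative_continuous by auto
  have "((\<lambda>z. m (fst z) (snd z)) \<longlongrightarrow> e0) (nhds (e0, e0))"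
    using smooth_on_continuous[OF smooth_m] continuous_on_eq_continuous_at[OF open_W] e0_W[OF e0_U] m_e0[OF e0_U]
    by (force simp: isCont_def tendsto_nhds_iff)
  then have "\<forall>\<^sub>F z in nhds (e0, e0). dist (m (fst z) (snd z)) e0 < r" using rL(1) by (rule tendstoD)
  moreover have "\<forall>\<^sub>F z in nhds (e0, e0). z \<in> W" using open_W e0_W[OF e0_U] eventually_nhds by blast
  ultimately have "\<forall>\<^sub>F z in nhds (e0, e0). z \<in> W \<and> dist (m (fst z) (snd z)) e0 < r"
    by eventually_elim auto
  then have "\<forall>\<^sub>F z in nhds e0 \<times>\<^sub>F nhds e0. z \<in> W \<and> dist (m (fst z) (snd z)) e0 < r"
    by (simp add: nhds_prod)
  then obtain P where P: "eventually P (nhds e0)" "\<And>p q. P p \<Longrightarrow> P q \<Longrightarrow> (p, q) \<in> W \<and> dist (m p q) e0 < r"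
    unfolding eventually_prod_same by (metis fst_conv snd_conv)
  have "(x \<longlongrightarrow> e0) (nhds 0)" using contx x0 by (simp add: isCont_def tendsto_nhds_iff)
  then have "\<forall>\<^sub>F t in nhds 0. P (x t)" using P(1) by (simp add: filterlim_iff)
  then obtain d where d: "d > 0" "\<And>t. \<bar>t\<bar> < d \<Longrightarrow> P (x t)"
    unfolding eventually_nhds_metric by (auto simp: dist_real_def)
  define b where "b = min (min d (a / 2)) (1 / (2 * (L + 1)))"
  have b: "b > 0" "b \<le> d" "b \<le> a / 2" "L * b < 1"
  proof -
    show "b > 0" "b \<le> d" "b \<le> a / 2" using d(1) a rL(2) by (auto simp: b_def min_def)
    have "b \<le> 1 / (2 * (L + 1))" by (simp add: b_def)
    then have "b * (2 * (L + 1)) \<le> 1" using rL(2) by (simp add: field_simps)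
    then show "L * b < 1" using \<open>b > 0\<close> by (simp add: algebra_simps)
  qed
  have hom: "x (s + t) = m (x s) (x t)" if s: "\<bar>s\<bar> < b" and t: "\<bar>t\<bar> < b" for s t
  proof (rule ode_local_uniqueness[where S="cball e0 r" and X="field u" and a="\<bar>t\<bar>" and L=L and x="\<lambda>t. x (s + t)" and y="\<lambda>t. m (x s) (x t)"])
    have "L * \<bar>t\<bar> \<le> L * b" using t rL(2) by (intro mult_left_mono) auto
    then show "L * \<bar>t\<bar> < 1" using b(4) by linarith
    have sa: "s \<in> {-a<..<a}" using s b a by auto
    show "x (s + 0) = m (x s) (x 0)" using m_e0 xU[OF sa] x0 by simp
    fix t' assume t': "t' \<in> {-\<bar>t\<bar>..\<bar>t\<bar>}"
    have st: "s + t' \<in> {-a<..<a}" and ta: "t' \<in> {-a<..<a}" and bd: "\<bar>t'\<bar> < d" "\<bar>s\<bar> < d" using t' t s b a by auto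
    have "((\<lambda>t. x (s + t)) has_vector_derivative 1 *\<^sub>R field u (x (s + t'))) (at t')"
      using has_vector_derivative_affine_reparam[of x "field u (x (s + t'))" 1 t' s] x[OF st]
      by (simp add: add.commute)
    then show "x (s + t') \<in> cball e0 r \<and> ((\<lambda>t. x (s + t)) has_vector_derivative field u (x (s + t'))) (at t')"
      using x[OF st] by simp
    have W: "(x s, x t') \<in> W" "dist (m (x s) (x t')) e0 < r" using P(2) d(2) bd by blast+
    have "((\<lambda>t. m (x s) (x t)) has_vector_derivative Dm (x s, x t') (0, field u (x t'))) (at t')"
      using has_vector_derivative_chain[of x "field u (x t')" t', OF _ m_has_derivative_snd[OF W(1)]] x[OF ta] by blast
    then show "m (x s) (x t') \<in> cball e0 r \<and> ((\<lambda>t. m (x s) (x t)) has_vector_derivative field u (m (x s) (x t'))) (at t')"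
      using W by (simp add: field_translate dist_commute)
  qed (use rL in auto)
  have "\<iota> (x (s + t)) = \<iota> (x s) \<cdot> \<iota> (x t)" if s: "\<bar>s\<bar> < b" and t: "\<bar>t\<bar> < b" for s t
  proof -
    have "\<bar>s\<bar> < d" "\<bar>t\<bar> < d" using s t b by auto
    then have "(x s, x t) \<in> W" using P(2) d(2) by blast
    then show ?thesis using hom[OF s t] \<iota>_\<kappa> by (simp add: m_def W_def)
  qed
  moreover have "smooth_on {-b<..<b} x" by (rule smooth_on_subset[OF smooth]) (use b a in auto)
  moreover have "\<forall>t\<in>{-b<..<b}. x t \<in> U" using xU b a by auto
  moreover have "(x has_vector_derivative u) (at 0)" using x[of 0] a x0 field_e0 by simp
  ultimately show ?thesis using b(1) x0 by (intro exI[of _ b] conjI exI[of _ x]) auto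
qed

text \<open>
The local homomorphism \<open>g\<close> extends by \<open>\<Gamma> t = g (t / n)\<^sup>n\<close> for any \<open>n\<close> that makes \<open>t / n\<close> small. A
common refinement shows independence of \<open>n\<close>, and for two arguments a common \<open>n\<close> shows that \<open>\<Gamma>\<close> is a homomorphism. It is
smooth near every \<open>t\<close> because \<open>\<Gamma> s = \<Gamma> t \<cdot> g (s - t)\<close> there.
\<close>

lemma one_param_exists: "\<exists>\<gamma>. one_param u \<gamma>"
proof -
  obtain E :: "'b set" where E: "parseval_frame E" using frame_exists by blast
  obtain b' x where b': "b' > 0" and x0: "x 0 = e0" and xU: "\<And>t. t \<in> {-b'<..<b'} \<Longrightarrow> x t \<in> U"
    and smooth: "smooth_on {-b'<..<b'} x" and deriv: "(x has_vector_derivative u) (at 0)"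
    and hom: "\<And>s t. \<bar>s\<bar> < b' \<Longrightarrow> \<bar>t\<bar> < b' \<Longrightarrow> \<bar>s + t\<bar> < b' \<Longrightarrow> \<iota> (x (s + t)) = \<iota> (x s) \<cdot> \<iota> (x t)"
    using local_one_param_exists[of u] by metis
  define b where "b = b' / 3"
  have b: "b > 0" "2 * b < b'" using b' by (auto simp: b_def)
  define g where "g t = \<iota> (x t)" for t
  have g: "g (s + t) = g s \<cdot> g t" if "\<bar>s\<bar> \<le> b" "\<bar>t\<bar> \<le> b" for s t
    unfolding g_def by (rule hom) (use that b in auto)
  have g0: "g 0 = e" by (simp add: g_def x0 \<iota>_e0)
  have gp: "plot A {-b<..<b} g"
    unfolding g_def
    by (rule plot_reparam[OF E plot_\<iota> smooth_on_subset[OF smooth] _ _ charts]) (use b xU in auto)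
  \<comment> \<open>The successor keeps the number of factors positive at \<open>t = 0\<close>.\<close>
  define N where "N t = Suc (nat \<lceil>\<bar>t\<bar> / b\<rceil>)" for t
  have N: "\<bar>t / N t\<bar> \<le> b" for t
  proof -
    have "\<bar>t\<bar> / b \<le> N t" unfolding N_def by linarith
    then have "\<bar>t\<bar> \<le> N t * b" using b by (simp add: field_simps)
    then show ?thesis by (simp add: N_def field_simps)
  qed
  define \<Gamma> where "\<Gamma> t = pw (g (t / N t)) (N t)" for t
  have indep: "\<Gamma> t = pw (g (t / n)) n" if n: "n > 0" "\<bar>t / n\<bar> \<le> b" for t and n :: nat
  proof -
    have sub: "g (t / i) = pw (g (t / (real i * real j))) j" if "i > 0" "j > 0" "\<bar>t / i\<bar> \<le> b" for i j :: nat
      using local_hom_pw[of b g j "t / (real i * real j)", OF g g0] that by simp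
    have "N t > 0" by (simp add: N_def)
    have "pw (g (t / N t)) (N t) = pw (g (t / (real (N t) * real n))) (n * N t)"
      using sub[OF \<open>N t > 0\<close> n(1) N] by (simp add: pw_mult)
    also have "\<dots> = pw (g (t / n)) n"
      using sub[OF n(1) \<open>N t > 0\<close> n(2)] by (simp add: pw_mult[symmetric] mult.commute)
    finally show ?thesis by (simp add: \<Gamma>_def)
  qed
  have \<Gamma>g: "\<Gamma> t = g t" if "\<bar>t\<bar> \<le> b" for t
    using indep[of 1 t] that by (simp add: right_unit)
  have \<Gamma>hom: "\<Gamma> (s + t) = \<Gamma> s \<cdot> \<Gamma> t" for s t
  proof -
    define n where "n = N (\<bar>s\<bar> + \<bar>t\<bar>)"
    have n: "n > 0" by (simp add: n_def N_def)
    have bd: "(\<bar>s\<bar> + \<bar>t\<bar>) / n \<le> b" using N[of "\<bar>s\<bar> + \<bar>t\<bar>"] by (simp add: n_def)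
    have le: "\<bar>r / n\<bar> \<le> b" if "\<bar>r\<bar> \<le> \<bar>s\<bar> + \<bar>t\<bar>" for r
    proof -
      have "\<bar>r / n\<bar> \<le> (\<bar>s\<bar> + \<bar>t\<bar>) / n" using that by (simp add: divide_right_mono)
      then show ?thesis using bd by linarith
    qed
    have l: "\<bar>s / n\<bar> \<le> b" "\<bar>t / n\<bar> \<le> b" "\<bar>(s + t) / n\<bar> \<le> b" by (rule le; linarith)+
    have "g (s / n) \<cdot> g (t / n) = g (t / n) \<cdot> g (s / n)"
      using g[OF l(1,2)] g[OF l(2,1)] by (simp add: add.commute)
    from pw_commute[OF this, of n] have "pw (g ((s + t) / n)) n = pw (g (s / n)) n \<cdot> pw (g (t / n)) n"
      using g[OF l(1,2)] by (simp add: add_divide_distrib)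
    then show ?thesis using indep[OF n l(1)] indep[OF n l(2)] indep[OF n l(3)] by simp
  qed
  have "plot A UNIV \<Gamma>"
  proof (rule plot_local[OF open_UNIV _ charts])
    fix t :: real
    have "plot A {t - b<..<t + b} (\<lambda>s. g (s - t))"
    proof (rule plot_reparam[OF parseval_frame_real gp _ _ _ charts])
      show "smooth_on {t - b<..<t + b} (\<lambda>s. s - t)"
        using smooth_on_add[OF _ smooth_on_ident smooth_on_const, of "{t - b<..<t + b}" "- t"] by simp
    qed auto
    then have "plot A {t - b<..<t + b} (\<lambda>s. \<Gamma> t \<cdot> g (s - t))"
      by (intro plot_mul plot_const) auto
    then have "plot A {t - b<..<t + b} \<Gamma>"
    proof (rule plot_cong[OF _ _ charts])
      fix s assume "s \<in> {t - b<..<t + b}"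
      then show "\<Gamma> t \<cdot> g (s - t) = \<Gamma> s" using \<Gamma>hom[of t "s - t"] \<Gamma>g[of "s - t"] by auto
    qed
    then show "\<exists>W. open W \<and> t \<in> W \<and> plot A W \<Gamma>"
      using b by (intro exI[of _ "{t - b<..<t + b}"]) auto
  qed
  moreover have "((\<lambda>t. \<kappa> (\<Gamma> t)) has_vector_derivative u) (at 0)"
    by (rule has_vector_derivative_transform_within_open[OF deriv, of "{-b<..<b}"])
      (use b xU in \<open>auto simp: \<Gamma>g g_def \<kappa>_\<iota>\<close>)
  ultimately show ?thesis unfolding one_param_def using \<Gamma>hom by blast
qed

definition exp_curve :: "'b \<Rightarrow> real \<Rightarrow> 'h" where "exp_curve u = (THE \<gamma>. one_param u \<gamma>)"

lemma one_param_exp_curve: "one_param u (exp_curve u)"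
proof -
  have "\<exists>!\<gamma>. one_param u \<gamma>" using one_param_exists one_param_unique by metis
  then show ?thesis unfolding exp_curve_def by (rule theI')
qed

lemma exp_curve_scale: "exp_curve (t *\<^sub>R u) r = exp_curve u (r * t)"
proof -
  have u: "one_param u (exp_curve u)" by (rule one_param_exp_curve)
  have "plot A UNIV (\<lambda>r. exp_curve u (r * t))"
  proof (rule plot_reparam[OF parseval_frame_real _ _ _ _ charts])
    show "plot A UNIV (exp_curve u)" using u by (simp add: one_param_def)
    show "smooth_on UNIV (\<lambda>r. r * t)"
      using smooth_on_bounded_linear[OF bounded_linear_mult_left open_UNIV smooth_on_ident] by simp
  qed auto
  moreover have "((\<lambda>r. \<kappa> (exp_curve u (r * t))) has_vector_derivative t *\<^sub>R u) (at 0)"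
    using has_vector_derivative_affine_reparam[of "\<lambda>r. \<kappa> (exp_curve u r)" u t 0 0] u
    by (simp add: one_param_def mult.commute)
  ultimately have "one_param (t *\<^sub>R u) (\<lambda>r. exp_curve u (r * t))"
    using u by (simp add: one_param_def distrib_right)
  then show ?thesis using one_param_unique[OF one_param_exp_curve] by metis
qed

lemmas exp_curve_plot = one_param_exp_curve[unfolded one_param_def, THEN conjunct1]
  and exp_curve_add = one_param_exp_curve[unfolded one_param_def, THEN conjunct2, THEN conjunct1, rule_format]
  and exp_curve_deriv = one_param_exp_curve[unfolded one_param_def, THEN conjunct2, THEN conjunct2]
  and exp_curve_zero = one_param_zero[OF one_param_exp_curve]

end

section \<open>The second-order part of a product\<close>

lemma has_derivative_unique_apply:
  "(f has_derivative D) (at x) \<Longrightarrow> (f has_derivative D') (at x) \<Longrightarrow> D v = D' v"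
  using has_derivative_unique by metis

text \<open>
Symmetry of the second derivative on a product, in a form suited to partial derivatives whose other order of
differentiation is known.
\<close>

lemma mixed_partials:
  fixes f :: "'e::real_normed_vector \<times> 'f::real_normed_vector \<Rightarrow> 'w::real_inner"
  assumes f: "smooth_on V f" and V: "open V" "(p0, k0) \<in> V"
  shows "\<exists>D. ((\<lambda>k. frechet_derivative f (at (p0, k)) (x, 0)) has_derivative D) (at k0) \<and>
     (\<forall>w D'. ((\<lambda>p. frechet_derivative f (at (p, k0)) (0, w)) has_derivative D') (at p0) \<longrightarrow> D w = D' x)"
proof -
  let ?D = "\<lambda>v. frechet_derivative (\<lambda>z. frechet_derivative f (at z) v) (at (p0, k0))"
  have D: "((\<lambda>z. frechet_derivative f (at z) v) has_derivative ?D v) (at (p0, k0))" for v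
    by (rule smooth_on_has_derivative[OF smooth_on_derivative[OF f] V(2)])
  have "?D (x, 0) (0, w) = D' x"
    if D': "((\<lambda>p. frechet_derivative f (at (p, k0)) (0, w)) has_derivative D') (at p0)" for w D'
  proof -
    have "((\<lambda>p. frechet_derivative f (at (p, k0)) (0, w)) has_derivative (\<lambda>v. ?D (0, w) (v, 0))) (at p0)"
      by (rule has_derivative_partial_fst[OF D])
    from has_derivative_unique_apply[OF D' this] have "D' x = ?D (0, w) (x, 0)" by simp
    also have "\<dots> = ?D (x, 0) (0, w)"
      by (rule second_derivative_symmetric[OF V]) (use f in \<open>auto simp: smooth_on_def\<close>)
    finally show ?thesis by simp
  qed
  moreover have "((\<lambda>k. frechet_derivative f (at (p0, k)) (x, 0)) has_derivative (\<lambda>w. ?D (x, 0) (0, w))) (at k0)"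
    by (rule has_derivative_partial_snd[OF D])
  ultimately show ?thesis by (intro exI[of _ "\<lambda>w. ?D (x, 0) (0, w)"] conjI allI impI) blast+
qed

context smooth_group
begin

text \<open>
In coordinates centred at the unit, the Taylor expansion of the product is \<open>p + q + \<beta> p q\<close> up to third order;
further terms in \<open>p\<close> alone or \<open>q\<close> alone are excluded because the unit is neutral. The Lie bracket is
\<open>\<beta> u v - \<beta> v u\<close>.
\<close>

definition \<beta> :: "'b \<Rightarrow> 'b \<Rightarrow> 'b" where "\<beta> u v = frechet_derivative (field v) (at e0) u"

lemma field_has_derivative: "(field v has_derivative (\<lambda>u. \<beta> u v)) (at e0)"
  unfolding \<beta>_def by (rule smooth_on_has_derivative[OF smooth_field e0_U])

lemma eventually_U: "\<forall>\<^sub>F p in nhds e0. p \<in> U"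
  using open_U e0_U eventually_nhds by blast

lemma field_along:
  assumes f: "(f has_derivative f') (at x)" "f x = e0" and X: "(X has_derivative X') (at x)"
  shows "((\<lambda>k. field (X k) (f k)) has_derivative (\<lambda>h. \<beta> (f' h) (X x) + X' h)) (at x)"
proof -
  obtain E :: "'b set" where E: "parseval_frame E" using frame_exists by blast
  have "((\<lambda>k. field v (f k)) has_derivative (\<lambda>h. \<beta> (f' h) v)) (at x)" for v
    by (rule has_derivative_compose[of f f' x UNIV "field v", OF f(1)]) (simp add: f(2) field_has_derivative)
  moreover have "\<forall>\<^sub>F k in nhds x. linear (\<lambda>v. field v (f k))"
  proof -
    have "(f \<longlongrightarrow> e0) (nhds x)"
      using has_derivative_continuous[OF f(1)] f(2) by (simp add: isCont_def tendsto_nhds_iff)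
    then have "\<forall>\<^sub>F k in nhds x. f k \<in> U" using eventually_U unfolding filterlim_iff by blast
    then show ?thesis by eventually_elim (rule linear_field)
  qed
  ultimately have "((\<lambda>k. field (X k) (f k)) has_derivative (\<lambda>h. \<beta> (f' h) (X x) + field (X' h) (f x))) (at x)"
    by (intro derivative_along_field[OF E _ _ X])
  then show ?thesis by (simp add: f(2) field_e0)
qed

text \<open>
The right-invariant vector field. Its derivative at the unit is \<open>\<beta>\<close> with the arguments
exchanged in comparison with \<open>field\<close>, by symmetry of the mixed second derivative of the product.
\<close>

definition rfield :: "'b \<Rightarrow> 'b \<Rightarrow> 'b" where "rfield x p = Dm (e0, p) (x, 0)"

lemma rfield_has_derivative: "(rfield x has_derivative (\<lambda>y. \<beta> x y)) (at e0)"
proof -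
  obtain D where D: "((\<lambda>k. Dm (e0, k) (x, 0)) has_derivative D) (at e0)"
    "\<And>w D'. ((\<lambda>p. Dm (p, e0) (0, w)) has_derivative D') (at e0) \<Longrightarrow> D w = D' x"
    using mixed_partials[OF smooth_m open_W e0_W(1)[OF e0_U], of x] unfolding Dm_def by blast
  have "((\<lambda>p. Dm (p, e0) (0, w)) has_derivative (\<lambda>u. \<beta> u w)) (at e0)" for w
    by (rule has_derivative_transform_within_open[OF field_has_derivative open_U e0_U]) (simp add: field_eq)
  then have "D w = \<beta> x w" for w by (rule D(2))
  then have "D = \<beta> x" by (rule ext)
  then show ?thesis using D(1) by (simp add: rfield_def[abs_def])
qed

lemma Dm_unit_fst: "p \<in> U \<Longrightarrow> Dm (p, e0) (y, 0) = y"
proof -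
  assume p: "p \<in> U"
  have "((\<lambda>p. m p e0) has_derivative (\<lambda>y. y)) (at p)"
    by (rule has_derivative_transform_within_open[OF has_derivative_ident open_U p]) (simp add: m_e0)
  moreover have "((\<lambda>p. m p e0) has_derivative (\<lambda>y. Dm (p, e0) (y, 0))) (at p)"
    using has_derivative_partial_fst[OF m_has_derivative[OF e0_W(1)[OF p]]] by simp
  ultimately show ?thesis using has_derivative_unique_apply by blast
qed

lemma Dm_split: "z \<in> W \<Longrightarrow> Dm z (x, y) = Dm z (x, 0) + Dm z (0, y)"
  using linear_add[OF has_derivative_linear[OF m_has_derivative], of z "(x, 0)" "(0, y)"] by simp

end

lemma unit_chart_in_atlas:
  assumes "lie_group G"
  shows "unit_chart G \<in> atlas G" "\<one>\<^bsub>G\<^esub> \<in> chart_dom (unit_chart G)"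
proof -
  have "\<exists>c. c \<in> atlas G \<and> \<one>\<^bsub>G\<^esub> \<in> chart_dom c"
    using assms smooth_manifoldD(3)[of "atlas G"] unfolding lie_group_def by blast
  from someI_ex[OF this] show "unit_chart G \<in> atlas G" "\<one>\<^bsub>G\<^esub> \<in> chart_dom (unit_chart G)"
    unfolding unit_chart_def by blast+
qed

lemma lie_group_smooth_group:
  assumes "lie_group G"
  shows "smooth_group (atlas G) (unit_chart G) (mult G) \<one>\<^bsub>G\<^esub>"
proof -
  interpret group G using assms by (simp add: lie_group_def)
  have [simp]: "x \<in> carrier G" for x using assms by (simp add: lie_group_def)
  show ?thesis
  proof
    show "\<exists>y. y \<otimes>\<^bsub>G\<^esub> x = \<one>\<^bsub>G\<^esub>" for x by (rule exI[of _ "inv\<^bsub>G\<^esub> x"]) simp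
  qed (use assms unit_chart_in_atlas[OF assms] in \<open>auto simp: lie_group_def m_assoc\<close>)
qed

section \<open>The descendent Lie group\<close>

locale rota_baxter =
  fixes G :: "('g::{t2_space, second_countable_topology}, 'a::{real_inner, banach}) lie_struct"
    and H :: "('h::{t2_space, second_countable_topology}, 'b::{real_inner, banach}) lie_struct"
    and \<Phi> :: "'g \<Rightarrow> 'h \<Rightarrow> 'h" and \<B> :: "'h \<Rightarrow> 'g"
  assumes lie_G: "lie_group G" and lie_H: "lie_group H"
    and action: "lie_action G H \<Phi>" and rb: "rel_rota_baxter G H \<Phi> \<B>"
begin

abbreviation "mulH x y \<equiv> x \<otimes>\<^bsub>H\<^esub> y"
abbreviation "mulG x y \<equiv> x \<otimes>\<^bsub>G\<^esub> y"
abbreviation "mulK x y \<equiv> x \<otimes>\<^bsub>H\<^esub> \<Phi> (\<B> x) y"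
abbreviation "eH \<equiv> \<one>\<^bsub>H\<^esub>"
abbreviation "eG \<equiv> \<one>\<^bsub>G\<^esub>"

sublocale GG: smooth_group "atlas G" "unit_chart G" mulG eG
  by (rule lie_group_smooth_group[OF lie_G])

sublocale HH: smooth_group "atlas H" "unit_chart H" mulH eH
  by (rule lie_group_smooth_group[OF lie_H])

lemma groups: "group G" "group H" "carrier G = UNIV" "carrier H = UNIV"
  using lie_G lie_H by (auto simp: lie_group_def)

lemma invG: "mulG (inv\<^bsub>G\<^esub> g) g = eG" "mulG g (inv\<^bsub>G\<^esub> g) = eG"
  and invH: "mulH (inv\<^bsub>H\<^esub> h) h = eH" "mulH h (inv\<^bsub>H\<^esub> h) = eH"
  using groups by (auto simp: group.l_inv group.r_inv)

lemma \<Phi>_hom: "\<Phi> g (mulH h h') = mulH (\<Phi> g h) (\<Phi> g h')"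
  and \<Phi>_bij: "bij (\<Phi> g)"
  using action groups unfolding lie_action_def lie_automorphism_def
  by (auto simp: iso_def hom_def Pi_iff)

lemma \<Phi>_mul: "\<Phi> (mulG g g') h = \<Phi> g (\<Phi> g' h)"
  using action by (simp add: lie_action_def)

lemma \<Phi>_unit: "\<Phi> eG h = h"
proof -
  have "\<Phi> eG (\<Phi> eG h) = \<Phi> eG h" by (metis \<Phi>_mul GG.left_unit)
  then show ?thesis using \<Phi>_bij by (metis bij_is_inj inj_eq)
qed

lemma \<Phi>_eH: "\<Phi> g eH = eH"
proof -
  have "mulH (\<Phi> g eH) (\<Phi> g eH) = \<Phi> g eH" by (metis \<Phi>_hom HH.left_unit)
  then show ?thesis by (metis HH.left_unit HH.mul_assoc HH.left_inverse)
qed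

lemma \<B>_mul: "mulG (\<B> h) (\<B> h') = \<B> (mulK h h')"
  using rb by (simp add: rel_rota_baxter_def)

lemma \<B>_unit: "\<B> eH = eG"
proof -
  have "mulG (\<B> eH) (\<B> eH) = \<B> eH" by (simp add: \<B>_mul \<Phi>_eH HH.left_unit)
  then show ?thesis by (metis GG.left_unit GG.mul_assoc GG.left_inverse)
qed

lemma manifolds: "smooth_manifold (atlas G)" "smooth_manifold (atlas H)"
  by (rule GG.manifold HH.manifold)+

lemma plot_\<Phi>: "plot (atlas G) S g \<Longrightarrow> plot (atlas H) S h \<Longrightarrow> plot (atlas H) S (\<lambda>x. \<Phi> (g x) (h x))"
  by (rule plot_smooth_map2[OF manifolds(1) manifolds(2) manifolds(2)]) (use action in \<open>auto simp: lie_action_def\<close>)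

lemma plot_\<B>: "plot (atlas H) S h \<Longrightarrow> plot (atlas G) S (\<lambda>x. \<B> (h x))"
  by (rule plot_smooth_map1[OF manifolds(2,1)]) (use rb in \<open>auto simp: rel_rota_baxter_def\<close>)

lemma plot_invG: "plot (atlas G) S g \<Longrightarrow> plot (atlas G) S (\<lambda>x. inv\<^bsub>G\<^esub> (g x))"
  by (rule plot_smooth_map1[OF manifolds(1,1)]) (use lie_G in \<open>auto simp: lie_group_def\<close>)

lemma mulK_assoc: "mulK (mulK x y) z = mulK x (mulK y z)"
  by (simp add: \<B>_mul[symmetric] \<Phi>_mul \<Phi>_hom HH.mul_assoc)

abbreviation "dag \<equiv> dagger G H \<Phi> \<B>"

text \<open>
By direct computation \<open>dag\<close> is a right inverse. In a monoid in which all elements have right inverses these are two-sided.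
\<close>

lemma mulK_dag: "mulK h (dag h) = eH"
  by (simp add: dagger_def \<Phi>_mul[symmetric] invG \<Phi>_unit invH)

lemma dag_mulK: "mulK (dag h) h = eH"
proof -
  have "mulK (dag h) (dag (dag h)) = eH" by (rule mulK_dag)
  moreover have "mulK h (mulK (dag h) (dag (dag h))) = mulK (mulK h (dag h)) (dag (dag h))"
    by (rule mulK_assoc[symmetric])
  ultimately have "h = dag (dag h)"
    unfolding mulK_dag by (simp add: \<B>_unit \<Phi>_unit \<Phi>_eH HH.left_unit HH.right_unit)
  then show ?thesis using mulK_dag[of "dag h"] by simp
qed

sublocale KK: smooth_group "atlas H" "unit_chart H" mulK eH
proof
  show "\<exists>y. mulK y x = eH" for x using dag_mulK by blast
  show "smooth_map (prod_atlas (atlas H) (atlas H)) (atlas H) (\<lambda>(x, y). mulK x y)"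
    by (rule smooth_map2I_plot[OF manifolds(2) manifolds(2) manifolds(2)]) (intro HH.plot_mul plot_\<Phi> plot_\<B>)
qed (simp_all only: mulK_assoc \<B>_unit \<Phi>_unit \<Phi>_eH HH.left_unit HH.right_unit manifolds HH.chart)

lemma descendent_simps: "mult (descendent H \<Phi> \<B>) = mulK" "atlas (descendent H \<Phi> \<B>) = atlas H"
  "one (descendent H \<Phi> \<B>) = eH" "unit_chart (descendent H \<Phi> \<B>) = unit_chart H"
  by (simp_all add: descendent_def unit_chart_def fun_eq_iff)

text \<open>
The descendent group and \<open>H\<close> have the same atlas and unit, hence the same chart around the unit.
\<close>

lemma lie_exp_descendent: "lie_exp (descendent H \<Phi> \<B>) (t *\<^sub>R u) = KK.exp_curve u t"
proof -
  have "one_parameter_subgroup (descendent H \<Phi> \<B>) v = KK.one_param v" for v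
    by (rule ext) (simp add: one_parameter_subgroup_def KK.one_param_def descendent_simps smooth_map_real_iff_plot o_def)
  then have "lie_exp (descendent H \<Phi> \<B>) v = KK.exp_curve v 1" for v
    by (simp add: lie_exp_def KK.exp_curve_def)
  then show ?thesis by (simp add: KK.exp_curve_scale)
qed

lemma dag_exp_curve: "dag (KK.exp_curve u t) = KK.exp_curve u (- t)"
proof -
  have "mulK (KK.exp_curve u (- t)) (KK.exp_curve u t) = eH"
    using KK.exp_curve_add[of u "- t" t] KK.exp_curve_zero[of u] by simp
  then have "mulK eH (dag (KK.exp_curve u t)) = mulK (KK.exp_curve u (- t)) (mulK (KK.exp_curve u t) (dag (KK.exp_curve u t)))"
    using mulK_assoc[of "KK.exp_curve u (- t)" "KK.exp_curve u t" "dag (KK.exp_curve u t)"] by argo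
  then show ?thesis unfolding mulK_dag KK.right_unit KK.left_unit .
qed

lemma left_inv_field_simps: "left_inv_field G = GG.field" "left_inv_field H = HH.field"
  by (simp_all add: fun_eq_iff left_inv_field_def GG.field_def HH.field_def GG.m_def[abs_def] HH.m_def[abs_def] Let_def)

lemma lie_bracket_simps: "lie_bracket G x y = GG.\<beta> x y - GG.\<beta> y x" "lie_bracket H u v = HH.\<beta> u v - HH.\<beta> v u"
  by (simp_all add: lie_bracket_def Let_def left_inv_field_simps GG.field_e0 HH.field_e0 GG.\<beta>_def HH.\<beta>_def)

section \<open>The differentiated action\<close>

abbreviation "\<phi> \<equiv> diff_action G H \<Phi>"
abbreviation "B \<equiv> tangent_map_unit H G \<B>"

lemma frame_ab: "\<exists>E::('a \<times> 'b) set. parseval_frame E"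
  using GG.frame_exists HH.frame_exists parseval_frame_prod by blast

lemma open_UU: "open (GG.U \<times> HH.U)"
  by (intro open_Times GG.open_U HH.open_U)

lemma plot_fst_snd: "plot (atlas G) (GG.U \<times> HH.U) (\<lambda>z. GG.\<iota> (fst z))" "plot (atlas H) (GG.U \<times> HH.U) (\<lambda>z. HH.\<iota> (snd z))"
proof -
  obtain E :: "'a set" where E: "parseval_frame E" using GG.frame_exists by blast
  show "plot (atlas G) (GG.U \<times> HH.U) (\<lambda>z. GG.\<iota> (fst z))"
    by (rule plot_reparam[OF E GG.plot_\<iota> smooth_on_fst[OF open_UU] open_UU _ GG.charts]) force
  obtain F :: "'b set" where F: "parseval_frame F" using HH.frame_exists by blast
  show "plot (atlas H) (GG.U \<times> HH.U) (\<lambda>z. HH.\<iota> (snd z))"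
    by (rule plot_reparam[OF F HH.plot_\<iota> smooth_on_snd[OF open_UU] open_UU _ HH.charts]) force
qed

text \<open>
\<open>\<psi>\<close> is the action in coordinates and \<open>V\<psi>\<close> the open set on which the coordinates are meaningful. The maps
\<open>\<b>\<close>, \<open>\<tau>\<close> and \<open>\<alpha>\<close> below are treated in the same way.
\<close>

definition \<psi> :: "'a \<times> 'b \<Rightarrow> 'b" where "\<psi> z = HH.\<kappa> (\<Phi> (GG.\<iota> (fst z)) (HH.\<iota> (snd z)))"

definition V\<psi> :: "('a \<times> 'b) set" where
  "V\<psi> = (GG.U \<times> HH.U) \<inter> (\<lambda>z. \<Phi> (GG.\<iota> (fst z)) (HH.\<iota> (snd z))) -` chart_dom (unit_chart H)"

lemma open_V\<psi>: "open V\<psi>"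
  unfolding V\<psi>_def by (rule plot_open_preimage[OF plot_\<Phi>[OF plot_fst_snd] HH.open_dom])

lemma smooth_\<psi>: "smooth_on V\<psi> \<psi>"
  using plot_coord[OF plot_\<Phi>[OF plot_fst_snd] HH.chart(1)] unfolding V\<psi>_def \<psi>_def[abs_def] .

lemma V\<psi>_unit: "r \<in> GG.U \<Longrightarrow> (r, HH.e0) \<in> V\<psi>"
  using HH.chart HH.e0_U by (simp add: V\<psi>_def HH.\<iota>_e0 \<Phi>_eH)

lemma \<psi>_unit: "\<psi> (r, HH.e0) = HH.e0"
  by (simp add: \<psi>_def HH.\<iota>_e0 \<Phi>_eH)

text \<open>
The tangent map of \<open>\<Phi> g\<close> at the unit, as a function of the coordinates \<open>r\<close> of \<open>g\<close>.
\<close>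

definition T :: "'a \<Rightarrow> 'b \<Rightarrow> 'b" where "T r v = frechet_derivative \<psi> (at (r, HH.e0)) (0, v)"

lemma \<psi>_has_derivative_T: "r \<in> GG.U \<Longrightarrow> ((\<lambda>q. \<psi> (r, q)) has_derivative T r) (at HH.e0)"
  unfolding T_def[abs_def]
  by (rule has_derivative_partial_snd[OF smooth_on_has_derivative[OF smooth_\<psi> V\<psi>_unit]])

lemma tangent_map_\<Phi>: "r \<in> GG.U \<Longrightarrow> tangent_map_unit H H (\<Phi> (GG.\<iota> r)) = T r"
  using frechet_derivative_at[OF \<psi>_has_derivative_T[of r]]
  by (simp add: tangent_map_unit_def \<psi>_def[abs_def] o_def)

lemma linear_T: "r \<in> GG.U \<Longrightarrow> linear (T r)"
  using \<psi>_has_derivative_T has_derivative_linear by blast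

lemma T_unit: "T GG.e0 v = v"
proof -
  have "((\<lambda>q. \<psi> (GG.e0, q)) has_derivative (\<lambda>v. v)) (at HH.e0)"
    by (rule has_derivative_transform_within_open[OF has_derivative_ident HH.open_U HH.e0_U])
      (simp add: \<psi>_def GG.\<iota>_e0 \<Phi>_unit HH.\<kappa>_\<iota>)
  from has_derivative_unique_apply[OF this \<psi>_has_derivative_T[OF GG.e0_U]] show ?thesis by simp
qed

lemma smooth_T: "smooth_on GG.U (\<lambda>r. T r v)"
proof -
  obtain E :: "('a \<times> 'b) set" where E: "parseval_frame E" using frame_ab by blast
  show ?thesis unfolding T_def
  proof (rule smooth_on_compose[OF E smooth_on_derivative[OF smooth_\<psi>] _ GG.open_U open_V\<psi>])
    show "smooth_on GG.U (\<lambda>r. (r, HH.e0))"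
      by (rule smooth_on_Pair[OF GG.open_U smooth_on_ident[OF GG.open_U] smooth_on_const[OF GG.open_U]])
  qed (use V\<psi>_unit in auto)
qed

text \<open>
The differentiated action is defined as a derivative in the space of bounded operators. Written as a finite sum of operators of rank
one by means of a frame, the operator-valued map is seen to be differentiable, and then it may be evaluated at a vector.
\<close>

lemma T_has_derivative_\<phi>: "((\<lambda>r. T r v) has_derivative (\<lambda>x. \<phi> x v)) (at GG.e0)"
proof -
  obtain E :: "'b set" where E: "parseval_frame E" using HH.frame_exists by blast
  let ?S = "\<lambda>r. \<Sum>b\<in>E. blinfun_scaleR_left (T r b) o\<^sub>L blinfun_inner_left b"
  have bl: "Blinfun (T r) = ?S r" if r: "r \<in> GG.U" for r
  proof -
    have "T r = blinfun_apply (?S r)"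
      by (rule ext) (simp add: linear_parseval_expand[OF E linear_T[OF r], symmetric] blinfun.sum_left)
    then show ?thesis by (metis blinfun_apply_inverse)
  qed
  have "bounded_linear (\<lambda>w. blinfun_scaleR_left w o\<^sub>L blinfun_inner_left b)" for b :: 'b
    by (intro bounded_linear_compose[OF bounded_bilinear.bounded_linear_left[OF bounded_bilinear_blinfun_compose]]
       bounded_linear_blinfun_scaleR_left)
  from bounded_linear.has_derivative[OF this smooth_on_has_derivative[OF smooth_T GG.e0_U]]
  have "(?S has_derivative (\<lambda>x. \<Sum>b\<in>E. blinfun_scaleR_left (frechet_derivative (\<lambda>r. T r b) (at GG.e0) x)
      o\<^sub>L blinfun_inner_left b)) (at GG.e0)"
    by (rule has_derivative_sum)
  then obtain F where F: "(?S has_derivative F) (at GG.e0)" by blast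
  have F': "((\<lambda>r. Blinfun (T r)) has_derivative F) (at GG.e0)"
    by (rule has_derivative_transform_within_open[OF F GG.open_U GG.e0_U]) (simp add: bl)
  have F'': "((\<lambda>r. Blinfun (tangent_map_unit H H (\<Phi> (GG.\<iota> r)))) has_derivative F) (at GG.e0)"
    by (rule has_derivative_transform_within_open[OF F' GG.open_U GG.e0_U]) (simp add: tangent_map_\<Phi>)
  have \<phi>: "\<phi> x v = blinfun_apply (F x) v" for x
    unfolding diff_action_def by (simp add: frechet_derivative_at[OF F'', symmetric])
  have "((\<lambda>r. blinfun_apply (Blinfun (T r)) v) has_derivative (\<lambda>x. blinfun_apply (F x) v)) (at GG.e0)"
    by (rule bounded_linear.has_derivative[OF blinfun.bounded_linear_left F'])
  then have "((\<lambda>r. T r v) has_derivative (\<lambda>x. blinfun_apply (F x) v)) (at GG.e0)"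
  proof (rule has_derivative_transform_within_open[OF _ GG.open_U GG.e0_U])
    show "blinfun_apply (Blinfun (T r)) v = T r v" if r: "r \<in> GG.U" for r
      unfolding bl[OF r] by (simp add: linear_parseval_expand[OF E linear_T[OF r], symmetric] blinfun.sum_left)
  qed
  then show ?thesis by (simp add: \<phi>)
qed

section \<open>Tangent map of the Rota-Baxter operator\<close>

definition \<b> :: "'b \<Rightarrow> 'a" where "\<b> k = GG.\<kappa> (\<B> (HH.\<iota> k))"

definition V\<b> :: "'b set" where "V\<b> = HH.U \<inter> (\<lambda>k. \<B> (HH.\<iota> k)) -` chart_dom (unit_chart G)"

lemma open_V\<b>: "open V\<b>"
  unfolding V\<b>_def by (rule plot_open_preimage[OF plot_\<B>[OF HH.plot_\<iota>] GG.open_dom])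

lemma smooth_\<b>: "smooth_on V\<b> \<b>"
  using plot_coord[OF plot_\<B>[OF HH.plot_\<iota>] GG.chart(1)] unfolding V\<b>_def \<b>_def[abs_def] .

lemma V\<b>_unit: "HH.e0 \<in> V\<b>"
  using HH.e0_U GG.chart by (simp add: V\<b>_def HH.\<iota>_e0 \<B>_unit)

lemma \<b>_unit: "\<b> HH.e0 = GG.e0"
  by (simp add: \<b>_def HH.\<iota>_e0 \<B>_unit)

lemma \<b>_has_derivative: "(\<b> has_derivative B) (at HH.e0)"
  using smooth_on_has_derivative[OF smooth_\<b> V\<b>_unit]
  by (simp add: tangent_map_unit_def \<b>_def[abs_def] o_def)

section \<open>The bracket of the descendent group\<close>

text \<open>
The chain rule for \<open>q \<mapsto> p \<cdot> \<Phi> (\<B> p) q\<close> at the unit, which is fixed by \<open>\<Phi> (\<B> p)\<close>.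
\<close>

lemma field_K: "p \<in> V\<b> \<Longrightarrow> KK.field v p = HH.field (T (\<b> p) v) p"
proof -
  assume p: "p \<in> V\<b>"
  then have pU: "p \<in> HH.U" and bU: "\<b> p \<in> GG.U" "GG.\<iota> (\<b> p) = \<B> (HH.\<iota> p)"
    using GG.\<iota>_\<kappa> by (auto simp: V\<b>_def \<b>_def)
  have "(HH.m p has_derivative (\<lambda>u. HH.field u p)) (at (\<psi> (\<b> p, HH.e0)))"
    using HH.m_has_derivative_field[OF pU] by (simp add: \<psi>_unit)
  from has_derivative_compose[OF \<psi>_has_derivative_T[OF bU(1)] this]
  have D: "((\<lambda>q. HH.m p (\<psi> (\<b> p, q))) has_derivative (\<lambda>v. HH.field (T (\<b> p) v) p)) (at HH.e0)" .
  let ?V = "HH.U \<inter> Pair (\<b> p) -` V\<psi>"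
  have oV: "open ?V"
    by (rule continuous_open_preimage[OF _ HH.open_U open_V\<psi>]) (intro continuous_intros)
  have "(KK.m p has_derivative (\<lambda>v. HH.field (T (\<b> p) v) p)) (at HH.e0)"
  proof (rule has_derivative_transform_within_open[OF D oV])
    show "HH.e0 \<in> ?V" using V\<psi>_unit[OF bU(1)] HH.e0_U by simp
    show "HH.m p (\<psi> (\<b> p, q)) = KK.m p q" if "q \<in> ?V" for q
      using that HH.\<iota>_\<kappa> by (simp add: KK.m_def HH.m_def \<psi>_def V\<psi>_def bU)
  qed
  from has_derivative_unique_apply[OF this KK.m_has_derivative_field[OF pU]] show ?thesis by simp
qed

text \<open>
The product rule for \<open>field_K\<close> in the variable \<open>p\<close>: differentiating the left-invariant field of \<open>H\<close> gives
\<open>\<beta>\<close>, differentiating the vector \<open>T (\<b> p) v\<close> gives the action.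
\<close>

lemma \<beta>_K: "KK.\<beta> u v = HH.\<beta> u v + \<phi> (B u) v"
proof -
  have "((\<lambda>r. T r v) has_derivative (\<lambda>x. \<phi> x v)) (at (\<b> HH.e0))"
    using T_has_derivative_\<phi> by (simp add: \<b>_unit)
  from HH.field_along[OF has_derivative_ident refl has_derivative_compose[OF \<b>_has_derivative this]]
  have D: "((\<lambda>p. HH.field (T (\<b> p) v) p) has_derivative (\<lambda>u. HH.\<beta> u v + \<phi> (B u) v)) (at HH.e0)"
    by (simp add: \<b>_unit T_unit)
  have "(KK.field v has_derivative (\<lambda>u. HH.\<beta> u v + \<phi> (B u) v)) (at HH.e0)"
    by (rule has_derivative_transform_within_open[OF D open_V\<b> V\<b>_unit]) (simp add: field_K)
  from has_derivative_unique_apply[OF this KK.field_has_derivative] show ?thesis by simp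
qed

lemma descendent_bracket_eq: "descendent_bracket H \<phi> B u v = KK.\<beta> u v - KK.\<beta> v u"
  by (simp add: descendent_bracket_def \<beta>_K lie_bracket_simps)

section \<open>The representation on the Lie algebra of \<open>G\<close>\<close>

text \<open>
For \<open>k = h\<^sup>\<dagger>\<close> this is the map whose tangent map at the unit is \<open>\<Theta> h\<close>. Keeping \<open>k\<close> as a second variable makes the relation
\<open>f\<Theta>_rel\<close> available for differentiation in \<open>k\<close>.
\<close>

definition f\<Theta> :: "'g \<Rightarrow> 'h \<Rightarrow> 'g" where "f\<Theta> g k = mulG (mulG (inv\<^bsub>G\<^esub> (\<B> (\<Phi> g k))) g) (\<B> k)"

lemma f\<Theta>_unit: "f\<Theta> eG k = eG" "f\<Theta> g eH = g"
proof -
  have "inv\<^bsub>G\<^esub> eG = eG" using invG GG.left_unit GG.right_unit by metis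
  then show "f\<Theta> eG k = eG" "f\<Theta> g eH = g"
    by (simp_all add: f\<Theta>_def \<Phi>_unit \<Phi>_eH \<B>_unit invG GG.left_unit GG.right_unit)
qed

lemma f\<Theta>_rel: "mulG (\<B> (\<Phi> g k)) (f\<Theta> g k) = mulG g (\<B> k)"
  by (simp add: f\<Theta>_def GG.mul_assoc[symmetric] invG GG.left_unit)

lemma plot_f\<Theta>: "plot (atlas G) S g \<Longrightarrow> plot (atlas H) S k \<Longrightarrow> plot (atlas G) S (\<lambda>x. f\<Theta> (g x) (k x))"
  unfolding f\<Theta>_def by (intro GG.plot_mul plot_invG plot_\<B> plot_\<Phi>)

lemma Theta_has_derivative:
  "((\<lambda>r. GG.\<kappa> (f\<Theta> (GG.\<iota> r) (dag h))) has_derivative Theta G H \<Phi> \<B> h) (at GG.e0)"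
proof -
  have p: "plot (atlas G) GG.U (\<lambda>r. f\<Theta> (GG.\<iota> r) (dag h))"
    by (intro plot_f\<Theta> GG.plot_\<iota> plot_const GG.open_U)
  have "GG.e0 \<in> GG.U \<inter> (\<lambda>r. f\<Theta> (GG.\<iota> r) (dag h)) -` chart_dom (unit_chart G)"
    using GG.e0_U GG.chart by (simp add: GG.\<iota>_e0 f\<Theta>_unit)
  from smooth_on_has_derivative[OF plot_coord[OF p GG.chart(1)] this]
  show ?thesis by (simp add: Theta_def tangent_map_unit_def f\<Theta>_def o_def)
qed

lemma bounded_linear_Theta: "bounded_linear (Theta G H \<Phi> \<B> h)"
  using Theta_has_derivative has_derivative_bounded_linear by blast

definition \<tau> :: "'a \<times> 'b \<Rightarrow> 'a" where "\<tau> z = GG.\<kappa> (f\<Theta> (GG.\<iota> (fst z)) (HH.\<iota> (snd z)))"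

definition V\<tau> :: "('a \<times> 'b) set" where
  "V\<tau> = (GG.U \<times> HH.U) \<inter> (\<lambda>z. f\<Theta> (GG.\<iota> (fst z)) (HH.\<iota> (snd z))) -` chart_dom (unit_chart G)"

lemma open_V\<tau>: "open V\<tau>"
  unfolding V\<tau>_def by (rule plot_open_preimage[OF plot_f\<Theta>[OF plot_fst_snd] GG.open_dom])

lemma smooth_\<tau>: "smooth_on V\<tau> \<tau>"
  using plot_coord[OF plot_f\<Theta>[OF plot_fst_snd] GG.chart(1)] unfolding V\<tau>_def \<tau>_def[abs_def] .

lemma V\<tau>_unit: "k \<in> HH.U \<Longrightarrow> (GG.e0, k) \<in> V\<tau>"
  using GG.chart GG.e0_U by (simp add: V\<tau>_def GG.\<iota>_e0 f\<Theta>_unit)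

lemma \<tau>_unit: "\<tau> (GG.e0, k) = GG.e0"
  by (simp add: \<tau>_def GG.\<iota>_e0 f\<Theta>_unit)

text \<open>
\<open>\<Theta> h\<close> as a function of the coordinates \<open>k\<close> of \<open>h\<^sup>\<dagger>\<close>.
\<close>

definition S :: "'b \<Rightarrow> 'a \<Rightarrow> 'a" where "S k x = frechet_derivative \<tau> (at (GG.e0, k)) (x, 0)"

lemma \<tau>_has_derivative_S: "k \<in> HH.U \<Longrightarrow> ((\<lambda>r. \<tau> (r, k)) has_derivative S k) (at GG.e0)"
  unfolding S_def[abs_def]
  by (rule has_derivative_partial_fst[OF smooth_on_has_derivative[OF smooth_\<tau> V\<tau>_unit]])

lemma Theta_eq_S: "dag h \<in> chart_dom (unit_chart H) \<Longrightarrow> Theta G H \<Phi> \<B> h = S (HH.\<kappa> (dag h))"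
proof -
  assume d: "dag h \<in> chart_dom (unit_chart H)"
  then have "((\<lambda>r. \<tau> (r, HH.\<kappa> (dag h))) has_derivative Theta G H \<Phi> \<B> h) (at GG.e0)"
    using Theta_has_derivative by (simp add: \<tau>_def HH.\<iota>_\<kappa>)
  from has_derivative_unique[OF this \<tau>_has_derivative_S] d show ?thesis by blast
qed

lemma S_unit: "S HH.e0 x = x"
proof -
  have "((\<lambda>r. \<tau> (r, HH.e0)) has_derivative (\<lambda>x. x)) (at GG.e0)"
    by (rule has_derivative_transform_within_open[OF has_derivative_ident GG.open_U GG.e0_U])
      (simp add: \<tau>_def HH.\<iota>_e0 f\<Theta>_unit GG.\<kappa>_\<iota>)
  from has_derivative_unique_apply[OF this \<tau>_has_derivative_S[OF HH.e0_U]] show ?thesis by simp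
qed

lemma smooth_S: "smooth_on HH.U (\<lambda>k. S k x)"
proof -
  obtain E :: "('a \<times> 'b) set" where E: "parseval_frame E" using frame_ab by blast
  show ?thesis unfolding S_def
  proof (rule smooth_on_compose[OF E smooth_on_derivative[OF smooth_\<tau>] _ HH.open_U open_V\<tau>])
    show "smooth_on HH.U (\<lambda>k. (GG.e0, k))"
      by (rule smooth_on_Pair[OF HH.open_U smooth_on_const[OF HH.open_U] smooth_on_ident[OF HH.open_U]])
  qed (use V\<tau>_unit in auto)
qed

text \<open>
The first factor of \<open>f\<Theta>_rel\<close> in coordinates. Its mixed second derivative at the unit is \<open>B (\<phi> x w)\<close>, most easily
computed by differentiating first in the variable \<open>k\<close>.
\<close>

definition \<alpha> :: "'a \<times> 'b \<Rightarrow> 'a" where "\<alpha> z = GG.\<kappa> (\<B> (\<Phi> (GG.\<iota> (fst z)) (HH.\<iota> (snd z))))"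

definition V\<alpha> :: "('a \<times> 'b) set" where
  "V\<alpha> = (GG.U \<times> HH.U) \<inter> (\<lambda>z. \<B> (\<Phi> (GG.\<iota> (fst z)) (HH.\<iota> (snd z)))) -` chart_dom (unit_chart G)"

lemma open_V\<alpha>: "open V\<alpha>"
  unfolding V\<alpha>_def by (rule plot_open_preimage[OF plot_\<B>[OF plot_\<Phi>[OF plot_fst_snd]] GG.open_dom])

lemma smooth_\<alpha>: "smooth_on V\<alpha> \<alpha>"
  using plot_coord[OF plot_\<B>[OF plot_\<Phi>[OF plot_fst_snd]] GG.chart(1)] unfolding V\<alpha>_def \<alpha>_def[abs_def] .

lemma V\<alpha>_unit: "r \<in> GG.U \<Longrightarrow> (r, HH.e0) \<in> V\<alpha>" "k \<in> V\<b> \<Longrightarrow> (GG.e0, k) \<in> V\<alpha>"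
  using GG.chart GG.e0_U HH.e0_U by (auto simp: V\<alpha>_def V\<b>_def GG.\<iota>_e0 HH.\<iota>_e0 \<Phi>_unit \<Phi>_eH \<B>_unit)

definition D\<alpha> :: "'a \<times> 'b \<Rightarrow> 'a \<times> 'b \<Rightarrow> 'a" where "D\<alpha> z = frechet_derivative \<alpha> (at z)"

lemma \<alpha>_has_derivative: "z \<in> V\<alpha> \<Longrightarrow> (\<alpha> has_derivative D\<alpha> z) (at z)"
  unfolding D\<alpha>_def by (rule smooth_on_has_derivative[OF smooth_\<alpha>])

lemma D\<alpha>_snd: "r \<in> GG.U \<Longrightarrow> D\<alpha> (r, HH.e0) (0, w) = B (T r w)"
proof -
  assume r: "r \<in> GG.U"
  have "(\<b> has_derivative B) (at (\<psi> (r, HH.e0)))" using \<b>_has_derivative by (simp add: \<psi>_unit)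
  from has_derivative_compose[OF \<psi>_has_derivative_T[OF r] this]
  have D: "((\<lambda>q. \<b> (\<psi> (r, q))) has_derivative (\<lambda>w. B (T r w))) (at HH.e0)" .
  let ?V = "HH.U \<inter> Pair r -` V\<psi>"
  have oV: "open ?V"
    by (rule continuous_open_preimage[OF _ HH.open_U open_V\<psi>]) (intro continuous_intros)
  have "((\<lambda>q. \<alpha> (r, q)) has_derivative (\<lambda>w. B (T r w))) (at HH.e0)"
  proof (rule has_derivative_transform_within_open[OF D oV])
    show "HH.e0 \<in> ?V" using V\<psi>_unit[OF r] HH.e0_U by simp
    show "\<b> (\<psi> (r, q)) = \<alpha> (r, q)" if "q \<in> ?V" for q
      using that HH.\<iota>_\<kappa> by (simp add: \<b>_def \<alpha>_def \<psi>_def V\<psi>_def)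
  qed
  from has_derivative_unique_apply[OF this has_derivative_partial_snd[OF \<alpha>_has_derivative[OF V\<alpha>_unit(1)[OF r]]]]
  show ?thesis by simp
qed

lemma D\<alpha>_mixed: "((\<lambda>k. D\<alpha> (GG.e0, k) (x, 0)) has_derivative (\<lambda>w. B (\<phi> x w))) (at HH.e0)"
proof -
  obtain D where D: "((\<lambda>k. D\<alpha> (GG.e0, k) (x, 0)) has_derivative D) (at HH.e0)"
    "\<And>w D'. ((\<lambda>p. D\<alpha> (p, HH.e0) (0, w)) has_derivative D') (at GG.e0) \<Longrightarrow> D w = D' x"
    using mixed_partials[OF smooth_\<alpha> open_V\<alpha> V\<alpha>_unit(1)[OF GG.e0_U], of x] unfolding D\<alpha>_def by blast
  have "((\<lambda>r. D\<alpha> (r, HH.e0) (0, w)) has_derivative (\<lambda>x. B (\<phi> x w))) (at GG.e0)" for w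
  proof (rule has_derivative_transform_within_open[OF _ GG.open_U GG.e0_U])
    show "((\<lambda>r. B (T r w)) has_derivative (\<lambda>x. B (\<phi> x w))) (at GG.e0)"
      by (rule bounded_linear.has_derivative[OF has_derivative_bounded_linear[OF \<b>_has_derivative] T_has_derivative_\<phi>])
  qed (simp add: D\<alpha>_snd)
  then have "D w = B (\<phi> x w)" for w by (rule D(2))
  then have "D = (\<lambda>w. B (\<phi> x w))" by (rule ext)
  then show ?thesis using D(1) by simp
qed

text \<open>
The derivative of \<open>f\<Theta>_rel\<close> in \<open>g\<close> at the unit, for fixed \<open>k\<close>.
\<close>

lemma S_relation:
  assumes k: "k \<in> V\<b>"
  shows "D\<alpha> (GG.e0, k) (x, 0) + GG.field (S k x) (\<b> k) = GG.rfield x (\<b> k)"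
proof -
  have kU: "k \<in> HH.U" and bU: "\<b> k \<in> GG.U" using k by (auto simp: V\<b>_def \<b>_def)
  have \<alpha>k: "\<alpha> (GG.e0, k) = \<b> k" by (simp add: \<alpha>_def \<b>_def GG.\<iota>_e0 \<Phi>_unit)
  have 1: "((\<lambda>r. (\<alpha> (r, k), \<tau> (r, k))) has_derivative (\<lambda>x. (D\<alpha> (GG.e0, k) (x, 0), S k x))) (at GG.e0)"
    by (intro has_derivative_Pair \<tau>_has_derivative_S[OF kU]
        has_derivative_partial_fst[OF \<alpha>_has_derivative[OF V\<alpha>_unit(2)[OF k]]])
  have "((\<lambda>z. GG.m (fst z) (snd z)) has_derivative GG.Dm (\<b> k, GG.e0)) (at (\<alpha> (GG.e0, k), \<tau> (GG.e0, k)))"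
    unfolding \<alpha>k \<tau>_unit by (rule GG.m_has_derivative[OF GG.e0_W(1)[OF bU]])
  from has_derivative_compose[OF 1 this]
  have L: "((\<lambda>r. GG.m (\<alpha> (r, k)) (\<tau> (r, k))) has_derivative (\<lambda>x. GG.Dm (\<b> k, GG.e0) (D\<alpha> (GG.e0, k) (x, 0), S k x))) (at GG.e0)"
    by simp
  have R: "((\<lambda>r. GG.m r (\<b> k)) has_derivative (\<lambda>x. GG.rfield x (\<b> k))) (at GG.e0)"
    using has_derivative_partial_fst[OF GG.m_has_derivative[OF GG.e0_W(2)[OF bU]]] by (simp add: GG.rfield_def)
  let ?V = "GG.U \<inter> (\<lambda>r. (r, k)) -` (V\<alpha> \<inter> V\<tau>)"
  have oV: "open ?V"
    by (rule continuous_open_preimage[OF _ GG.open_U open_Int[OF open_V\<alpha> open_V\<tau>]]) (intro continuous_intros)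
  have "((\<lambda>r. GG.m r (\<b> k)) has_derivative (\<lambda>x. GG.Dm (\<b> k, GG.e0) (D\<alpha> (GG.e0, k) (x, 0), S k x))) (at GG.e0)"
  proof (rule has_derivative_transform_within_open[OF L oV])
    show "GG.e0 \<in> ?V" using V\<alpha>_unit(2)[OF k] V\<tau>_unit[OF kU] GG.e0_U by simp
    show "GG.m (\<alpha> (r, k)) (\<tau> (r, k)) = GG.m r (\<b> k)" if "r \<in> ?V" for r
    proof -
      have "\<B> (HH.\<iota> k) \<in> chart_dom (unit_chart G)" using k by (simp add: V\<b>_def)
      then show ?thesis
        using that by (simp add: GG.m_def \<alpha>_def \<tau>_def \<b>_def V\<alpha>_def V\<tau>_def GG.\<iota>_\<kappa> f\<Theta>_rel)
    qed
  qed
  from has_derivative_unique_apply[OF this R]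
  have "GG.Dm (\<b> k, GG.e0) (D\<alpha> (GG.e0, k) (x, 0), S k x) = GG.rfield x (\<b> k)" by simp
  then show ?thesis
    using GG.Dm_split[OF GG.e0_W(1)[OF bU], of "D\<alpha> (GG.e0, k) (x, 0)" "S k x"]
    by (simp add: GG.Dm_unit_fst[OF bU] GG.field_eq[OF bU])
qed

text \<open>
The derivative of \<open>S_relation\<close> in \<open>k\<close> at the unit reads \<open>B (\<phi> x w) + \<beta> (B w) x + S' w = \<beta> x (B w)\<close>.
\<close>

lemma S_has_derivative: "((\<lambda>k. S k x) has_derivative (\<lambda>w. - theta G \<phi> B w x)) (at HH.e0)"
proof -
  obtain S' where S': "((\<lambda>k. S k x) has_derivative S') (at HH.e0)"
    using smooth_on_has_derivative[OF smooth_S HH.e0_U] by blast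
  have "((\<lambda>k. D\<alpha> (GG.e0, k) (x, 0) + GG.field (S k x) (\<b> k)) has_derivative
      (\<lambda>w. B (\<phi> x w) + (GG.\<beta> (B w) (S HH.e0 x) + S' w))) (at HH.e0)"
    by (intro has_derivative_add D\<alpha>_mixed GG.field_along \<b>_has_derivative \<b>_unit S')
  then have "((\<lambda>k. GG.rfield x (\<b> k)) has_derivative
      (\<lambda>w. B (\<phi> x w) + (GG.\<beta> (B w) (S HH.e0 x) + S' w))) (at HH.e0)"
    by (rule has_derivative_transform_within_open[OF _ open_V\<b> V\<b>_unit]) (rule S_relation)
  moreover have "((\<lambda>k. GG.rfield x (\<b> k)) has_derivative (\<lambda>w. GG.\<beta> x (B w))) (at HH.e0)"
    by (rule has_derivative_compose[OF \<b>_has_derivative]) (simp add: \<b>_unit GG.rfield_has_derivative)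
  ultimately have "B (\<phi> x w) + (GG.\<beta> (B w) x + S' w) = GG.\<beta> x (B w)" for w
    using has_derivative_unique_apply[of "\<lambda>k. GG.rfield x (\<b> k)" _ "HH.e0" _ w] unfolding S_unit by blast
  then have "S' w = - theta G \<phi> B w x" for w
    unfolding theta_def lie_bracket_simps by (simp add: algebra_simps eq_diff_eq)
  then have "S' = (\<lambda>w. - theta G \<phi> B w x)" by (rule ext)
  then show ?thesis using S' by simp
qed

text \<open>
The inverse in the descendent group turns \<open>Exp (t u)\<close> into \<open>Exp (- t u)\<close>, which cancels the sign in \<open>S_has_derivative\<close>.
\<close>

theorem Theta_exp_curve_derivative:
  "((\<lambda>t. Theta G H \<Phi> \<B> (KK.exp_curve u t) x) has_vector_derivative theta G \<phi> B u x) (at 0)"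
proof -
  have "((\<lambda>t. HH.\<kappa> (KK.exp_curve u (- t))) has_vector_derivative - u) (at 0)"
    using has_vector_derivative_affine_reparam[of "\<lambda>r. HH.\<kappa> (KK.exp_curve u r)" u "-1" 0 0] KK.exp_curve_deriv by simp
  from has_vector_derivative_chain[OF this, of "\<lambda>k. S k x" "\<lambda>w. - theta G \<phi> B w x"]
  have 1: "((\<lambda>t. S (HH.\<kappa> (KK.exp_curve u (- t))) x) has_vector_derivative - theta G \<phi> B (- u) x) (at 0)"
    using S_has_derivative by (simp add: KK.exp_curve_zero)
  have 2: "- theta G \<phi> B (- u) x = theta G \<phi> B u x"
    using linear_neg[OF has_derivative_linear[OF S_has_derivative[of x]], of u] by simp
  let ?V = "(\<lambda>t. KK.exp_curve u (- t)) -` chart_dom (unit_chart H)"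
  have oV: "open ?V"
    by (rule open_vimage[OF HH.open_dom])
      (intro continuous_on_compose2[OF KK.one_param_continuous[OF KK.one_param_exp_curve]] continuous_intros, auto)
  have "((\<lambda>t. Theta G H \<Phi> \<B> (KK.exp_curve u t) x) has_vector_derivative - theta G \<phi> B (- u) x) (at 0)"
    by (rule has_vector_derivative_transform_within_open[OF 1 oV])
      (use HH.chart in \<open>auto simp: KK.exp_curve_zero Theta_eq_S dag_exp_curve\<close>)
  then show ?thesis unfolding 2 .
qed

text \<open>
Linearity is inherited from \<open>\<Theta>\<close>, of which \<open>\<theta>\<close> is a derivative.
\<close>

lemma theta_linear: "linear (theta G \<phi> B u)"
proof (rule linearI)
  fix x y and r :: real
  note D = Theta_exp_curve_derivative and L = bounded_linear.linear[OF bounded_linear_Theta]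
  have "((\<lambda>t. Theta G H \<Phi> \<B> (KK.exp_curve u t) (x + y)) has_vector_derivative theta G \<phi> B u x + theta G \<phi> B u y) (at 0)"
    using has_vector_derivative_add[OF D[of u x] D[of u y]] by (simp only: linear_add[OF L])
  then show "theta G \<phi> B u (x + y) = theta G \<phi> B u x + theta G \<phi> B u y"
    using vector_derivative_at[OF D[of u "x + y"]] by (simp add: vector_derivative_at)
  have "((\<lambda>t. r *\<^sub>R Theta G H \<Phi> \<B> (KK.exp_curve u t) x) has_vector_derivative r *\<^sub>R theta G \<phi> B u x) (at 0)"
    by (rule bounded_linear.has_vector_derivative[OF bounded_linear_scaleR_right D])
  then have "((\<lambda>t. Theta G H \<Phi> \<B> (KK.exp_curve u t) (r *\<^sub>R x)) has_vector_derivative r *\<^sub>R theta G \<phi> B u x) (at 0)"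
    unfolding linear_cmul[OF L] .
  then show "theta G \<phi> B u (r *\<^sub>R x) = r *\<^sub>R theta G \<phi> B u x"
    using vector_derivative_at[OF D[of u "r *\<^sub>R x"]] by (simp add: vector_derivative_at)
qed

end

section \<open>Partial derivatives on powers of a vector space\<close>

definition pow_box :: "nat \<Rightarrow> 'b set \<Rightarrow> (nat \<Rightarrow> 'b) set" where
  "pow_box n U = {x. \<forall>i<n. x i \<in> U}"

lemma pow_box_upd: "x \<in> pow_box n U \<Longrightarrow> y \<in> U \<Longrightarrow> x(i := y) \<in> pow_box n U"
  by (auto simp: pow_box_def)

lemma pow_boxD: "x \<in> pow_box n U \<Longrightarrow> i < n \<Longrightarrow> x i \<in> U"
  by (auto simp: pow_box_def)

definition slot_deriv :: "nat \<Rightarrow> 'b::real_normed_vector \<Rightarrow> ((nat \<Rightarrow> 'b) \<Rightarrow> 'v::real_normed_vector) \<Rightarrow> (nat \<Rightarrow> 'b) \<Rightarrow> 'v" where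
  "slot_deriv i v f x = frechet_derivative (\<lambda>y. f (x(i := y))) (at (x i)) v"

lemma smooth_pow_on_slot_deriv: "smooth_pow_on n S f \<Longrightarrow> i < n \<Longrightarrow> smooth_pow_on n S (slot_deriv i v f)"
proof -
  assume f: "smooth_pow_on n S f" and i: "i < n"
  have "Ck_pow_on k n S (slot_deriv i v f)" for k
  proof -
    have "Ck_pow_on (Suc k) n S f" using f unfolding smooth_pow_on_def by blast
    then show ?thesis using i unfolding slot_deriv_def[abs_def] by simp
  qed
  then show ?thesis by (simp add: smooth_pow_on_def)
qed

lemma slot_deriv_has_derivative:
  assumes "smooth_pow_on n S f" "i < n" "x \<in> S"
  shows "((\<lambda>y. f (x(i := y))) has_derivative (\<lambda>v. slot_deriv i v f x)) (at (x i))"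
proof -
  have "Ck_pow_on (Suc 0) n S f" using assms(1) unfolding smooth_pow_on_def by blast
  then have "(\<lambda>y. f (x(i := y))) differentiable (at (x i))" using assms(2,3) by simp
  then show ?thesis unfolding slot_deriv_def using frechet_derivative_works by blast
qed

lemma slot_deriv_linear:
  assumes "smooth_pow_on n S f" "i < n" "x \<in> S"
  shows "linear (\<lambda>v. slot_deriv i v f x)"
  using slot_deriv_has_derivative[OF assms] has_derivative_linear by blast

lemma slot_deriv_combination:
  assumes U: "open U" and i: "i < n" and x: "x \<in> pow_box n U"
    and f: "smooth_pow_on n (pow_box n U) f" and g: "smooth_pow_on n (pow_box n U) g"
    and h: "\<And>x. x \<in> pow_box n U \<Longrightarrow> h x = a *\<^sub>R f x + b *\<^sub>R g x"
  shows "slot_deriv i v h x = a *\<^sub>R slot_deriv i v f x + b *\<^sub>R slot_deriv i v g x"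
proof -
  have "((\<lambda>y. a *\<^sub>R f (x(i := y)) + b *\<^sub>R g (x(i := y))) has_derivative
      (\<lambda>v. a *\<^sub>R slot_deriv i v f x + b *\<^sub>R slot_deriv i v g x)) (at (x i))"
    by (intro has_derivative_add has_derivative_scaleR_right slot_deriv_has_derivative[OF f i x] slot_deriv_has_derivative[OF g i x])
  then have "((\<lambda>y. h (x(i := y))) has_derivative
      (\<lambda>v. a *\<^sub>R slot_deriv i v f x + b *\<^sub>R slot_deriv i v g x)) (at (x i))"
    by (rule has_derivative_transform_within_open[OF _ U pow_boxD[OF x i]]) (simp add: h pow_box_upd[OF x])
  from fun_cong[OF frechet_derivative_at[OF this], of v] show ?thesis
    unfolding slot_deriv_def[of i v h] by simp
qed

lemma continuous_on_slot:
  assumes "continuous_on (pow_box n U) f" "x \<in> pow_box n U"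
  shows "continuous_on U (\<lambda>y. f (x(i := y)))"
proof (rule continuous_on_compose2[OF assms(1)])
  show "continuous_on U (\<lambda>y. x(i := y))"
  proof (rule continuous_on_coordinatewise_then_product)
    show "continuous_on U (\<lambda>y. (x(i := y)) j)" for j by (cases "j = i") auto
  qed
qed (use pow_box_upd[OF assms(2)] in auto)

lemma Ck_pow_on_slot:
  assumes "Ck_pow_on k n (pow_box n U) f" "i < n" "x \<in> pow_box n U"
  shows "Ck_on k U (\<lambda>y. f (x(i := y)))"
  using assms(1)
proof (induction k arbitrary: f)
  case 0
  then show ?case unfolding Ck_on.simps Ck_pow_on.simps by (rule continuous_on_slot[OF _ assms(3)])
next
  case (Suc k)
  have "continuous_on (pow_box n U) f" using Suc.prems by simp
  then have "continuous_on U (\<lambda>y. f (x(i := y)))" by (rule continuous_on_slot[OF _ assms(3)])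
  moreover have "(\<lambda>y. f (x(i := y))) differentiable (at y)" if "y \<in> U" for y
  proof -
    have "(\<lambda>z. f ((x(i := y))(i := z))) differentiable (at ((x(i := y)) i))"
      using Suc.prems assms(2) pow_box_upd[OF assms(3) that, of i] unfolding Ck_pow_on.simps by blast
    then show ?thesis by simp
  qed
  moreover have "Ck_on k U (\<lambda>y. frechet_derivative (\<lambda>y. f (x(i := y))) (at y) v)" for v
  proof -
    have "Ck_pow_on k n (pow_box n U) (\<lambda>x. frechet_derivative (\<lambda>y. f (x(i := y))) (at (x i)) v)"
      using Suc.prems assms(2) by simp
    from Suc.IH[OF this] show ?thesis by (simp only: fun_upd_upd fun_upd_same)
  qed
  ultimately show ?case unfolding Ck_on.simps by blast
qed

lemma slot_deriv_symmetric:
  fixes f :: "(nat \<Rightarrow> 'b::real_normed_vector) \<Rightarrow> 'v::real_inner"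
  assumes f: "smooth_pow_on n (pow_box n U) f" and i: "i < n" and x: "x \<in> pow_box n U" and U: "open U"
  shows "slot_deriv i u (slot_deriv i v f) x = slot_deriv i v (slot_deriv i u f) x"
proof -
  have "Ck_on 2 U (\<lambda>y. f (x(i := y)))"
    by (rule Ck_pow_on_slot[OF _ i x]) (use f in \<open>simp add: smooth_pow_on_def\<close>)
  from second_derivative_symmetric[OF U pow_boxD[OF x i] this, of v u] show ?thesis
    by (simp add: slot_deriv_def)
qed

text \<open>
The derivative in the last listed slot is taken first, as in \<open>iter_deriv\<close>.
\<close>

primrec slots :: "nat list \<Rightarrow> (nat \<Rightarrow> 'b::real_normed_vector) \<Rightarrow> ((nat \<Rightarrow> 'b) \<Rightarrow> 'v::real_normed_vector) \<Rightarrow> (nat \<Rightarrow> 'b) \<Rightarrow> 'v" where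
  "slots [] w f = f"
| "slots (i # is) w f = slot_deriv i (w i) (slots is w f)"

lemma smooth_pow_on_slots: "smooth_pow_on n S f \<Longrightarrow> set is \<subseteq> {..<n} \<Longrightarrow> smooth_pow_on n S (slots is w f)"
  by (induction "is") (auto intro: smooth_pow_on_slot_deriv)

lemma slots_cong: "(\<And>i. i \<in> set is \<Longrightarrow> w i = w' i) \<Longrightarrow> slots is w f = slots is w' f"
  by (induction "is") auto

lemma slots_append: "slots (is @ js) w f = slots is w (slots js w f)"
  by (induction "is") auto

lemma slots_combination:
  assumes U: "open U" and "set is \<subseteq> {..<n}" "x \<in> pow_box n U"
    and f: "smooth_pow_on n (pow_box n U) f" and g: "smooth_pow_on n (pow_box n U) g"
    and h: "\<And>x. x \<in> pow_box n U \<Longrightarrow> h x = a *\<^sub>R f x + b *\<^sub>R g x"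
  shows "slots is w h x = a *\<^sub>R slots is w f x + b *\<^sub>R slots is w g x"
  using assms(2,3)
proof (induction "is" arbitrary: x)
  case Nil
  then show ?case by (simp add: h)
next
  case (Cons i "is")
  show ?case unfolding slots.simps
    by (rule slot_deriv_combination[OF U _ Cons.prems(2)])
      (use Cons smooth_pow_on_slots f g in auto)
qed

text \<open>
In the slot \<open>k\<close> itself this is linearity of the derivative in its direction; the outer derivatives preserve linear combinations.
\<close>

lemma slots_multilinear:
  assumes U: "open U" and f: "smooth_pow_on n (pow_box n U) f"
    and "distinct is" "k \<in> set is" "set is \<subseteq> {..<n}" "x \<in> pow_box n U"
  shows "slots is (w(k := a *\<^sub>R y + b *\<^sub>R z)) f x = a *\<^sub>R slots is (w(k := y)) f x + b *\<^sub>R slots is (w(k := z)) f x"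
  using assms(3-6)
proof (induction "is" arbitrary: x)
  case (Cons i "is")
  have smooth: "smooth_pow_on n (pow_box n U) (slots is w f)" for w
    by (rule smooth_pow_on_slots[OF f]) (use Cons.prems in auto)
  have i: "i < n" using Cons.prems by auto
  show ?case
  proof (cases "i = k")
    case True
    have eq: "slots is (w(k := y)) f = slots is w f" for y
      by (rule slots_cong) (use Cons.prems True in auto)
    note lin = slot_deriv_linear[OF smooth i Cons.prems(4), of w]
    show ?thesis
      unfolding True slots.simps eq fun_upd_same
      using linear_add[OF lin, of "a *\<^sub>R y" "b *\<^sub>R z"] linear_cmul[OF lin] by (simp add: True)
  next
    case False
    have "slot_deriv i (w i) (slots is (w(k := a *\<^sub>R y + b *\<^sub>R z)) f) x =
      a *\<^sub>R slot_deriv i (w i) (slots is (w(k := y)) f) x + b *\<^sub>R slot_deriv i (w i) (slots is (w(k := z)) f) x"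
      by (rule slot_deriv_combination[OF U i Cons.prems(4) smooth smooth]) (rule Cons.IH, use Cons.prems False in auto)
    then show ?thesis unfolding slots.simps fun_upd_other[OF False] .
  qed
qed simp

text \<open>
To evaluate an iterated derivative it suffices to guess all intermediate derivatives \<open>g j\<close>. They need to be correct only at those
arguments in \<open>N\<close> whose variables that have been differentiated are \<open>0\<close>; \<open>N\<close> is a neighbourhood in each of the variables
separately.
\<close>

lemma iter_deriv_eq_chain:
  fixes g :: "nat \<Rightarrow> (nat \<Rightarrow> real) \<Rightarrow> 'v::real_normed_vector"
  assumes N: "\<And>t i. t \<in> N \<Longrightarrow> i < n \<Longrightarrow> t i = 0 \<Longrightarrow> open {r. t(i := r) \<in> N}"
    and f: "\<And>t. t \<in> N \<Longrightarrow> f t = g n t"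
    and chain: "\<And>t j. t \<in> N \<Longrightarrow> j < n \<Longrightarrow> t j = 0 \<Longrightarrow> ((\<lambda>r. g (Suc j) (t(j := r))) has_vector_derivative g j t) (at 0)"
    and j: "j \<le> n" "t \<in> N" "\<And>i. j \<le> i \<Longrightarrow> i < n \<Longrightarrow> t i = 0"
  shows "iter_deriv [j..<n] f t = g j t"
  using j
proof (induction arbitrary: t rule: inc_induct)
  case base
  then show ?case by (simp add: f)
next
  case (step j)
  have tj: "t j = 0" using step by simp
  have "((\<lambda>r. iter_deriv [Suc j..<n] f (t(j := r))) has_vector_derivative g j t) (at 0)"
  proof (rule has_vector_derivative_transform_within_open[OF chain[OF step.prems(1) \<open>j < n\<close> tj] N[OF step.prems(1) \<open>j < n\<close> tj]])
    show "0 \<in> {r. t(j := r) \<in> N}" using tj step.prems by (metis fun_upd_triv mem_Collect_eq)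
    show "g (Suc j) (t(j := r)) = iter_deriv [Suc j..<n] f (t(j := r))" if "r \<in> {r. t(j := r) \<in> N}" for r
    proof (rule step.IH[symmetric])
      show "t(j := r) \<in> N" using that by blast
      show "(t(j := r)) i = 0" if "Suc j \<le> i" "i < n" for i using step.prems(2)[of i] that by simp
    qed
  qed
  then show ?case
    using \<open>j < n\<close> by (simp add: upt_conv_Cons tj vector_derivative_at)
qed

lemma iter_deriv_reindex:
  assumes "inj s"
  shows "iter_deriv (map s is) (\<lambda>t. f (t \<circ> s)) t = iter_deriv is f (t \<circ> s)"
proof (induction "is" arbitrary: t)
  case (Cons i "is")
  have upd: "(t(s i := r)) \<circ> s = (t \<circ> s)(i := r)" for r
    using assms by (auto simp: fun_eq_iff inj_eq)
  show ?case unfolding list.map iter_deriv.simps Cons.IH upd by (simp only: comp_apply)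
qed simp

section \<open>Iterated derivatives along exponential curves\<close>

context rota_baxter
begin

abbreviation "\<gamma> \<equiv> KK.exp_curve"

definition coords :: "(nat \<Rightarrow> 'b) \<Rightarrow> (nat \<Rightarrow> real) \<Rightarrow> nat \<Rightarrow> 'b" where
  "coords w t = (\<lambda>i. HH.\<kappa> (\<gamma> (w i) (t i)))"

text \<open>
Times for which all points, and all products of neighbouring points, on the exponential curves lie in the domain of the chart
around the unit. The products occur in the differential.
\<close>

definition small :: "nat \<Rightarrow> (nat \<Rightarrow> 'b) \<Rightarrow> (nat \<Rightarrow> real) set" where
  "small n w = {t. (\<forall>i<n. \<gamma> (w i) (t i) \<in> chart_dom (unit_chart H)) \<and>
     (\<forall>i. Suc i < n \<longrightarrow> mulK (\<gamma> (w i) (t i)) (\<gamma> (w (Suc i)) (t (Suc i))) \<in> chart_dom (unit_chart H))}"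

lemma open_\<gamma>: "open V \<Longrightarrow> open {r. \<gamma> u r \<in> V}"
  using open_vimage[OF _ KK.one_param_continuous[OF KK.one_param_exp_curve]] by (simp add: vimage_def)

lemma small_open: "open {r. t(i := r) \<in> small n w}"
proof -
  let ?D = "chart_dom (unit_chart H)" and ?x = "\<lambda>k r. \<gamma> (w k) ((t(i := r)) k)"
  have p: "plot (atlas H) UNIV (?x k)" for k
    by (cases "k = i") (simp_all add: KK.exp_curve_plot plot_const)
  have o: "open {r. ?x k r \<in> ?D}" "open {r. mulK (?x k r) (?x (Suc k) r) \<in> ?D}" for k
    using plot_open_preimage[OF p HH.open_dom, of k]
      plot_open_preimage[OF KK.plot_mul[OF p p] HH.open_dom, of k "Suc k"]
    by (simp_all only: vimage_def Int_UNIV_left)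
  have "{r. t(i := r) \<in> small n w} = (\<Inter>k\<in>{..<n}. {r. ?x k r \<in> ?D}) \<inter>
      (\<Inter>k\<in>{..<n - 1}. {r. mulK (?x k r) (?x (Suc k) r) \<in> ?D})"
    unfolding small_def by (auto simp only: mem_Collect_eq INT_iff Int_iff lessThan_iff less_diff_conv Suc_eq_plus1)
  then show ?thesis by (simp only:) (intro open_Int open_INT ballI o finite_lessThan)
qed

lemma zero_small: "(\<lambda>_. 0) \<in> small n w"
  using HH.chart by (simp add: small_def KK.exp_curve_zero KK.left_unit)

lemma coords_zero: "coords w (\<lambda>_. 0) = (\<lambda>_. HH.e0)"
  by (simp add: coords_def KK.exp_curve_zero)

lemma const_box: "(\<lambda>_. HH.e0) \<in> pow_box n HH.U"
  using HH.e0_U by (simp add: pow_box_def)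

lemma coords_box: "t \<in> small n w \<Longrightarrow> coords w t \<in> pow_box n HH.U"
  by (auto simp: coords_def pow_box_def small_def)

lemma coords_upd: "coords w (t(i := r)) = (coords w t)(i := HH.\<kappa> (\<gamma> (w i) r))"
  by (auto simp: coords_def)

definition local_rep :: "((nat \<Rightarrow> 'h) \<Rightarrow> 'v) \<Rightarrow> (nat \<Rightarrow> 'b) \<Rightarrow> 'v" where
  "local_rep F x = F (\<lambda>i. HH.\<iota> (x i))"

definition mixed_partial :: "nat \<Rightarrow> ((nat \<Rightarrow> 'h) \<Rightarrow> 'v::real_normed_vector) \<Rightarrow> (nat \<Rightarrow> 'b) \<Rightarrow> 'v" where
  "mixed_partial n F w = slots [0..<n] w (local_rep F) (\<lambda>_. HH.e0)"

lemma smooth_local_rep: "smooth_pow_map n (atlas H) F \<Longrightarrow> smooth_pow_on n (pow_box n HH.U) (local_rep F)"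
  unfolding smooth_pow_map_def local_rep_def[abs_def] pow_box_def using HH.chart(1) by auto

lemma local_rep_coords:
  assumes "smooth_pow_map n (atlas H) F" "\<And>i. i < n \<Longrightarrow> h i \<in> chart_dom (unit_chart H)"
  shows "local_rep F (\<lambda>i. HH.\<kappa> (h i)) = F h"
proof -
  have dep: "depends_on_first n F" using assms(1) by (simp add: smooth_pow_map_def)
  have "F (\<lambda>i. HH.\<iota> (HH.\<kappa> (h i))) = F h"
    by (rule dep[unfolded depends_on_first_def, rule_format]) (use assms(2) HH.\<iota>_\<kappa> in simp)
  then show ?thesis by (simp add: local_rep_def)
qed

lemma slot_curve_derivative:
  assumes f: "smooth_pow_on n (pow_box n HH.U) f" and i: "i < n" and x: "x \<in> pow_box n HH.U" "x i = HH.e0"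
  shows "((\<lambda>r. f (x(i := HH.\<kappa> (\<gamma> v r)))) has_vector_derivative slot_deriv i v f x) (at 0)"
  using has_vector_derivative_chain[OF KK.exp_curve_deriv, of "\<lambda>y. f (x(i := y))" "\<lambda>v. slot_deriv i v f x" v]
    slot_deriv_has_derivative[OF f i x(1)] x(2) by (simp add: KK.exp_curve_zero)

lemma slots_chain_step:
  assumes F: "smooth_pow_on n (pow_box n HH.U) f" and j: "j < k" "k \<le> n" and x: "x \<in> pow_box n HH.U" "x j = HH.e0"
  shows "((\<lambda>r. slots [Suc j..<k] w f (x(j := HH.\<kappa> (\<gamma> (w j) r)))) has_vector_derivative slots [j..<k] w f x) (at 0)"
proof -
  have "smooth_pow_on n (pow_box n HH.U) (slots [Suc j..<k] w f)"
    by (rule smooth_pow_on_slots[OF F]) (use j in auto)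
  from slot_curve_derivative[OF this _ x, of "w j"] j show ?thesis
    unfolding upt_conv_Cons[OF j(1)] slots.simps by simp
qed

text \<open>
Each derivative in a time at \<open>0\<close> is, by the chain rule, a partial derivative in a slot in the direction of the curve.
\<close>

lemma iter_deriv_cochain:
  fixes F :: "(nat \<Rightarrow> 'h) \<Rightarrow> 'v::real_normed_vector"
  assumes F: "smooth_pow_map n (atlas H) F"
  shows "iter_deriv [0..<n] (\<lambda>t. F (\<lambda>i. \<gamma> (w i) (t i))) (\<lambda>_. 0) = mixed_partial n F w"
proof -
  have "iter_deriv [0..<n] (\<lambda>t. F (\<lambda>i. \<gamma> (w i) (t i))) (\<lambda>_. 0) =
    (\<lambda>j t. slots [j..<n] w (local_rep F) (coords w t)) 0 (\<lambda>_. 0)"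
  proof (rule iter_deriv_eq_chain[where N="small n w"])
    show "F (\<lambda>i. \<gamma> (w i) (t i)) = slots [n..<n] w (local_rep F) (coords w t)" if "t \<in> small n w" for t
      using local_rep_coords[OF F, of "\<lambda>i. \<gamma> (w i) (t i)"] that by (simp add: coords_def small_def)
    show "((\<lambda>r. slots [Suc j..<n] w (local_rep F) (coords w (t(j := r)))) has_vector_derivative
        slots [j..<n] w (local_rep F) (coords w t)) (at 0)" if "t \<in> small n w" "j < n" "t j = 0" for t j
      unfolding coords_upd
      by (rule slots_chain_step[OF smooth_local_rep[OF F] that(2) order_refl coords_box[OF that(1)]])
        (simp add: coords_def that KK.exp_curve_zero)
  qed (use small_open zero_small in auto)
  then show ?thesis by (simp add: mixed_partial_def coords_zero)
qed

text \<open>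
The part of the derivatives of \<open>F (\<dots>, h\<^sub>i \<star> h\<^sub>i\<^sub>+\<^sub>1, \<dots>)\<close> that is of second order in the slot \<open>i\<close>. It carries no sign in
an exchange of \<open>w i\<close> and \<open>w (i + 1)\<close>, so that its alternation vanishes.
\<close>

definition doubled_partial :: "nat \<Rightarrow> nat \<Rightarrow> ((nat \<Rightarrow> 'h) \<Rightarrow> 'v::real_normed_vector) \<Rightarrow> (nat \<Rightarrow> 'b) \<Rightarrow> 'v" where
  "doubled_partial n i F w = slots [0..<i] w (slot_deriv i (w i) (slot_deriv i (w (Suc i))
     (slots [Suc i..<n] (omit (Suc i) w) (local_rep F)))) (\<lambda>_. HH.e0)"

lemma doubled_partial_swap:
  fixes F :: "(nat \<Rightarrow> 'h) \<Rightarrow> 'v::real_inner"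
  assumes F: "smooth_pow_map n (atlas H) F" and i: "i < n"
  shows "doubled_partial n i F (w \<circ> Transposition.transpose i (Suc i)) = doubled_partial n i F w"
proof -
  let ?w = "w \<circ> Transposition.transpose i (Suc i)"
  let ?R = "slots [Suc i..<n] (omit (Suc i) w) (local_rep F)"
  have 1: "slots [Suc i..<n] (omit (Suc i) ?w) (local_rep F) = ?R"
    by (rule slots_cong) (auto simp: omit_def Transposition.transpose_def)
  have 2: "slots [0..<i] ?w f = slots [0..<i] w f" for f :: "(nat \<Rightarrow> 'b) \<Rightarrow> 'v"
    by (rule slots_cong) (auto simp: Transposition.transpose_def)
  have R: "smooth_pow_on n (pow_box n HH.U) ?R"
    by (rule smooth_pow_on_slots[OF smooth_local_rep[OF F]]) auto
  have sm: "smooth_pow_on n (pow_box n HH.U) (slot_deriv i a (slot_deriv i b ?R))" for a b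
    by (intro smooth_pow_on_slot_deriv R i)
  have "slots [0..<i] w (slot_deriv i (w (Suc i)) (slot_deriv i (w i) ?R)) (\<lambda>_. HH.e0) =
     1 *\<^sub>R slots [0..<i] w (slot_deriv i (w i) (slot_deriv i (w (Suc i)) ?R)) (\<lambda>_. HH.e0) +
     0 *\<^sub>R slots [0..<i] w (slot_deriv i (w i) (slot_deriv i (w (Suc i)) ?R)) (\<lambda>_. HH.e0)"
    by (rule slots_combination[OF HH.open_U _ const_box sm sm])
      (use i slot_deriv_symmetric[OF R i _ HH.open_U] in auto)
  then show ?thesis unfolding doubled_partial_def 1 2 by simp
qed

text \<open>
Where the second-order part \<open>\<beta>\<close> of the product enters: after the derivative in \<open>h\<^sub>i\<^sub>+\<^sub>1\<close>, the slot is
differentiated along a left-invariant field at the moving point \<open>h\<^sub>i\<close>, and the derivative of that field at the unit is \<open>\<beta>\<close>.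
\<close>

lemma slot_field_derivative:
  assumes f: "smooth_pow_on n (pow_box n HH.U) f" and i: "i < n" and x: "x \<in> pow_box n HH.U" "x i = HH.e0"
  shows "((\<lambda>r. slot_deriv i (KK.field b (HH.\<kappa> (\<gamma> a r))) f (x(i := HH.\<kappa> (\<gamma> a r)))) has_vector_derivative
     slot_deriv i a (slot_deriv i b f) x + slot_deriv i (KK.\<beta> a b) f x) (at 0)"
proof -
  obtain E :: "'b set" where E: "parseval_frame E" using HH.frame_exists by blast
  have xx: "x(i := HH.e0) = x" using x(2) by auto
  have "((\<lambda>y. slot_deriv i (KK.field b y) f (x(i := y))) has_derivative
     (\<lambda>u. slot_deriv i u (slot_deriv i (KK.field b HH.e0) f) x + slot_deriv i (KK.\<beta> u b) f (x(i := HH.e0)))) (at HH.e0)"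
  proof (rule derivative_along_field[OF E, where L="\<lambda>y v. slot_deriv i v f (x(i := y))"])
    show "((\<lambda>y. slot_deriv i v f (x(i := y))) has_derivative (\<lambda>h. slot_deriv i h (slot_deriv i v f) x)) (at HH.e0)" for v
      using slot_deriv_has_derivative[OF smooth_pow_on_slot_deriv[OF f i] i x(1), of v] by (simp add: x(2))
    show "\<forall>\<^sub>F y in nhds HH.e0. linear (\<lambda>v. slot_deriv i v f (x(i := y)))"
      using HH.eventually_U by eventually_elim (rule slot_deriv_linear[OF f i pow_box_upd[OF x(1)]])
  qed (rule KK.field_has_derivative)
  then have "((\<lambda>y. slot_deriv i (KK.field b y) f (x(i := y))) has_derivative
     (\<lambda>u. slot_deriv i u (slot_deriv i b f) x + slot_deriv i (KK.\<beta> u b) f x)) (at HH.e0)"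
    by (simp add: xx KK.field_e0)
  from has_vector_derivative_chain[OF KK.exp_curve_deriv, of "\<lambda>y. slot_deriv i (KK.field b y) f (x(i := y))", OF _, of _ a] this
  show ?thesis by (simp add: KK.exp_curve_zero)
qed

text \<open>
The successive derivatives of \<open>\<Theta>(h\<^sub>0) \<eta> (h\<^sub>1, \<dots>, h\<^sub>n)\<close>: those in the last \<open>n\<close> times pass through the linear map, and the one in
the first time falls on \<open>\<Theta>\<close> only.
\<close>

definition chain_action :: "nat \<Rightarrow> ((nat \<Rightarrow> 'h) \<Rightarrow> 'a) \<Rightarrow> (nat \<Rightarrow> 'b) \<Rightarrow> nat \<Rightarrow> (nat \<Rightarrow> real) \<Rightarrow> 'a" where
  "chain_action n \<eta> w j t = (if j = 0 then theta G \<phi> B (w 0) (slots [0..<n] (w \<circ> Suc) (local_rep \<eta>) (coords (w \<circ> Suc) (t \<circ> Suc)))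
     else Theta G H \<Phi> \<B> (\<gamma> (w 0) (t 0)) (slots [j - 1..<n] (w \<circ> Suc) (local_rep \<eta>) (coords (w \<circ> Suc) (t \<circ> Suc))))"

lemma chain_action_step:
  assumes \<eta>: "smooth_pow_map n (atlas H) \<eta>" and t: "t \<in> small (Suc n) w" "j < Suc n" "t j = 0"
  shows "((\<lambda>r. chain_action n \<eta> w (Suc j) (t(j := r))) has_vector_derivative chain_action n \<eta> w j t) (at 0)"
proof (cases j)
  case 0
  have "(t(0 := r)) \<circ> Suc = t \<circ> Suc" for r by (auto simp: fun_eq_iff)
  then show ?thesis
    unfolding 0 chain_action_def using Theta_exp_curve_derivative by simp
next
  case (Suc i)
  have upd: "(t(Suc i := r)) \<circ> Suc = (t \<circ> Suc)(i := r)" for r by (auto simp: fun_eq_iff)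
  have box: "coords (w \<circ> Suc) (t \<circ> Suc) \<in> pow_box n HH.U" using t(1) by (auto simp: small_def coords_def pow_box_def)
  have "((\<lambda>r. slots [Suc i..<n] (w \<circ> Suc) (local_rep \<eta>) (coords (w \<circ> Suc) ((t \<circ> Suc)(i := r)))) has_vector_derivative
      slots [i..<n] (w \<circ> Suc) (local_rep \<eta>) (coords (w \<circ> Suc) (t \<circ> Suc))) (at 0)"
    unfolding coords_upd
    by (rule slots_chain_step[OF smooth_local_rep[OF \<eta>] _ order_refl box])
      (use t Suc in \<open>auto simp: coords_def KK.exp_curve_zero\<close>)
  from bounded_linear.has_vector_derivative[OF bounded_linear_Theta this]
  show ?thesis by (simp add: chain_action_def Suc upd)
qed

text \<open>
The successive derivatives of \<open>\<eta> (\<dots>, h\<^sub>i \<star> h\<^sub>i\<^sub>+\<^sub>1, \<dots>)\<close>. Variables after \<open>i + 1\<close> belong to the slot before them; the derivative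
in the variable \<open>i + 1\<close> is one along a left-invariant field, the one in the variable \<open>i\<close> splits as in
\<open>slot_field_derivative\<close>, and both parts are differentiated further in the remaining slots.
\<close>

definition chain_merge :: "nat \<Rightarrow> ((nat \<Rightarrow> 'h) \<Rightarrow> 'v::real_normed_vector) \<Rightarrow> nat \<Rightarrow> (nat \<Rightarrow> 'b) \<Rightarrow> nat \<Rightarrow> (nat \<Rightarrow> real) \<Rightarrow> 'v" where
  "chain_merge n \<eta> i w j t = (let w' = omit (Suc i) w; x = coords w' (omit (Suc i) t); R = slots [Suc i..<n] w' (local_rep \<eta>) in
     if j \<le> i then slots [j..<i] w (slot_deriv i (w i) (slot_deriv i (w (Suc i)) R)) x
        + slots [j..<i] w (slot_deriv i (KK.\<beta> (w i) (w (Suc i))) R) x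
     else if j = Suc i then slot_deriv i (KK.field (w (Suc i)) (x i)) R x
     else slots [j - 1..<n] w' (local_rep \<eta>)
       (x(i := HH.\<kappa> (mulK (\<gamma> (w i) (t i)) (\<gamma> (w (Suc i)) (t (Suc i)))))))"

lemma chain_merge_step:
  assumes \<eta>: "smooth_pow_map n (atlas H) \<eta>" and i: "i < n" and t: "t \<in> small (Suc n) w" "j < Suc n" "t j = 0"
  shows "((\<lambda>r. chain_merge n \<eta> i w (Suc j) (t(j := r))) has_vector_derivative chain_merge n \<eta> i w j t) (at 0)"
proof -
  define w' where "w' = omit (Suc i) w"
  define x where "x = coords w' (omit (Suc i) t)"
  define R where "R = slots [Suc i..<n] w' (local_rep \<eta>)"
  have R: "smooth_pow_on n (pow_box n HH.U) R"
    unfolding R_def by (rule smooth_pow_on_slots[OF smooth_local_rep[OF \<eta>]]) auto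
  have box: "x \<in> pow_box n HH.U" using t(1) i by (auto simp: x_def w'_def small_def coords_def pow_box_def omit_def)
  have xi: "x i = HH.\<kappa> (\<gamma> (w i) (t i))" by (simp add: x_def w'_def coords_def omit_def)
  consider "j < i" | "j = i" | "j = Suc i" | "Suc i < j" by linarith
  then show ?thesis
  proof cases
    case 1
    have upd: "coords w' (omit (Suc i) (t(j := r))) = x(j := HH.\<kappa> (\<gamma> (w j) r))" for r
      using 1 by (auto simp: fun_eq_iff x_def w'_def coords_def omit_def)
    have xj: "x j = HH.e0" using 1 t(3) by (simp add: x_def w'_def coords_def omit_def KK.exp_curve_zero)
    have step: "((\<lambda>r. slots [Suc j..<i] w f (x(j := HH.\<kappa> (\<gamma> (w j) r)))) has_vector_derivative slots [j..<i] w f x) (at 0)"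
      if "smooth_pow_on n (pow_box n HH.U) f" for f :: "(nat \<Rightarrow> 'b) \<Rightarrow> 'c"
      by (rule slots_chain_step[OF that 1 _ box xj]) (use i in simp)
    have "((\<lambda>r. slots [Suc j..<i] w (slot_deriv i (w i) (slot_deriv i (w (Suc i)) R)) (x(j := HH.\<kappa> (\<gamma> (w j) r)))
        + slots [Suc j..<i] w (slot_deriv i (KK.\<beta> (w i) (w (Suc i))) R) (x(j := HH.\<kappa> (\<gamma> (w j) r)))) has_vector_derivative
        slots [j..<i] w (slot_deriv i (w i) (slot_deriv i (w (Suc i)) R)) x
        + slots [j..<i] w (slot_deriv i (KK.\<beta> (w i) (w (Suc i))) R) x) (at 0)"
      by (intro has_vector_derivative_add step smooth_pow_on_slot_deriv R i)
    then show ?thesis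
      using 1 unfolding chain_merge_def Let_def w'_def[symmetric] upd R_def[symmetric] x_def[symmetric] by simp
  next
    case 2
    have upd: "coords w' (omit (Suc i) (t(i := r))) = x(i := HH.\<kappa> (\<gamma> (w i) r))" for r
      by (auto simp: fun_eq_iff x_def w'_def coords_def omit_def)
    have "x i = HH.e0" using t(3) 2 xi by (simp add: KK.exp_curve_zero)
    from slot_field_derivative[OF R i box this, of "w (Suc i)" "w i"]
    show ?thesis
      unfolding 2 chain_merge_def Let_def w'_def[symmetric] upd R_def[symmetric] x_def[symmetric] by simp
  next
    case 3
    have upd: "coords w' (omit (Suc i) (t(Suc i := r))) = x" for r
      by (auto simp: fun_eq_iff x_def w'_def coords_def omit_def)
    have xU: "x i \<in> HH.U" using pow_boxD[OF box i] .
    have m0: "KK.m (x i) HH.e0 = x i" by (rule KK.m_e0[OF xU])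
    have dom: "\<gamma> (w i) (t i) \<in> chart_dom (unit_chart H)" using t(1) i by (simp add: small_def)
    have "((\<lambda>y. R (x(i := y))) has_derivative (\<lambda>v. slot_deriv i v R x)) (at (KK.m (x i) HH.e0))"
      using slot_deriv_has_derivative[OF R i box] by (simp add: m0)
    from has_derivative_compose[OF KK.m_has_derivative_field[OF xU] this]
    have "((\<lambda>q. R (x(i := KK.m (x i) q))) has_derivative (\<lambda>u. slot_deriv i (KK.field u (x i)) R x)) (at HH.e0)" .
    then have "((\<lambda>q. R (x(i := KK.m (x i) q))) has_derivative (\<lambda>u. slot_deriv i (KK.field u (x i)) R x)) (at (HH.\<kappa> (\<gamma> (w (Suc i)) 0)))"
      by (simp add: KK.exp_curve_zero)
    from has_vector_derivative_chain[OF KK.exp_curve_deriv this]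
    have "((\<lambda>r. R (x(i := KK.m (x i) (HH.\<kappa> (\<gamma> (w (Suc i)) r))))) has_vector_derivative
        slot_deriv i (KK.field (w (Suc i)) (x i)) R x) (at 0)" .
    then have "((\<lambda>r. R (x(i := HH.\<kappa> (mulK (\<gamma> (w i) (t i)) (\<gamma> (w (Suc i)) r))))) has_vector_derivative
        slot_deriv i (KK.field (w (Suc i)) (x i)) R x) (at 0)"
      by (rule has_vector_derivative_transform_within_open[OF _ open_\<gamma>[OF HH.open_dom, of "w (Suc i)"]])
        (use HH.chart dom HH.\<iota>_\<kappa> in \<open>auto simp: KK.exp_curve_zero KK.m_def xi\<close>)
    then show ?thesis
      unfolding 3 chain_merge_def Let_def w'_def[symmetric] upd R_def[symmetric] x_def[symmetric] by (simp add: R_def)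
  next
    case 4
    then obtain k where k: "j = Suc k" "i < k" by (cases j) auto
    define y where "y = x(i := HH.\<kappa> (mulK (\<gamma> (w i) (t i)) (\<gamma> (w (Suc i)) (t (Suc i)))))"
    have upd: "(coords w' (omit (Suc i) (t(j := r))))(i := HH.\<kappa> (mulK (\<gamma> (w i) ((t(j := r)) i)) (\<gamma> (w (Suc i)) ((t(j := r)) (Suc i)))))
        = y(k := HH.\<kappa> (\<gamma> (w' k) r))" for r
      using k 4 by (auto simp: fun_eq_iff y_def x_def w'_def coords_def omit_def)
    have yb: "y \<in> pow_box n HH.U"
      unfolding y_def by (rule pow_box_upd[OF box]) (use t(1) i in \<open>auto simp: small_def\<close>)
    have "((\<lambda>r. slots [Suc k..<n] w' (local_rep \<eta>) (y(k := HH.\<kappa> (\<gamma> (w' k) r)))) has_vector_derivative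
       slots [k..<n] w' (local_rep \<eta>) y) (at 0)"
      by (rule slots_chain_step[OF smooth_local_rep[OF \<eta>] _ order_refl yb])
        (use k t in \<open>auto simp: y_def x_def w'_def coords_def omit_def KK.exp_curve_zero\<close>)
    moreover have "chain_merge n \<eta> i w (Suc j) (t(j := r)) = slots [Suc k..<n] w' (local_rep \<eta>) (y(k := HH.\<kappa> (\<gamma> (w' k) r)))" for r
      using k unfolding chain_merge_def Let_def w'_def[symmetric] upd by simp
    moreover have "chain_merge n \<eta> i w j t = slots [k..<n] w' (local_rep \<eta>) y"
      using k unfolding chain_merge_def Let_def w'_def[symmetric] x_def[symmetric] y_def[symmetric] by simp
    ultimately show ?thesis by simp
  qed
qed

lemma chain_merge_start:
  assumes \<eta>: "smooth_pow_map n (atlas H) \<eta>" and i: "i < n" and t: "t \<in> small (Suc n) w"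
  shows "chain_merge n \<eta> i w (Suc n) t = \<eta> (merge mulK (Suc i) (\<lambda>i. \<gamma> (w i) (t i)))"
proof -
  let ?h = "merge mulK (Suc i) (\<lambda>i. \<gamma> (w i) (t i))"
  have "(coords (omit (Suc i) w) (omit (Suc i) t))(i := HH.\<kappa> (mulK (\<gamma> (w i) (t i)) (\<gamma> (w (Suc i)) (t (Suc i)))))
      = (\<lambda>j. HH.\<kappa> (?h j))"
    by (auto simp: fun_eq_iff merge_def coords_def omit_def)
  moreover have "?h j \<in> chart_dom (unit_chart H)" if "j < n" for j
    using t i that by (auto simp: small_def merge_def)
  ultimately show ?thesis
    using local_rep_coords[OF \<eta>, of ?h] i by (simp add: chain_merge_def Let_def)
qed

lemma chain_merge_end: "i < n \<Longrightarrow> chain_merge n \<eta> i w 0 (\<lambda>_. 0) =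
    doubled_partial n i \<eta> w + mixed_partial n \<eta> ((omit (Suc i) w)(i := KK.\<beta> (w i) (w (Suc i))))"
proof -
  assume i: "i < n"
  let ?w = "(omit (Suc i) w)(i := KK.\<beta> (w i) (w (Suc i)))"
  have "omit (Suc i) (\<lambda>_. 0 :: real) = (\<lambda>_. 0)" by (auto simp: omit_def)
  moreover have "slots [0..<n] ?w (local_rep \<eta>) =
     slots [0..<i] w (slot_deriv i (KK.\<beta> (w i) (w (Suc i))) (slots [Suc i..<n] (omit (Suc i) w) (local_rep \<eta>)))"
  proof -
    have "[0..<n] = [0..<i] @ i # [Suc i..<n]"
      using i by (metis le_add1 less_imp_add_positive upt_add_eq_append upt_conv_Cons zero_le add_0 less_imp_le)
    then have "slots [0..<n] ?w (local_rep \<eta>) = slots [0..<i] ?w (slot_deriv i (?w i) (slots [Suc i..<n] ?w (local_rep \<eta>)))"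
      by (simp add: slots_append)
    also have "slots [Suc i..<n] ?w (local_rep \<eta>) = slots [Suc i..<n] (omit (Suc i) w) (local_rep \<eta>)"
      by (rule slots_cong) auto
    also have "slots [0..<i] ?w f = slots [0..<i] w f" for f :: "(nat \<Rightarrow> 'b) \<Rightarrow> 'c"
      by (rule slots_cong) (auto simp: omit_def)
    finally show ?thesis unfolding fun_upd_same .
  qed
  ultimately show ?thesis by (simp add: chain_merge_def doubled_partial_def mixed_partial_def Let_def coords_zero)
qed

lemma iter_deriv_rb_d:
  fixes \<eta> :: "(nat \<Rightarrow> 'h) \<Rightarrow> 'a"
  assumes \<eta>: "smooth_pow_map n (atlas H) \<eta>"
  shows "iter_deriv [0..<Suc n] (\<lambda>t. rb_d G H \<Phi> \<B> (Suc n) \<eta> (\<lambda>i. \<gamma> (w i) (t i))) (\<lambda>_. 0) =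
    theta G \<phi> B (w 0) (mixed_partial n \<eta> (\<lambda>j. w (Suc j))) +
    (\<Sum>i<n. (-1) ^ Suc i *\<^sub>R (doubled_partial n i \<eta> w + mixed_partial n \<eta> ((omit (Suc i) w)(i := KK.\<beta> (w i) (w (Suc i))))))"
proof -
  define chain_last where "chain_last j t = (if j = Suc n then \<eta> (\<lambda>i. \<gamma> (w i) (t i)) else 0)" for j t
  have C: "((\<lambda>r. chain_last (Suc j) (t(j := r))) has_vector_derivative chain_last j t) (at 0)" if "j < Suc n" for j t
  proof (cases "j = n")
    case True
    have dep: "depends_on_first n \<eta>" using \<eta> by (simp add: smooth_pow_map_def)
    have "\<eta> (\<lambda>i. \<gamma> (w i) ((t(n := r)) i)) = \<eta> (\<lambda>i. \<gamma> (w i) (t i))" for r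
      by (rule dep[unfolded depends_on_first_def, rule_format]) simp
    then show ?thesis unfolding chain_last_def True by simp
  next
    case False
    then show ?thesis using that by (simp add: chain_last_def)
  qed
  define g where "g j t = chain_action n \<eta> w j t + (\<Sum>i<n. (-1) ^ Suc i *\<^sub>R chain_merge n \<eta> i w j t) + (-1) ^ (n + 1) *\<^sub>R chain_last j t" for j t
  have "iter_deriv [0..<Suc n] (\<lambda>t. rb_d G H \<Phi> \<B> (Suc n) \<eta> (\<lambda>i. \<gamma> (w i) (t i))) (\<lambda>_. 0) = g 0 (\<lambda>_. 0)"
  proof (rule iter_deriv_eq_chain[where N="small (Suc n) w"])
    fix t assume t: "t \<in> small (Suc n) w"
    have "coords (w \<circ> Suc) (t \<circ> Suc) = (\<lambda>i. HH.\<kappa> (\<gamma> (w (i + 1)) (t (i + 1))))" by (auto simp: coords_def)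
    then have A: "chain_action n \<eta> w (Suc n) t = Theta G H \<Phi> \<B> (\<gamma> (w 0) (t 0)) (\<eta> (\<lambda>i. \<gamma> (w (i + 1)) (t (i + 1))))"
      using local_rep_coords[OF \<eta>, of "\<lambda>i. \<gamma> (w (i + 1)) (t (i + 1))"] t by (simp add: chain_action_def small_def)
    have "(\<Sum>i = 1..n. (-1) ^ i *\<^sub>R \<eta> (merge mulK i (\<lambda>i. \<gamma> (w i) (t i)))) =
        (\<Sum>i<n. (-1) ^ Suc i *\<^sub>R \<eta> (merge mulK (Suc i) (\<lambda>i. \<gamma> (w i) (t i))))"
      using sum.atLeast_Suc_atMost_Suc_shift[of "\<lambda>i. (-1) ^ i *\<^sub>R \<eta> (merge mulK i (\<lambda>i. \<gamma> (w i) (t i)))" 0 "n - 1"]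
      by (cases n) (simp_all add: lessThan_Suc_atMost atLeast0AtMost del: sum.lessThan_Suc)
    also have "\<dots> = (\<Sum>i<n. (-1) ^ Suc i *\<^sub>R chain_merge n \<eta> i w (Suc n) t)"
      by (rule sum.cong) (simp_all add: chain_merge_start[OF \<eta> _ t])
    finally show "rb_d G H \<Phi> \<B> (Suc n) \<eta> (\<lambda>i. \<gamma> (w i) (t i)) = g (Suc n) t"
      unfolding rb_d_def descendent_simps Let_def by (simp add: g_def A chain_last_def)
  next
    fix t j assume t: "t \<in> small (Suc n) w" "j < Suc n" "t j = 0"
    show "((\<lambda>r. g (Suc j) (t(j := r))) has_vector_derivative g j t) (at 0)"
      unfolding g_def
      by (intro has_vector_derivative_add has_vector_derivative_sum
          bounded_linear.has_vector_derivative[OF bounded_linear_scaleR_right] C t chain_action_step[OF \<eta> t] chain_merge_step[OF \<eta> _ t]) simp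
  qed (use small_open zero_small in auto)
  also have "\<dots> = theta G \<phi> B (w 0) (mixed_partial n \<eta> (\<lambda>j. w (Suc j))) +
    (\<Sum>i<n. (-1) ^ Suc i *\<^sub>R (doubled_partial n i \<eta> w + mixed_partial n \<eta> ((omit (Suc i) w)(i := KK.\<beta> (w i) (w (Suc i))))))"
  proof -
    have "(\<lambda>_. 0 :: real) \<circ> Suc = (\<lambda>_. 0)" by auto
    then have "chain_action n \<eta> w 0 (\<lambda>_. 0) = theta G \<phi> B (w 0) (mixed_partial n \<eta> (\<lambda>j. w (Suc j)))"
      by (simp add: chain_action_def mixed_partial_def coords_zero o_def)
    then show ?thesis by (simp add: g_def chain_last_def chain_merge_end)
  qed
  finally show ?thesis .
qed

end

section \<open>Alternation\<close>

definition alt :: "nat \<Rightarrow> ((nat \<Rightarrow> 'b) \<Rightarrow> 'v::real_vector) \<Rightarrow> (nat \<Rightarrow> 'b) \<Rightarrow> 'v" where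
  "alt n M u = (\<Sum>s | s permutes {..<n}. real_of_int (sign s) *\<^sub>R M (u \<circ> s))"

definition insert_at :: "nat \<Rightarrow> 'b \<Rightarrow> (nat \<Rightarrow> 'b) \<Rightarrow> nat \<Rightarrow> 'b" where
  "insert_at i z v = (\<lambda>j. if j < i then v j else if j = i then z else v (j - 1))"

lemma finite_permutes: "finite {s. s permutes {..<n::nat}}"
  by (rule finite_permutations) simp

lemma sign_permutation_insert:
  assumes "\<tau> permutes {..<n}" "p < Suc n" "a < Suc n"
  shows "real_of_int (sign (permutation_insert p a \<tau>)) = (-1) ^ (p + a) * real_of_int (sign \<tau>)"
proof -
  have "\<tau> permutes {0..<n}" using assms(1) by (simp add: lessThan_atLeast0)
  from signof_permutation_insert[OF this assms(2,3), where 'a=real] show ?thesis by simp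
qed

lemma sum_permutes_fixed_value:
  fixes h :: "(nat \<Rightarrow> nat) \<Rightarrow> 'v::real_vector"
  assumes "p < Suc n" "a < Suc n"
  shows "(\<Sum>s | s permutes {..<Suc n} \<and> s p = a. real_of_int (sign s) *\<^sub>R h s) =
    (-1) ^ (p + a) *\<^sub>R (\<Sum>\<tau> | \<tau> permutes {..<n}. real_of_int (sign \<tau>) *\<^sub>R h (permutation_insert p a \<tau>))"
proof -
  have "{s. s permutes {..<Suc n} \<and> s p = a} = permutation_insert p a ` {\<tau>. \<tau> permutes {..<n}}"
    using permutation_fix[OF assms] by (simp add: lessThan_atLeast0)
  moreover have "inj_on (permutation_insert p a) {\<tau>. \<tau> permutes {..<n}}"
    using permutation_insert_inj_on[OF assms] by (simp add: lessThan_atLeast0)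
  ultimately have "(\<Sum>s | s permutes {..<Suc n} \<and> s p = a. real_of_int (sign s) *\<^sub>R h s) =
    (\<Sum>\<tau> | \<tau> permutes {..<n}. real_of_int (sign (permutation_insert p a \<tau>)) *\<^sub>R h (permutation_insert p a \<tau>))"
    by (simp add: sum.reindex)
  also have "\<dots> = (\<Sum>\<tau> | \<tau> permutes {..<n}. (-1) ^ (p + a) *\<^sub>R (real_of_int (sign \<tau>) *\<^sub>R h (permutation_insert p a \<tau>)))"
    by (rule sum.cong) (simp_all add: sign_permutation_insert assms scaleR_scaleR)
  finally show ?thesis by (simp add: scaleR_sum_right)
qed

text \<open>
Expansion along a row or a column, as for determinants: permutations are grouped by the value at \<open>p\<close> here and by the preimage
of \<open>a\<close> in the next lemma. Deleting the pair \<open>(p, a)\<close> changes the sign by \<open>(-1)\<^sup>p\<^sup>+\<^sup>a\<close>.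
\<close>

lemma sum_permutes_by_value:
  fixes h :: "(nat \<Rightarrow> nat) \<Rightarrow> 'v::real_vector"
  assumes "p < Suc n"
  shows "(\<Sum>s | s permutes {..<Suc n}. real_of_int (sign s) *\<^sub>R h s) =
    (\<Sum>a<Suc n. (-1) ^ (p + a) *\<^sub>R
      (\<Sum>\<tau> | \<tau> permutes {..<n}. real_of_int (sign \<tau>) *\<^sub>R h (permutation_insert p a \<tau>)))"
proof -
  have "(\<Sum>s | s permutes {..<Suc n}. real_of_int (sign s) *\<^sub>R h s) =
    (\<Sum>a<Suc n. \<Sum>s | s \<in> {s. s permutes {..<Suc n}} \<and> s p = a. real_of_int (sign s) *\<^sub>R h s)"
    by (rule sum.group[symmetric]) (use assms finite_permutes permutes_in_image in \<open>auto simp del: lessThan_Suc\<close>, fastforce)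
  then show ?thesis using sum_permutes_fixed_value[OF assms, where h=h] by simp
qed

lemma sum_permutes_by_position:
  fixes h :: "(nat \<Rightarrow> nat) \<Rightarrow> 'v::real_vector"
  assumes "a < Suc n"
  shows "(\<Sum>s | s permutes {..<Suc n}. real_of_int (sign s) *\<^sub>R h s) =
    (\<Sum>p<Suc n. (-1) ^ (p + a) *\<^sub>R
      (\<Sum>\<tau> | \<tau> permutes {..<n}. real_of_int (sign \<tau>) *\<^sub>R h (permutation_insert p a \<tau>)))"
proof -
  have eq: "{s. s permutes {..<Suc n} \<and> inv_into UNIV s a = p} = {s. s permutes {..<Suc n} \<and> s p = a}" for p
    using permutes_inv_eq[of _ "{..<Suc n}" a p] by blast
  have "(\<Sum>s | s permutes {..<Suc n}. real_of_int (sign s) *\<^sub>R h s) =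
    (\<Sum>p<Suc n. \<Sum>s | s \<in> {s. s permutes {..<Suc n}} \<and> inv_into UNIV s a = p. real_of_int (sign s) *\<^sub>R h s)"
  proof (rule sum.group[symmetric])
    show "(\<lambda>s. inv_into UNIV s a) ` {s. s permutes {..<Suc n}} \<subseteq> {..<Suc n}"
      using assms permutes_in_image[OF permutes_inv] by fast
  qed (rule finite_permutes, simp)
  then show ?thesis using sum_permutes_fixed_value[OF _ assms, where h=h] by (simp add: eq)
qed

lemma omit_permutation_insert: "omit p (u \<circ> permutation_insert p a \<tau>) = omit a u \<circ> \<tau>"
  by (rule ext) (auto simp: omit_def permutation_insert_expand)

text \<open>
The dependence of the argument on \<open>w p\<close> is singled out, and the remaining entries form a shorter sequence.
\<close>

lemma alt_by_value:
  assumes "p < Suc n"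
  shows "alt (Suc n) (\<lambda>w. f (w p) (omit p w)) u = (\<Sum>a<Suc n. (-1) ^ (p + a) *\<^sub>R alt n (f (u a)) (omit a u))"
  unfolding alt_def sum_permutes_by_value[OF assms]
  by (simp add: omit_permutation_insert del: sum.lessThan_Suc)

lemma alt_case_nat:
  "alt (Suc n) M (case_nat z v) = (\<Sum>i<Suc n. (-1) ^ i *\<^sub>R alt n (\<lambda>v. M (insert_at i z v)) v)"
proof -
  have "case_nat z v \<circ> permutation_insert p 0 \<tau> = insert_at p z (v \<circ> \<tau>)" for p \<tau>
    by (rule ext) (auto simp: insert_at_def permutation_insert_expand)
  then show ?thesis
    unfolding alt_def using sum_permutes_by_position[of 0 n "\<lambda>s. M (case_nat z v \<circ> s)"]
    by (simp del: sum.lessThan_Suc)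
qed

lemma eq_uminus_self_0: "x = - x \<Longrightarrow> x = (0::'v::real_vector)"
proof -
  assume "x = - x"
  then have "2 *\<^sub>R x = 0" by (metis add.right_inverse scaleR_2)
  then show ?thesis by simp
qed

text \<open>
An involution that reverses the sign pairs the permutations into terms that cancel.
\<close>

lemma signed_sum_cancel:
  fixes h :: "(nat \<Rightarrow> nat) \<Rightarrow> 'v::real_vector"
  assumes "\<And>s. s permutes A \<Longrightarrow> f s permutes A" "\<And>s. f (f s) = s"
    and "\<And>s. s permutes A \<Longrightarrow> sign (f s) = - sign s" "\<And>s. h (f s) = h s"
  shows "(\<Sum>s | s permutes A. real_of_int (sign s) *\<^sub>R h s) = 0"
proof -
  have "(\<Sum>s | s permutes A. real_of_int (sign s) *\<^sub>R h s) = (\<Sum>s | s permutes A. real_of_int (sign (f s)) *\<^sub>R h (f s))"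
    by (rule sum.reindex_bij_witness[of _ f f]) (use assms(1,2) in auto)
  also have "\<dots> = - (\<Sum>s | s permutes A. real_of_int (sign s) *\<^sub>R h s)"
    unfolding sum_negf[symmetric] by (rule sum.cong) (simp_all add: assms(3,4))
  finally show ?thesis by (rule eq_uminus_self_0)
qed

lemma sign_swap:
  assumes "s permutes {..<n::nat}" "i \<noteq> j"
  shows "sign (s \<circ> Transposition.transpose i j) = - sign s" "sign (Transposition.transpose i j \<circ> s) = - sign s"
  using assms by (simp_all add: sign_compose permutes_imp_permutation[of "{..<n}"] permutation_swap_id sign_swap_id)

lemma alt_eq_0_of_swap_invariant:
  assumes "i < n" "j < n" "i \<noteq> j" "\<And>w. f (w \<circ> Transposition.transpose i j) = f w"
  shows "alt n f u = 0"
proof -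
  have t: "Transposition.transpose i j permutes {..<n}" using assms by (intro permutes_swap_id) auto
  show ?thesis unfolding alt_def
  proof (rule signed_sum_cancel[of _ "\<lambda>s. s \<circ> Transposition.transpose i j"])
    show "f (u \<circ> (s \<circ> Transposition.transpose i j)) = f (u \<circ> s)" for s
      using assms(4)[of "u \<circ> s"] by (simp only: comp_assoc)
  qed (use assms(3) in \<open>auto intro: permutes_compose[OF t] simp: comp_assoc sign_swap\<close>)
qed

lemma alt_alternating:
  assumes "i < n" "j < n" "i \<noteq> j" "u i = u j"
  shows "alt n M u = 0"
proof -
  have t: "Transposition.transpose i j permutes {..<n}" using assms by (intro permutes_swap_id) auto
  have "u \<circ> Transposition.transpose i j = u" using assms(4) by (auto simp: fun_eq_iff Transposition.transpose_def)
  then show ?thesis unfolding alt_def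
    by (intro signed_sum_cancel[of _ "\<lambda>s. Transposition.transpose i j \<circ> s"])
      (auto intro: permutes_compose[OF _ t] simp: comp_assoc[symmetric] sign_swap[OF _ assms(3)])
qed

lemma alt_add: "alt n (\<lambda>w. f w + g w) u = alt n f u + alt n g u"
  by (simp add: alt_def scaleR_add_right sum.distrib)

lemma alt_scaleR: "alt n (\<lambda>w. a *\<^sub>R f w) u = a *\<^sub>R alt n f u"
  by (simp add: alt_def scaleR_sum_right mult.commute)

lemma alt_diff: "alt n (\<lambda>w. f w - g w) u = alt n f u - alt n g u"
  by (simp add: alt_def scaleR_diff_right sum_subtractf)

lemma alt_sum: "alt n (\<lambda>w. \<Sum>i\<in>I. f i w) u = (\<Sum>i\<in>I. alt n (f i) u)"
  by (simp add: alt_def scaleR_sum_right) (rule sum.swap)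

lemma insert_at_upd: "insert_at i z v = (insert_at i 0 v)(i := z)"
  by (auto simp: insert_at_def fun_eq_iff)

lemma upd_eq_insert_at: "v(i := z) = insert_at i z (omit i v)"
  by (auto simp: insert_at_def omit_def fun_eq_iff)

lemma omit_omit: "a \<le> b \<Longrightarrow> omit b (omit a u) = omit a (omit (Suc b) u)"
  by (auto simp: omit_def fun_eq_iff)

text \<open>
The left-hand side comes from the terms of the group differential, the right-hand side is the bracket part of the
Chevalley-Eilenberg differential. On the left, two expansions choose the entries \<open>u\<^sub>a\<close> and \<open>u\<^sub>b\<close> for the positions
\<open>i\<close> and \<open>i + 1\<close>. On the right, an expansion chooses the position \<open>i\<close> at which the bracket is inserted. The terms with
\<open>a < b\<close> and with \<open>a > b\<close> have opposite signs and combine to \<open>\<beta> u\<^sub>a u\<^sub>b - \<beta> u\<^sub>b u\<^sub>a\<close>.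
\<close>

lemma alt_bracket_slots:
  fixes M :: "(nat \<Rightarrow> 'b::ab_group_add) \<Rightarrow> 'v::real_vector"
  assumes M: "\<And>v i x y. i < n \<Longrightarrow> M (v(i := x - y)) = M (v(i := x)) - M (v(i := y))"
  shows "(\<Sum>i<n. (-1) ^ Suc i *\<^sub>R alt (Suc n) (\<lambda>w. M ((omit (Suc i) w)(i := \<beta> (w i) (w (Suc i))))) u) =
    (\<Sum>j<Suc n. \<Sum>i<j. (-1) ^ (i + j) *\<^sub>R
       alt n M (case_nat (\<beta> (u i) (u j) - \<beta> (u j) (u i)) (omit i (omit j u))))"
proof (cases n)
  case 0
  then show ?thesis by simp
next
  case (Suc k)
  define A where "A z v = alt n M (case_nat z v)" for z v
  have A: "A z v = (\<Sum>i<n. (-1) ^ i *\<^sub>R alt k (\<lambda>v. M (insert_at i z v)) v)" for z v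
    unfolding A_def Suc by (rule alt_case_nat)
  have A_diff: "A (x - y) v = A x v - A y v" for x y v
  proof -
    have "alt k (\<lambda>v. M (insert_at i (x - y) v)) v = alt k (\<lambda>v. M (insert_at i x v)) v - alt k (\<lambda>v. M (insert_at i y v)) v"
      if "i < n" for i
      using M[OF that] by (subst (1 2 3) insert_at_upd) (simp add: alt_diff)
    then show ?thesis by (simp add: A scaleR_diff_right sum_subtractf)
  qed
  have slot: "alt (Suc n) (\<lambda>w. M ((omit (Suc i) w)(i := \<beta> (w i) (w (Suc i))))) u =
      (\<Sum>a<Suc n. \<Sum>b<n. ((-1) ^ (a + b)) *\<^sub>R alt k (\<lambda>v. M (insert_at i (\<beta> (u a) (omit a u b)) v)) (omit b (omit a u)))"
    if i: "i < n" for i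
  proof -
    \<comment> \<open>Omitting either of two neighbours makes no difference when the slot is overwritten.\<close>
    have "(omit (Suc i) w)(i := \<beta> (w i) (w (Suc i))) = (omit i w)(i := \<beta> (w i) (omit i w i))" for w :: "nat \<Rightarrow> 'b"
      by (auto simp: omit_def fun_eq_iff)
    then have "alt (Suc n) (\<lambda>w. M ((omit (Suc i) w)(i := \<beta> (w i) (w (Suc i))))) u =
      alt (Suc n) (\<lambda>w. (\<lambda>x v. M (v(i := \<beta> x (v i)))) (w i) (omit i w)) u" by simp
    also have "\<dots> = (\<Sum>a<Suc n. (-1) ^ (i + a) *\<^sub>R alt n (\<lambda>v. M (v(i := \<beta> (u a) (v i)))) (omit a u))"
      by (rule alt_by_value) (use i in simp)
    also have "\<dots> = (\<Sum>a<Suc n. (-1) ^ (i + a) *\<^sub>R (\<Sum>b<n. (-1) ^ (i + b) *\<^sub>R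
        alt k (\<lambda>v. M (insert_at i (\<beta> (u a) (omit a u b)) v)) (omit b (omit a u))))"
    proof -
      have "alt n (\<lambda>v. M (v(i := \<beta> x (v i)))) v' = (\<Sum>b<n. (-1) ^ (i + b) *\<^sub>R
        alt k (\<lambda>v. M (insert_at i (\<beta> x (v' b)) v)) (omit b v'))" for x v'
        unfolding upd_eq_insert_at Suc
        by (rule alt_by_value[where f="\<lambda>y v. M (insert_at i (\<beta> x y) v)"]) (use i Suc in simp)
      then show ?thesis by simp
    qed
    also have "\<dots> = (\<Sum>a<Suc n. \<Sum>b<n. ((-1) ^ (a + b)) *\<^sub>R alt k (\<lambda>v. M (insert_at i (\<beta> (u a) (omit a u b)) v)) (omit b (omit a u)))"
    proof -
      have "(-1::real) ^ (i + a) * (-1) ^ (i + b) = (-1) ^ (a + b)" for a b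
        by (simp add: power_add[symmetric]) (simp add: power_add mult_ac flip: power_mult_distrib)
      then show ?thesis by (simp only: scaleR_sum_right scaleR_scaleR)
    qed
    finally show ?thesis .
  qed
  have "(\<Sum>i<n. (-1) ^ Suc i *\<^sub>R alt (Suc n) (\<lambda>w. M ((omit (Suc i) w)(i := \<beta> (w i) (w (Suc i))))) u) =
    (\<Sum>i<n. \<Sum>a<Suc n. \<Sum>b<n. - ((-1) ^ (a + b) *\<^sub>R ((-1) ^ i *\<^sub>R alt k (\<lambda>v. M (insert_at i (\<beta> (u a) (omit a u b)) v)) (omit b (omit a u)))))"
    by (rule sum.cong) (simp_all add: slot scaleR_sum_right sum_negf mult.commute del: sum.lessThan_Suc)
  also have "\<dots> = (\<Sum>a<Suc n. \<Sum>b<n. - ((-1) ^ (a + b) *\<^sub>R A (\<beta> (u a) (omit a u b)) (omit b (omit a u))))"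
    unfolding A by (subst sum.swap, rule sum.cong[OF refl], subst sum.swap)
      (simp add: scaleR_sum_right sum_negf del: sum.lessThan_Suc)
  \<comment> \<open>An index \<open>b \<ge> a\<close> into the shortened sequence is the index \<open>c = b + 1\<close> of the original one; this shift reverses the sign.\<close>
  also have "\<dots> = (\<Sum>a<Suc n. (\<Sum>b<a. - ((-1) ^ (a + b) *\<^sub>R A (\<beta> (u a) (u b)) (omit b (omit a u))))
      + (\<Sum>c\<in>{a<..<Suc n}. (-1) ^ (a + c) *\<^sub>R A (\<beta> (u a) (u c)) (omit a (omit c u))))"
  proof (rule sum.cong[OF refl])
    fix a assume a: "a \<in> {..<Suc n}"
    let ?f = "\<lambda>b. - ((-1) ^ (a + b) *\<^sub>R A (\<beta> (u a) (omit a u b)) (omit b (omit a u)))"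
    have "(\<Sum>b<n. ?f b) = (\<Sum>b<a. ?f b) + (\<Sum>b\<in>{a..<n}. ?f b)"
      using a by (subst sum.union_disjoint[symmetric]) (auto intro: sum.cong)
    also have "(\<Sum>b<a. ?f b) = (\<Sum>b<a. - ((-1) ^ (a + b) *\<^sub>R A (\<beta> (u a) (u b)) (omit b (omit a u))))"
      by (rule sum.cong) (simp_all add: omit_def)
    also have "(\<Sum>b\<in>{a..<n}. ?f b) = (\<Sum>c\<in>{a<..<Suc n}. (-1) ^ (a + c) *\<^sub>R A (\<beta> (u a) (u c)) (omit a (omit c u)))"
    proof (rule sum.reindex_bij_witness[of _ "\<lambda>c. c - 1" Suc])
      fix b assume "b \<in> {a..<n}"
      then have "omit b (omit a u) = omit a (omit (Suc b) u)" "omit a u b = u (Suc b)"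
        by (auto simp: omit_omit) (simp add: omit_def)
      then show "(-1) ^ (a + Suc b) *\<^sub>R A (\<beta> (u a) (u (Suc b))) (omit a (omit (Suc b) u)) = ?f b" by simp
    qed auto
    finally show "(\<Sum>b<n. ?f b) = (\<Sum>b<a. - ((-1) ^ (a + b) *\<^sub>R A (\<beta> (u a) (u b)) (omit b (omit a u))))
      + (\<Sum>c\<in>{a<..<Suc n}. (-1) ^ (a + c) *\<^sub>R A (\<beta> (u a) (u c)) (omit a (omit c u)))" .
  qed
  also have "\<dots> = (\<Sum>j<Suc n. \<Sum>i<j. - ((-1) ^ (i + j) *\<^sub>R A (\<beta> (u j) (u i)) (omit i (omit j u))))
      + (\<Sum>j<Suc n. \<Sum>i<j. (-1) ^ (i + j) *\<^sub>R A (\<beta> (u i) (u j)) (omit i (omit j u)))"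
  proof -
    let ?g = "\<lambda>a c. (-1) ^ (a + c) *\<^sub>R A (\<beta> (u a) (u c)) (omit a (omit c u))"
    have "(\<Sum>a<Suc n. \<Sum>c\<in>{a<..<Suc n}. ?g a c) = (\<Sum>(a, c)\<in>(SIGMA a:{..<Suc n}. {a<..<Suc n}). ?g a c)"
      by (rule sum.Sigma) auto
    also have "\<dots> = (\<Sum>(c, a)\<in>(SIGMA c:{..<Suc n}. {..<c}). ?g a c)"
      by (rule sum.reindex_bij_witness[of _ "\<lambda>(c, a). (a, c)" "\<lambda>(a, c). (c, a)"]) auto
    also have "\<dots> = (\<Sum>c<Suc n. \<Sum>a<c. ?g a c)"
      by (rule sum.Sigma[symmetric]) auto
    finally show ?thesis by (simp only: sum.distrib add.commute)
  qed
  also have "\<dots> = (\<Sum>j<Suc n. \<Sum>i<j. (-1) ^ (i + j) *\<^sub>R A (\<beta> (u i) (u j) - \<beta> (u j) (u i)) (omit i (omit j u)))"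
    unfolding sum.distrib[symmetric] by (simp only: A_diff scaleR_diff_right add.commute add_uminus_conv_diff)
  finally show ?thesis unfolding A_def .
qed

section \<open>Linear combinations of smooth cochains\<close>

lemma Ck_pow_on_cong:
  assumes U: "\<And>i. i < n \<Longrightarrow> open (U i)" and S: "S = {x. \<forall>i<n. x i \<in> U i}"
    and fg: "\<And>x. x \<in> S \<Longrightarrow> f x = g x" and f: "Ck_pow_on k n S f"
  shows "Ck_pow_on k n S g"
  using fg f
proof (induction k arbitrary: f g)
  case 0
  then show ?case by (simp cong: continuous_on_cong)
next
  case (Suc k)
  have upd: "x(i := y) \<in> S" if "x \<in> S" "i < n" "y \<in> U i" for x i y using that by (auto simp: S)
  have xU: "x i \<in> U i" if "x \<in> S" "i < n" for x i using that by (auto simp: S)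
  have "continuous_on S g" using Suc.prems by (auto cong: continuous_on_cong)
  moreover have "(\<lambda>y. g (x(i := y))) differentiable (at (x i))" if "i < n" "x \<in> S" for i x
    by (rule differentiable_cong_open[OF U[OF that(1)] xU[OF that(2,1)], of "\<lambda>y. f (x(i := y))"])
      (use Suc.prems upd that in auto)
  moreover have "Ck_pow_on k n S (\<lambda>x. frechet_derivative (\<lambda>y. g (x(i := y))) (at (x i)) v)" if i: "i < n" for i v
  proof (rule Suc.IH)
    show "Ck_pow_on k n S (\<lambda>x. frechet_derivative (\<lambda>y. f (x(i := y))) (at (x i)) v)"
      using Suc.prems(2) i by simp
    show "frechet_derivative (\<lambda>y. f (x(i := y))) (at (x i)) v = frechet_derivative (\<lambda>y. g (x(i := y))) (at (x i)) v"
      if "x \<in> S" for x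
      by (rule fun_cong[OF frechet_derivative_cong_open[OF U[OF i] xU[OF that i]]])
        (rule Suc.prems(1)[OF upd[OF that i]])
  qed
  ultimately show ?case by simp
qed

lemma Ck_pow_on_combination:
  assumes U: "\<And>i. i < n \<Longrightarrow> open (U i)" and S: "S = {x. \<forall>i<n. x i \<in> U i}"
    and f: "Ck_pow_on k n S f" and g: "Ck_pow_on k n S g"
  shows "Ck_pow_on k n S (\<lambda>x. a *\<^sub>R f x + b *\<^sub>R g x)"
  using f g
proof (induction k arbitrary: f g)
  case 0
  then show ?case unfolding Ck_pow_on.simps
    by (intro continuous_on_add continuous_on_scaleR continuous_on_const)
next
  case (Suc k)
  have D: "((\<lambda>y. a *\<^sub>R f (x(i := y)) + b *\<^sub>R g (x(i := y))) has_derivative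
     (\<lambda>v. a *\<^sub>R frechet_derivative (\<lambda>y. f (x(i := y))) (at (x i)) v
        + b *\<^sub>R frechet_derivative (\<lambda>y. g (x(i := y))) (at (x i)) v)) (at (x i))"
    if "i < n" "x \<in> S" for i x
    using Suc.prems that by (intro has_derivative_add has_derivative_scaleR_right) (auto simp: frechet_derivative_works[symmetric])
  have "continuous_on S f" "continuous_on S g" using Suc.prems by simp_all
  then have "continuous_on S (\<lambda>x. a *\<^sub>R f x + b *\<^sub>R g x)"
    by (intro continuous_on_add continuous_on_scaleR continuous_on_const)
  moreover have "(\<lambda>y. a *\<^sub>R f (x(i := y)) + b *\<^sub>R g (x(i := y))) differentiable (at (x i))" if "i < n" "x \<in> S" for i x
    using D[OF that] by (auto simp: differentiable_def)
  moreover have "Ck_pow_on k n S (\<lambda>x. frechet_derivative (\<lambda>y. a *\<^sub>R f (x(i := y)) + b *\<^sub>R g (x(i := y))) (at (x i)) v)"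
    if i: "i < n" for i v
  proof (rule Ck_pow_on_cong[OF U S])
    show "Ck_pow_on k n S (\<lambda>x. a *\<^sub>R frechet_derivative (\<lambda>y. f (x(i := y))) (at (x i)) v
        + b *\<^sub>R frechet_derivative (\<lambda>y. g (x(i := y))) (at (x i)) v)"
      by (rule Suc.IH) (use Suc.prems i in \<open>unfold Ck_pow_on.simps, blast+\<close>)
    show "a *\<^sub>R frechet_derivative (\<lambda>y. f (x(i := y))) (at (x i)) v + b *\<^sub>R frechet_derivative (\<lambda>y. g (x(i := y))) (at (x i)) v
      = frechet_derivative (\<lambda>y. a *\<^sub>R f (x(i := y)) + b *\<^sub>R g (x(i := y))) (at (x i)) v" if "x \<in> S" for x
      by (rule fun_cong[OF frechet_derivative_at[OF D[OF i that]]])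
  qed auto
  ultimately show ?case by simp
qed

lemma Ck_pow_on_zero: "Ck_pow_on k n S (\<lambda>_. 0)"
proof (induction k)
  case (Suc k)
  then show ?case by (simp add: frechet_derivative_const)
qed simp

lemma smooth_pow_map_zero: "smooth_pow_map n A (\<lambda>_. 0)"
  by (simp add: smooth_pow_map_def depends_on_first_def smooth_pow_on_def Ck_pow_on_zero)

lemma smooth_pow_map_combination:
  assumes "\<forall>c\<in>A. is_chart c" "smooth_pow_map n A F" "smooth_pow_map n A F'"
  shows "smooth_pow_map n A (\<lambda>h. a *\<^sub>R F h + b *\<^sub>R F' h)"
  unfolding smooth_pow_map_def
proof (intro conjI allI impI)
  show "depends_on_first n (\<lambda>h. a *\<^sub>R F h + b *\<^sub>R F' h)"
    using assms(2,3) unfolding smooth_pow_map_def depends_on_first_def by metis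
  fix c assume c: "\<forall>i<n. c i \<in> A"
  show "smooth_pow_on n {x. \<forall>i<n. x i \<in> chart_ran (c i)}
        (\<lambda>x. a *\<^sub>R F (\<lambda>i. chart_inv (c i) (x i)) + b *\<^sub>R F' (\<lambda>i. chart_inv (c i) (x i)))"
    unfolding smooth_pow_on_def
  proof
    fix k
    show "Ck_pow_on k n {x. \<forall>i<n. x i \<in> chart_ran (c i)}
        (\<lambda>x. a *\<^sub>R F (\<lambda>i. chart_inv (c i) (x i)) + b *\<^sub>R F' (\<lambda>i. chart_inv (c i) (x i)))"
    proof (rule Ck_pow_on_combination[OF _ refl])
      show "open (chart_ran (c i))" if "i < n" for i using assms(1) c that is_chartD(2) by blast
    qed (use assms(2,3) c in \<open>auto simp: smooth_pow_map_def smooth_pow_on_def\<close>)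
  qed
qed

section \<open>Cochain maps induce homomorphisms\<close>

definition linear_complex :: "(nat \<Rightarrow> ('x \<Rightarrow> 'v::real_vector) set) \<Rightarrow> (nat \<Rightarrow> ('x \<Rightarrow> 'v) \<Rightarrow> 'x \<Rightarrow> 'v) \<Rightarrow> bool" where
  "linear_complex C d \<longleftrightarrow> (\<forall>k\<ge>1. (\<lambda>_. 0) \<in> C k \<and>
     (\<forall>F\<in>C k. \<forall>F'\<in>C k. \<forall>a b. (\<lambda>x. a *\<^sub>R F x + b *\<^sub>R F' x) \<in> C k \<and>
        d k (\<lambda>x. a *\<^sub>R F x + b *\<^sub>R F' x) = (\<lambda>x. a *\<^sub>R d k F x + b *\<^sub>R d k F' x)))"

lemma linear_complexD:
  assumes "linear_complex C d" "k \<ge> 1"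
  shows "(\<lambda>_. 0) \<in> C k" "F \<in> C k \<Longrightarrow> F' \<in> C k \<Longrightarrow> (\<lambda>x. a *\<^sub>R F x + b *\<^sub>R F' x) \<in> C k"
    "F \<in> C k \<Longrightarrow> F' \<in> C k \<Longrightarrow> d k (\<lambda>x. a *\<^sub>R F x + b *\<^sub>R F' x) = (\<lambda>x. a *\<^sub>R d k F x + b *\<^sub>R d k F' x)"
  using assms unfolding linear_complex_def by blast+

lemma linear_complex_zero: "linear_complex C d \<Longrightarrow> k \<ge> 1 \<Longrightarrow> d k (\<lambda>_. 0) = (\<lambda>_. 0)"
  using linear_complexD(3)[of C d k "\<lambda>_. 0" "\<lambda>_. 0" 0 0] linear_complexD(1)[of C d k] by simp

lemma coboundaries_combination:
  assumes L: "linear_complex C d"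
    and x: "x \<in> coboundaries C d k" and y: "y \<in> coboundaries C d k"
  shows "(\<lambda>z. a *\<^sub>R x z + b *\<^sub>R y z) \<in> coboundaries C d k"
proof (cases "k \<le> 1")
  case True
  then show ?thesis using x y by (simp add: coboundaries_def)
next
  case False
  then have k: "k - 1 \<ge> 1" by simp
  obtain f g where "f \<in> C (k - 1)" "g \<in> C (k - 1)" "x = d (k - 1) f" "y = d (k - 1) g"
    using x y False by (auto simp: coboundaries_def)
  then have "(\<lambda>z. a *\<^sub>R x z + b *\<^sub>R y z) \<in> d (k - 1) ` C (k - 1)"
    using linear_complexD(2,3)[OF L k, of f g a b] by (intro image_eqI[of _ _ "\<lambda>z. a *\<^sub>R f z + b *\<^sub>R g z"]) simp_all
  then show ?thesis using False by (simp add: coboundaries_def)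
qed

lemma coboundaries_zero: "linear_complex C d \<Longrightarrow> (\<lambda>_. 0) \<in> coboundaries C d k"
  using linear_complex_zero[of C d "k - 1"] linear_complexD(1)[of C d "k - 1"]
  by (auto simp: coboundaries_def image_iff intro!: bexI[of _ "\<lambda>_. 0"])

lemma cocycles_add:
  assumes L: "linear_complex C d" "k \<ge> 1" and "F \<in> cocycles C d k" "F' \<in> cocycles C d k"
  shows "(\<lambda>x. F x + F' x) \<in> cocycles C d k"
  using linear_complexD(2,3)[OF L, of F F' 1 1] assms(3,4) by (simp add: cocycles_def)

lemma cohomology_class_eq: "cohomology_class C d k F = {\<lambda>x. c x + F x | c. c \<in> coboundaries C d k}"
  by (auto simp: cohomology_class_def r_coset_def cocycle_group_def)

lemma cohomology_classI: "c \<in> coboundaries C d k \<Longrightarrow> (\<lambda>x. c x + F x) \<in> cohomology_class C d k F"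
  unfolding cohomology_class_eq by (rule CollectI) (rule exI[of _ c], simp)

lemma cohomology_class_eq_iff:
  assumes L: "linear_complex C d"
  shows "cohomology_class C d k F = cohomology_class C d k F' \<longleftrightarrow> (\<lambda>x. F x - F' x) \<in> coboundaries C d k"
proof
  assume eq: "cohomology_class C d k F = cohomology_class C d k F'"
  have "(\<lambda>x. 0 + F x) \<in> cohomology_class C d k F"
    by (rule cohomology_classI[OF coboundaries_zero[OF L]])
  then have "F \<in> cohomology_class C d k F'" using eq by simp
  then obtain c where c: "c \<in> coboundaries C d k" "F = (\<lambda>x. c x + F' x)"
    unfolding cohomology_class_eq by blast
  then show "(\<lambda>x. F x - F' x) \<in> coboundaries C d k" by simp
next
  have sub: "cohomology_class C d k F \<subseteq> cohomology_class C d k F'"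
    if "(\<lambda>x. F x - F' x) \<in> coboundaries C d k" for F F'
  proof
    fix y assume "y \<in> cohomology_class C d k F"
    then obtain c where c: "c \<in> coboundaries C d k" "y = (\<lambda>x. c x + F x)" unfolding cohomology_class_eq by blast
    have "(\<lambda>x. c x + (F x - F' x)) \<in> coboundaries C d k"
      using coboundaries_combination[OF L c(1) that, of 1 1] by simp
    from cohomology_classI[OF this, of F'] show "y \<in> cohomology_class C d k F'" using c(2) by simp
  qed
  assume d: "(\<lambda>x. F x - F' x) \<in> coboundaries C d k"
  have "(\<lambda>x. F' x - F x) \<in> coboundaries C d k"
    using coboundaries_combination[OF L d d, of "-1" 0] by simp
  then show "cohomology_class C d k F = cohomology_class C d k F'" using sub[OF d] sub by blast
qed

lemma cohomology_class_mult:
  assumes L: "linear_complex C d"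
  shows "cohomology_class C d k F <#>\<^bsub>cocycle_group C d k\<^esub> cohomology_class C d k F' =
    cohomology_class C d k (\<lambda>x. F x + F' x)"
proof (intro equalityI subsetI)
  fix y assume "y \<in> cohomology_class C d k F <#>\<^bsub>cocycle_group C d k\<^esub> cohomology_class C d k F'"
  then obtain c c' where c: "c \<in> coboundaries C d k" "c' \<in> coboundaries C d k" "y = (\<lambda>x. (c x + F x) + (c' x + F' x))"
    by (auto simp: set_mult_def cocycle_group_def cohomology_class_eq)
  have "(\<lambda>x. c x + c' x) \<in> coboundaries C d k"
    using coboundaries_combination[OF L c(1,2), of 1 1] by simp
  from cohomology_classI[OF this, of "\<lambda>x. F x + F' x"]
  show "y \<in> cohomology_class C d k (\<lambda>x. F x + F' x)" using c(3) by (simp add: algebra_simps)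
next
  fix y assume "y \<in> cohomology_class C d k (\<lambda>x. F x + F' x)"
  then obtain c where c: "c \<in> coboundaries C d k" "y = (\<lambda>x. c x + (F x + F' x))"
    unfolding cohomology_class_eq by blast
  have "(\<lambda>x. c x + F x) \<in> cohomology_class C d k F" "(\<lambda>x. 0 + F' x) \<in> cohomology_class C d k F'"
    by (rule cohomology_classI[OF c(1)], rule cohomology_classI[OF coboundaries_zero[OF L]])
  moreover have "y = (\<lambda>x. (c x + F x) + (0 + F' x))" using c(2) by (simp add: algebra_simps)
  ultimately show "y \<in> cohomology_class C d k F <#>\<^bsub>cocycle_group C d k\<^esub> cohomology_class C d k F'"
    unfolding set_mult_def cocycle_group_def by auto
qed

lemma carrier_cohomology: "carrier (cohomology C d k) = cohomology_class C d k ` cocycles C d k"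
  by (auto simp: cohomology_def FactGroup_def RCOSETS_def cohomology_class_def cocycle_group_def)

lemma cochain_map_induces_hom:
  fixes C :: "nat \<Rightarrow> ('x \<Rightarrow> 'v::real_vector) set" and C' :: "nat \<Rightarrow> ('y \<Rightarrow> 'w::real_vector) set"
  assumes L: "linear_complex C d" and L': "linear_complex C' d'" and V: "cochain_map C d C' d' V" and k: "k \<ge> 1"
  shows "\<exists>h \<in> hom (cohomology C d k) (cohomology C' d' k).
    \<forall>F \<in> cocycles C d k. h (cohomology_class C d k F) = cohomology_class C' d' k (V k F)"
proof -
  have V1: "V k F \<in> C' k" if "F \<in> C k" "k \<ge> 1" for F k using V that unfolding cochain_map_def by blast
  have V2: "V k (\<lambda>x. a *\<^sub>R F x + b *\<^sub>R F' x) = (\<lambda>y. a *\<^sub>R V k F y + b *\<^sub>R V k F' y)"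
    if "F \<in> C k" "F' \<in> C k" "k \<ge> 1" for F F' a b k using V that unfolding cochain_map_def by blast
  have V3: "V (k + 1) (d k F) = d' k (V k F)" if "F \<in> C k" "k \<ge> 1" for F k
    using V that unfolding cochain_map_def by blast
  have V0: "V k (\<lambda>_. 0) = (\<lambda>_. 0)" if "k \<ge> 1" for k
    using V2[OF linear_complexD(1)[OF L that] linear_complexD(1)[OF L that] that, of 0 0] by simp
  have cocyc: "V k F \<in> cocycles C' d' k" if "F \<in> cocycles C d k" for F
    using that V1[OF _ k] V3[OF _ k, of F] V0[of "k + 1"] by (simp add: cocycles_def)
  have cob: "V k c \<in> coboundaries C' d' k" if c: "c \<in> coboundaries C d k" for c
  proof (cases "k \<le> 1")
    case True
    then show ?thesis using c V0[OF k] by (simp add: coboundaries_def)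
  next
    case False
    then obtain f where f: "f \<in> C (k - 1)" "c = d (k - 1) f" using c by (auto simp: coboundaries_def)
    have k1: "k - 1 \<ge> 1" "k - 1 + 1 = k" using False by auto
    show ?thesis using V3[OF f(1) k1(1)] V1[OF f(1) k1(1)] False f(2) k1(2) by (simp add: coboundaries_def)
  qed
  have well: "cohomology_class C' d' k (V k F) = cohomology_class C' d' k (V k F')"
    if F: "F \<in> cocycles C d k" "F' \<in> cocycles C d k" "cohomology_class C d k F = cohomology_class C d k F'" for F F'
  proof -
    have "V k (\<lambda>x. F x - F' x) = (\<lambda>y. V k F y - V k F' y)"
      using V2[of F k F' 1 "-1"] F k by (simp add: cocycles_def)
    then show ?thesis
      unfolding cohomology_class_eq_iff[OF L'] using cob F(3) unfolding cohomology_class_eq_iff[OF L] by metis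
  qed
  define h where "h X = cohomology_class C' d' k (V k (SOME F. F \<in> cocycles C d k \<and> cohomology_class C d k F = X))" for X
  have h: "h (cohomology_class C d k F) = cohomology_class C' d' k (V k F)" if F: "F \<in> cocycles C d k" for F
  proof -
    let ?P = "\<lambda>F'. F' \<in> cocycles C d k \<and> cohomology_class C d k F' = cohomology_class C d k F"
    have "?P (SOME F'. ?P F')" by (rule someI[of ?P F]) (use F in simp)
    then show ?thesis unfolding h_def using well F by blast
  qed
  have "h \<in> hom (cohomology C d k) (cohomology C' d' k)"
  proof (rule homI)
    fix X assume "X \<in> carrier (cohomology C d k)"
    then show "h X \<in> carrier (cohomology C' d' k)" using h cocyc by (auto simp: carrier_cohomology)
  next
    fix X Y assume "X \<in> carrier (cohomology C d k)" "Y \<in> carrier (cohomology C d k)"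
    then obtain F F' where F: "F \<in> cocycles C d k" "F' \<in> cocycles C d k"
      "X = cohomology_class C d k F" "Y = cohomology_class C d k F'" by (auto simp: carrier_cohomology)
    have V: "V k (\<lambda>x. F x + F' x) = (\<lambda>y. V k F y + V k F' y)"
      using V2[of F k F' 1 1] F k by (simp add: cocycles_def)
    have "h (X \<otimes>\<^bsub>cohomology C d k\<^esub> Y) = h (cohomology_class C d k (\<lambda>x. F x + F' x))"
      unfolding cohomology_def FactGroup_def using cohomology_class_mult[OF L] by (simp add: F)
    also have "\<dots> = cohomology_class C' d' k (\<lambda>y. V k F y + V k F' y)"
      using h[OF cocycles_add[OF L k F(1,2)]] by (simp add: V)
    also have "\<dots> = h X \<otimes>\<^bsub>cohomology C' d' k\<^esub> h Y"
      unfolding cohomology_def FactGroup_def using cohomology_class_mult[OF L'] by (simp add: F h)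
    finally show "h (X \<otimes>\<^bsub>cohomology C d k\<^esub> Y) = h X \<otimes>\<^bsub>cohomology C' d' k\<^esub> h Y" .
  qed
  then show ?thesis using h by blast
qed

section \<open>The van Est map\<close>

lemma alt_linear: "linear L \<Longrightarrow> alt n (\<lambda>v. L (f v)) u = L (alt n f u)"
  by (simp add: alt_def linear_sum linear_cmul)

context rota_baxter
begin

text \<open>
Renaming the time variables by the permutation moves it from the order of differentiation to the vectors.
\<close>

lemma VE_eq_alt_iter_deriv:
  "VE H \<Phi> \<B> k F u = alt (k - 1) (\<lambda>w. iter_deriv [0..<k - 1] (\<lambda>t. F (\<lambda>i. \<gamma> (w i) (t i))) (\<lambda>_. 0)) u"
proof -
  have "iter_deriv (map s [0..<k - 1]) (\<lambda>t. F (\<lambda>i. \<gamma> (u (s i)) (t (s i)))) (\<lambda>_. 0) =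
      iter_deriv [0..<k - 1] (\<lambda>t. F (\<lambda>i. \<gamma> (u (s i)) (t i))) (\<lambda>_. 0)" if "s permutes {..<k - 1}" for s
  proof -
    have "(\<lambda>_. 0 :: real) \<circ> s = (\<lambda>_. 0)" by auto
    then show ?thesis
      using iter_deriv_reindex[OF permutes_inj[OF that], of "[0..<k - 1]" "\<lambda>t. F (\<lambda>i. \<gamma> (u (s i)) (t i))" "\<lambda>_. 0"]
      by simp
  qed
  then show ?thesis unfolding VE_def alt_def Let_def lie_exp_descendent by simp
qed

lemma VE_eq: "smooth_pow_map (k - 1) (atlas H) F \<Longrightarrow> VE H \<Phi> \<B> k F = alt (k - 1) (mixed_partial (k - 1) F)"
  by (rule ext) (simp add: VE_eq_alt_iter_deriv iter_deriv_cochain)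

lemma mixed_partial_multilinear:
  assumes F: "smooth_pow_map n (atlas H) F" and i: "i < n"
  shows "mixed_partial n F (w(i := a *\<^sub>R x + b *\<^sub>R y)) = a *\<^sub>R mixed_partial n F (w(i := x)) + b *\<^sub>R mixed_partial n F (w(i := y))"
  unfolding mixed_partial_def
  by (rule slots_multilinear[OF HH.open_U smooth_local_rep[OF F]]) (use i const_box in auto)

lemma mixed_partial_combination:
  assumes F: "smooth_pow_map n (atlas H) F" "smooth_pow_map n (atlas H) F'"
  shows "mixed_partial n (\<lambda>h. a *\<^sub>R F h + b *\<^sub>R F' h) w = a *\<^sub>R mixed_partial n F w + b *\<^sub>R mixed_partial n F' w"
  unfolding mixed_partial_def
  by (rule slots_combination[OF HH.open_U _ const_box F[THEN smooth_local_rep]]) (auto simp: local_rep_def)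

lemma alternating_multilinear_alt_mixed_partial:
  assumes F: "smooth_pow_map n (atlas H) F"
  shows "alternating_multilinear n (alt n (mixed_partial n F))"
  unfolding alternating_multilinear_def
proof (intro conjI allI impI)
  show "depends_on_first n (alt n (mixed_partial n F))"
    unfolding depends_on_first_def alt_def
  proof (intro allI impI sum.cong refl)
    fix u u' :: "nat \<Rightarrow> 'b" and s assume u: "\<forall>i<n. u i = u' i" and s: "s \<in> {s. s permutes {..<n}}"
    have "mixed_partial n F (u \<circ> s) = mixed_partial n F (u' \<circ> s)" unfolding mixed_partial_def
      by (rule fun_cong[OF slots_cong]) (use u s permutes_in_image in fastforce)
    then show "real_of_int (sign s) *\<^sub>R mixed_partial n F (u \<circ> s) = real_of_int (sign s) *\<^sub>R mixed_partial n F (u' \<circ> s)" by simp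
  qed
next
  fix u :: "nat \<Rightarrow> 'b" and i assume i: "i < n"
  have comb: "alt n (mixed_partial n F) (u(i := a *\<^sub>R x + b *\<^sub>R y)) = a *\<^sub>R alt n (mixed_partial n F) (u(i := x)) + b *\<^sub>R alt n (mixed_partial n F) (u(i := y))" for a b x y
    unfolding alt_def scaleR_sum_right sum.distrib[symmetric]
  proof (rule sum.cong[OF refl])
    fix s assume "s \<in> {s. s permutes {..<n}}"
    then have s: "s permutes {..<n}" by simp
    define k where "k = inv_into UNIV s i"
    have k: "k < n" using permutes_in_image[OF permutes_inv[OF s], of i] i by (simp add: k_def)
    have sk: "s j = i \<longleftrightarrow> j = k" for j unfolding k_def using permutes_inverses[OF s] by metis
    have upd: "u(i := z) \<circ> s = (u \<circ> s)(k := z)" for z by (auto simp: fun_eq_iff sk)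
    show "real_of_int (sign s) *\<^sub>R mixed_partial n F (u(i := a *\<^sub>R x + b *\<^sub>R y) \<circ> s) =
       a *\<^sub>R real_of_int (sign s) *\<^sub>R mixed_partial n F (u(i := x) \<circ> s) + b *\<^sub>R real_of_int (sign s) *\<^sub>R mixed_partial n F (u(i := y) \<circ> s)"
      unfolding upd mixed_partial_multilinear[OF F k] by (simp add: scaleR_add_right mult.commute)
  qed
  show "linear (\<lambda>y. alt n (mixed_partial n F) (u(i := y)))"
  proof (rule linearI)
    fix x y and r :: real
    show "alt n (mixed_partial n F) (u(i := x + y)) = alt n (mixed_partial n F) (u(i := x)) + alt n (mixed_partial n F) (u(i := y))"
      using comb[of 1 x 1 y] by simp
    show "alt n (mixed_partial n F) (u(i := r *\<^sub>R x)) = r *\<^sub>R alt n (mixed_partial n F) (u(i := x))"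
      using comb[of r x 0 x] by simp
  qed
next
  fix u :: "nat \<Rightarrow> 'b" and i j assume "i < n" "j < n" "i \<noteq> j \<and> u i = u j"
  then show "alt n (mixed_partial n F) u = 0" by (intro alt_alternating[of i n j]) auto
qed

text \<open>
Alternation of \<open>iter_deriv_rb_d\<close>: the term with \<open>\<theta>\<close> is expanded by its first entry, the second-order terms vanish, and the
remaining ones are handled by \<open>alt_bracket_slots\<close>.
\<close>

lemma VE_rb_d:
  fixes F :: "(nat \<Rightarrow> 'h) \<Rightarrow> 'a"
  assumes F: "smooth_pow_map n (atlas H) F"
  shows "VE H \<Phi> \<B> (Suc (Suc n)) (rb_d G H \<Phi> \<B> (Suc n) F) = lie_rb_d G H \<phi> B (Suc n) (VE H \<Phi> \<B> (Suc n) F)"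
proof
  fix u
  have VE: "VE H \<Phi> \<B> (Suc n) F = alt n (mixed_partial n F)" using VE_eq[of "Suc n" F] F by simp
  have "VE H \<Phi> \<B> (Suc (Suc n)) (rb_d G H \<Phi> \<B> (Suc n) F) u =
    alt (Suc n) (\<lambda>w. theta G \<phi> B (w 0) (mixed_partial n F (\<lambda>j. w (Suc j))) +
      (\<Sum>i<n. (-1) ^ Suc i *\<^sub>R (doubled_partial n i F w + mixed_partial n F ((omit (Suc i) w)(i := KK.\<beta> (w i) (w (Suc i))))))) u"
    unfolding VE_eq_alt_iter_deriv using iter_deriv_rb_d[OF F] by simp
  also have "\<dots> = alt (Suc n) (\<lambda>w. theta G \<phi> B (w 0) (mixed_partial n F (\<lambda>j. w (Suc j)))) u +
      (\<Sum>i<n. (-1) ^ Suc i *\<^sub>R (alt (Suc n) (doubled_partial n i F) u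
        + alt (Suc n) (\<lambda>w. mixed_partial n F ((omit (Suc i) w)(i := KK.\<beta> (w i) (w (Suc i))))) u))"
    unfolding alt_add alt_sum alt_scaleR ..
  also have "alt (Suc n) (\<lambda>w. theta G \<phi> B (w 0) (mixed_partial n F (\<lambda>j. w (Suc j)))) u =
      (\<Sum>i<Suc n. (-1) ^ i *\<^sub>R theta G \<phi> B (u i) (alt n (mixed_partial n F) (omit i u)))"
  proof -
    have "alt (Suc n) (\<lambda>w. theta G \<phi> B (w 0) (mixed_partial n F (\<lambda>j. w (Suc j)))) u =
       alt (Suc n) (\<lambda>w. (\<lambda>x v. theta G \<phi> B x (mixed_partial n F v)) (w 0) (omit 0 w)) u"
      by (simp add: omit_def)
    also have "\<dots> = (\<Sum>a<Suc n. (-1) ^ (0 + a) *\<^sub>R alt n (\<lambda>v. theta G \<phi> B (u a) (mixed_partial n F v)) (omit a u))"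
      by (rule alt_by_value) simp
    finally show ?thesis by (simp only: alt_linear[OF theta_linear] add_0)
  qed
  also have "(\<Sum>i<n. (-1) ^ Suc i *\<^sub>R (alt (Suc n) (doubled_partial n i F) u
        + alt (Suc n) (\<lambda>w. mixed_partial n F ((omit (Suc i) w)(i := KK.\<beta> (w i) (w (Suc i))))) u)) =
      (\<Sum>i<n. (-1) ^ Suc i *\<^sub>R alt (Suc n) (\<lambda>w. mixed_partial n F ((omit (Suc i) w)(i := KK.\<beta> (w i) (w (Suc i))))) u)"
  proof (rule sum.cong[OF refl])
    fix i assume "i \<in> {..<n}"
    then have "alt (Suc n) (doubled_partial n i F) u = 0"
      by (intro alt_eq_0_of_swap_invariant[of i _ "Suc i"] doubled_partial_swap[OF F]) auto
    then show "(-1) ^ Suc i *\<^sub>R (alt (Suc n) (doubled_partial n i F) u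
        + alt (Suc n) (\<lambda>w. mixed_partial n F ((omit (Suc i) w)(i := KK.\<beta> (w i) (w (Suc i))))) u) =
      (-1) ^ Suc i *\<^sub>R alt (Suc n) (\<lambda>w. mixed_partial n F ((omit (Suc i) w)(i := KK.\<beta> (w i) (w (Suc i))))) u" by simp
  qed
  also have "\<dots> = (\<Sum>j<Suc n. \<Sum>i<j. (-1) ^ (i + j) *\<^sub>R
       alt n (mixed_partial n F) (case_nat (KK.\<beta> (u i) (u j) - KK.\<beta> (u j) (u i)) (omit i (omit j u))))"
  proof (rule alt_bracket_slots)
    show "mixed_partial n F (v(i := x - y)) = mixed_partial n F (v(i := x)) - mixed_partial n F (v(i := y))" if "i < n" for v i x y
      using mixed_partial_multilinear[OF F that, of v 1 x "-1" y] by simp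
  qed
  finally show "VE H \<Phi> \<B> (Suc (Suc n)) (rb_d G H \<Phi> \<B> (Suc n) F) u = lie_rb_d G H \<phi> B (Suc n) (VE H \<Phi> \<B> (Suc n) F) u"
    unfolding VE lie_rb_d_def Let_def descendent_bracket_eq by (simp del: sum.lessThan_Suc)
qed

lemma cochain_map_VE:
  "cochain_map (rb_cochains H :: nat \<Rightarrow> ((nat \<Rightarrow> 'h) \<Rightarrow> 'a) set) (rb_d G H \<Phi> \<B>)
     lie_rb_cochains (lie_rb_d G H \<phi> B) (VE H \<Phi> \<B>)"
  unfolding cochain_map_def
proof (intro allI impI conjI ballI)
  fix k :: nat and F :: "(nat \<Rightarrow> 'h) \<Rightarrow> 'a" assume k: "1 \<le> k" and F: "F \<in> rb_cochains H k"
  have F': "smooth_pow_map (k - 1) (atlas H) F" using F by (simp add: rb_cochains_def)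
  show "VE H \<Phi> \<B> k F \<in> lie_rb_cochains k"
    using alternating_multilinear_alt_mixed_partial[OF F'] by (simp add: VE_eq[OF F'] lie_rb_cochains_def)
  show "VE H \<Phi> \<B> (k + 1) (rb_d G H \<Phi> \<B> k F) = lie_rb_d G H \<phi> B k (VE H \<Phi> \<B> k F)"
    using VE_rb_d[OF F'] k by simp
  fix K :: "(nat \<Rightarrow> 'h) \<Rightarrow> 'a" and a b :: real assume K: "K \<in> rb_cochains H k"
  have K': "smooth_pow_map (k - 1) (atlas H) K" using K by (simp add: rb_cochains_def)
  show "VE H \<Phi> \<B> k (\<lambda>x. a *\<^sub>R F x + b *\<^sub>R K x) = (\<lambda>y. a *\<^sub>R VE H \<Phi> \<B> k F y + b *\<^sub>R VE H \<Phi> \<B> k K y)"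
  proof -
    have "mixed_partial (k - 1) (\<lambda>x. a *\<^sub>R F x + b *\<^sub>R K x) = (\<lambda>w. a *\<^sub>R mixed_partial (k - 1) F w + b *\<^sub>R mixed_partial (k - 1) K w)"
      by (rule ext) (rule mixed_partial_combination[OF F' K'])
    then show ?thesis
      unfolding VE_eq[OF smooth_pow_map_combination[OF HH.charts F' K']] VE_eq[OF F'] VE_eq[OF K']
      by (intro ext) (simp only: alt_add alt_scaleR)
  qed
qed

lemma linear_complex_rb:
  "linear_complex (rb_cochains H :: nat \<Rightarrow> ((nat \<Rightarrow> 'h) \<Rightarrow> 'a) set) (rb_d G H \<Phi> \<B>)"
  unfolding linear_complex_def
proof (intro allI impI conjI ballI)
  fix k :: nat and F K :: "(nat \<Rightarrow> 'h) \<Rightarrow> 'a" and a b :: real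
  assume "F \<in> rb_cochains H k" "K \<in> rb_cochains H k"
  then show "(\<lambda>x. a *\<^sub>R F x + b *\<^sub>R K x) \<in> rb_cochains H k"
    by (simp add: rb_cochains_def smooth_pow_map_combination[OF HH.charts])
  note L = bounded_linear.linear[OF bounded_linear_Theta]
  show "rb_d G H \<Phi> \<B> k (\<lambda>x. a *\<^sub>R F x + b *\<^sub>R K x) = (\<lambda>x. a *\<^sub>R rb_d G H \<Phi> \<B> k F x + b *\<^sub>R rb_d G H \<Phi> \<B> k K x)"
    by (rule ext) (simp add: rb_d_def Let_def linear_add[OF L] linear_cmul[OF L] scaleR_add_right
        scaleR_diff_right sum.distrib scaleR_sum_right mult.commute)
qed (simp add: rb_cochains_def smooth_pow_map_zero)

lemma linear_complex_lie_rb: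
  "linear_complex (lie_rb_cochains :: nat \<Rightarrow> ((nat \<Rightarrow> 'b) \<Rightarrow> 'a) set) (lie_rb_d G H \<phi> B)"
  unfolding linear_complex_def
proof (intro allI impI conjI ballI)
  fix k :: nat and f g :: "(nat \<Rightarrow> 'b) \<Rightarrow> 'a" and a b :: real
  assume fg: "f \<in> lie_rb_cochains k" "g \<in> lie_rb_cochains k"
  have "depends_on_first (k - 1) (\<lambda>x. a *\<^sub>R f x + b *\<^sub>R g x)"
    using fg unfolding lie_rb_cochains_def alternating_multilinear_def depends_on_first_def mem_Collect_eq by metis
  moreover have "linear (\<lambda>y. a *\<^sub>R f (u(i := y)) + b *\<^sub>R g (u(i := y)))" if "i < k - 1" for u i
    using fg that unfolding lie_rb_cochains_def alternating_multilinear_def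
    by (intro linear_compose_add linear_compose_scale_right) auto
  ultimately show "(\<lambda>x. a *\<^sub>R f x + b *\<^sub>R g x) \<in> lie_rb_cochains k"
    using fg unfolding lie_rb_cochains_def alternating_multilinear_def by simp
  show "lie_rb_d G H \<phi> B k (\<lambda>x. a *\<^sub>R f x + b *\<^sub>R g x) = (\<lambda>x. a *\<^sub>R lie_rb_d G H \<phi> B k f x + b *\<^sub>R lie_rb_d G H \<phi> B k g x)"
    by (rule ext) (simp add: lie_rb_d_def Let_def linear_add[OF theta_linear] linear_cmul[OF theta_linear]
        scaleR_add_right sum.distrib scaleR_sum_right mult.commute del: sum.lessThan_Suc)
qed (auto simp: lie_rb_cochains_def alternating_multilinear_def depends_on_first_def linear_zero)

end

theorem theorem4p7:
  fixes G :: "('g::{t2_space, second_countable_topology}, 'a::{real_inner, banach}) lie_struct"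
    and H :: "('h::{t2_space, second_countable_topology}, 'b::{real_inner, banach}) lie_struct"
    and \<Phi> :: "'g \<Rightarrow> 'h \<Rightarrow> 'h"
    and \<phi> :: "'a \<Rightarrow> 'b \<Rightarrow> 'b"
    and \<B> :: "'h \<Rightarrow> 'g"
    and B :: "'b \<Rightarrow> 'a"
  assumes "lie_group G" and "lie_group H"
    and "lie_action G H \<Phi>" and "\<phi> = diff_action G H \<Phi>"
    and "rel_rota_baxter G H \<Phi> \<B>" and "B = tangent_map_unit H G \<B>"
  shows "cochain_map
           (rb_cochains H :: nat \<Rightarrow> ((nat \<Rightarrow> 'h) \<Rightarrow> 'a) set) (rb_d G H \<Phi> \<B>)
           lie_rb_cochains (lie_rb_d G H \<phi> B)
           (VE H \<Phi> \<B>) \<and>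
         (\<forall>k\<ge>1. \<exists>VE_star \<in> hom (cohomology (rb_cochains H) (rb_d G H \<Phi> \<B>) k)
                               (cohomology lie_rb_cochains (lie_rb_d G H \<phi> B) k).
            \<forall>F \<in> cocycles (rb_cochains H) (rb_d G H \<Phi> \<B>) k.
              VE_star (cohomology_class (rb_cochains H) (rb_d G H \<Phi> \<B>) k F) =
              cohomology_class lie_rb_cochains (lie_rb_d G H \<phi> B) k (VE H \<Phi> \<B> k F))"
proof -
  interpret rota_baxter G H \<Phi> \<B> by unfold_locales (fact assms)+
  show ?thesis
    unfolding \<open>\<phi> = diff_action G H \<Phi>\<close> \<open>B = tangent_map_unit H G \<B>\<close>
    using cochain_map_VE cochain_map_induces_hom[OF linear_complex_rb linear_complex_lie_rb cochain_map_VE] by blast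
qed

end
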